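(* Let $s\ge4$, let $P_1,\dots,P_s$ be distinct $K$-rational points of $\mathbb{P}^2$ lying on a non-singular conic $\mathcal{C}=\mathcal{Z}^+(C)$, let $1\le m_1\le\cdots\le m_s$, and let $\mathbb{W}=m_1P_1+\cdots+m_sP_s$. Let $\mu=\sum_{j=1}^sm_j+s$ and $\varrho=m_s+m_{s-1}$. (a) If $\mu\ge2\varrho+4$ then $$\mathrm{HF}_{\Omega^1_{R_{\mathbb{W}}/K}}(i)=\begin{cases}\sum_{j=1}^s\frac{(m_j+1)(3m_j-2)}{2}&\text{if }i\ge\lfloor\frac{\mu}{2}\rfloor,\\[2pt]3\sum_{j=1}^s\binom{m_j+1}{2}-2i-1&\text{if }r_{\mathbb{W}}+2\le i<\lfloor\frac{\mu}{2}\rfloor,\\[2pt]4\sum_{j=1}^s\binom{m_j+1}{2}-2i-1-\mathrm{HF}_{\mathbb{W}}(i-2)&\text{if }i=r_{\mathbb{W}}+1,\\[2pt]\mathrm{HF}_{\mathbb{W}}(i)+3\mathrm{HF}_{\mathbb{W}}(i-1)-\mathrm{HF}_{\mathbb{W}}(i-2)-2i-1&\text{if }0\le i\le r_{\mathbb{W}}.\end{cases}$$ (b) If $\mu\le2\varrho+3$ and $\mathbb{Y}:=(m_1+1)P_1+\cdots+(m_{s-2}+1)P_{s-2}+m_{s-1}P_{s-1}+m_sP_s$, then $$\mathrm{HF}_{\Omega^1_{R_{\mathbb{W}}/K}}(i)=\begin{cases}\sum_{j=1}^s\frac{(m_j+1)(3m_j-2)}{2}&\text{if }i\ge\varrho+1,\\[2pt]4\sum_{j=1}^s\binom{m_j+1}{2}-i-1-\mathrm{HF}_{\mathbb{Y}}(i-1)&\text{if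 }r_{\mathbb{W}}+1\le i\le\varrho,\\[2pt]\mathrm{HF}_{\mathbb{W}}(i)+3\mathrm{HF}_{\mathbb{W}}(i-1)-\mathrm{HF}_{\mathbb{Y}}(i-1)-i-1&\text{if }0\le i\le r_{\mathbb{W}}.\end{cases}$$
   Context: $K$ is a field of characteristic zero, $S=K[X_0,X_1,X_2]$ with the standard grading is the homogeneous coordinate ring of $\mathbb{P}^2$ over $K$, and $C\in S$ is a quadratic form whose zero locus $\mathcal{Z}^+(C)$ is a non-singular conic. Coordinates are chosen so that no $P_j$ lies on $X_0=0$. With $\wp_j\subseteq S$ the homogeneous vanishing ideal of $P_j$, the fat point scheme $\mathbb{W}=m_1P_1+\cdots+m_sP_s$ has homogeneous vanishing ideal $I_{\mathbb{W}}=\wp_1^{m_1}\cap\cdots\cap\wp_s^{m_s}$ and coordinate ring $R_{\mathbb{W}}=S/I_{\mathbb{W}}$; $\mathrm{HF}_{\mathbb{W}}(i)=\dim_K(R_{\mathbb{W}})_i$ (zero for $i<0$), and $r_{\mathbb{W}}$ is the regularity index of $R_{\mathbb{W}}$, i.e. the least integer $i$ such that $\mathrm{HF}_{\mathbb{W}}(j)$ equals the (constant) Hilbert polynomial of $R_{\mathbb{W}}$ for all $j\ge i$. The same notation is used for $\mathbb{Y}$. $\Omega^1_{R_{\mathbb{W}}/K}$ is the module of Kähler differentials of $R_{\mathbb{W}}/K$, graded with $\deg(dx_i)=1$ where $x_i$ is the image of $X_i$; $\mathrm{HF}_M(i)=\dim_KM_i$. *)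

theory Defs
  imports
    "HOL-Library.Poly_Mapping"
    "HOL-Library.Numeral_Type"
    "HOL-Computational_Algebra.Polynomial"
    "HOL-Algebra.Algebraic_Closure_Type"
    "HOL-Algebra.Ideal_Product"
    "HOL-Algebra.QuotRing"
    "Jordan_Normal_Form.Missing_VectorSpace"
begin

section \<open>Modules by generators and relations\<close>

text \<open>The free \<open>A\<close>-module on a set \<open>B\<close>, as the finitely supported functions inside
  \<^const>\<open>ring.func_space\<close>, and its basis vectors.\<close>

definition free_module :: "('a, 'm) ring_scheme \<Rightarrow> 'x set \<Rightarrow> ('a, 'x \<Rightarrow> 'a) module" where
  "free_module A B =
    (ring.func_space A B)\<lparr>carrier := {f \<in> B \<rightarrow>\<^sub>E carrier A. finite {x \<in> B. f x \<noteq> \<zero>\<^bsub>A\<^esub>}}\<rparr>"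

definition free_gen :: "('a, 'm) ring_scheme \<Rightarrow> 'x set \<Rightarrow> 'x \<Rightarrow> ('x \<Rightarrow> 'a)" where
  "free_gen A B a = (\<lambda>x\<in>B. if x = a then \<one>\<^bsub>A\<^esub> else \<zero>\<^bsub>A\<^esub>)"

text \<open>The quotient \<open>M / N\<close> of a module by a submodule. The fields \<^const>\<open>monoid.mult\<close> and
  \<^const>\<open>one\<close> of the record carry no meaning for modules.\<close>

definition quotient_module ::
    "('a, 'b, 'm) module_scheme \<Rightarrow> 'b set \<Rightarrow> ('a, 'b set) module" where
  "quotient_module M N =
    \<lparr>carrier = a_rcosets\<^bsub>M\<^esub> N, monoid.mult = (\<lambda>_ _. N), one = N, zero = N, add = set_add M,
     module.smult = (\<lambda>a Y. \<Union>x\<in>Y. N +>\<^bsub>M\<^esub> (a \<odot>\<^bsub>M\<^esub> x))\<rparr>"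

section \<open>Kaehler differentials\<close>

text \<open>A \<open>K\<close>-algebra \<open>A\<close> is a record with \<^term>\<open>algebra K A\<close>. The module of Kaehler differentials
  of \<open>A/K\<close> is the free \<open>A\<close>-module on the symbols \<open>da\<close>, \<open>a \<in> A\<close>, modulo
  \<open>d(a + b) = da + db\<close>, \<open>d(ab) = a db + b da\<close> and \<open>d(c\<cdot>1) = 0\<close> for \<open>c \<in> K\<close>.\<close>

definition kaehler_relations ::
    "('k, 'l) ring_scheme \<Rightarrow> ('k, 'a, 'm) module_scheme \<Rightarrow> ('a \<Rightarrow> 'a) set" where
  "kaehler_relations K A =
    (let F = free_module A (carrier A); \<delta> = free_gen A (carrier A) in
      {\<delta> (a \<oplus>\<^bsub>A\<^esub> b) \<ominus>\<^bsub>F\<^esub> (\<delta> a \<oplus>\<^bsub>F\<^esub> \<delta> b) | a b. a \<in> carrier A \<and> b \<in> carrier A} \<union>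
      {\<delta> (a \<otimes>\<^bsub>A\<^esub> b) \<ominus>\<^bsub>F\<^esub> (a \<odot>\<^bsub>F\<^esub> \<delta> b \<oplus>\<^bsub>F\<^esub> b \<odot>\<^bsub>F\<^esub> \<delta> a) | a b. a \<in> carrier A \<and> b \<in> carrier A} \<union>
      {\<delta> (c \<odot>\<^bsub>A\<^esub> \<one>\<^bsub>A\<^esub>) | c. c \<in> carrier K})"

definition kaehler_submodule ::
    "('k, 'l) ring_scheme \<Rightarrow> ('k, 'a, 'm) module_scheme \<Rightarrow> ('a \<Rightarrow> 'a) set" where
  "kaehler_submodule K A = module.span A (free_module A (carrier A)) (kaehler_relations K A)"

definition kaehler ::
    "('k, 'l) ring_scheme \<Rightarrow> ('k, 'a, 'm) module_scheme \<Rightarrow> ('a, ('a \<Rightarrow> 'a) set) module" where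
  "kaehler K A = quotient_module (free_module A (carrier A)) (kaehler_submodule K A)"

definition kaehler_d ::
    "('k, 'l) ring_scheme \<Rightarrow> ('k, 'a, 'm) module_scheme \<Rightarrow> 'a \<Rightarrow> ('a \<Rightarrow> 'a) set" where
  "kaehler_d K A a =
    kaehler_submodule K A +>\<^bsub>free_module A (carrier A)\<^esub> free_gen A (carrier A) a"

text \<open>An \<open>A\<close>-module regarded as a \<open>K\<close>-module.\<close>

definition restrict_scalars ::
    "('k, 'a, 'm) module_scheme \<Rightarrow> ('a, 'b, 'n) module_scheme \<Rightarrow> ('k, 'b) module" where
  "restrict_scalars A M =
    \<lparr>carrier = carrier M, monoid.mult = monoid.mult M, one = one M, zero = zero M, add = add M,
     module.smult = (\<lambda>c x. (c \<odot>\<^bsub>A\<^esub> \<one>\<^bsub>A\<^esub>) \<odot>\<^bsub>M\<^esub> x)\<rparr>"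

section \<open>The polynomial ring in three variables\<close>

type_synonym 'k poly3 = "(3 \<Rightarrow>\<^sub>0 nat) \<Rightarrow>\<^sub>0 'k"

abbreviation base_field :: "'k::field ring" where
  "base_field \<equiv> ring_of_type_algebra"

abbreviation poly3_ring :: "'k::field poly3 ring" where
  "poly3_ring \<equiv> ring_of_type_algebra"

definition const3 :: "'k::zero \<Rightarrow> 'k poly3" where
  "const3 c = Poly_Mapping.single 0 c"

definition var3 :: "3 \<Rightarrow> 'k::zero_neq_one poly3" where
  "var3 j = Poly_Mapping.single (Poly_Mapping.single j 1) 1"

definition eval3 :: "'k::comm_semiring_1 poly3 \<Rightarrow> (3 \<Rightarrow> 'k) \<Rightarrow> 'k" where
  "eval3 f p = (\<Sum>t\<in>Poly_Mapping.keys f.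
     Poly_Mapping.lookup f t * (\<Prod>j\<in>UNIV. p j ^ Poly_Mapping.lookup t j))"

definition partial3 :: "3 \<Rightarrow> 'k::comm_semiring_1 poly3 \<Rightarrow> 'k poly3" where
  "partial3 j f = (\<Sum>t\<in>Poly_Mapping.keys f.
     Poly_Mapping.single (t - Poly_Mapping.single j 1)
       (of_nat (Poly_Mapping.lookup t j) * Poly_Mapping.lookup f t))"

text \<open>Homogeneous of degree \<open>i\<close>, with \<open>i\<close> an integer: for \<open>i < 0\<close> only \<open>0\<close> qualifies.\<close>

definition homogeneous3 :: "int \<Rightarrow> 'k::zero poly3 \<Rightarrow> bool" where
  "homogeneous3 i f \<longleftrightarrow>
    (\<forall>t\<in>Poly_Mapping.keys f. int (\<Sum>j\<in>UNIV. Poly_Mapping.lookup t j) = i)"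

section \<open>Points and conics in the projective plane\<close>

text \<open>A \<open>K\<close>-rational point is given by a nonzero vector of homogeneous coordinates.\<close>

definition same_point :: "(3 \<Rightarrow> 'k::field) \<Rightarrow> (3 \<Rightarrow> 'k) \<Rightarrow> bool" where
  "same_point p q \<longleftrightarrow> (\<exists>c. c \<noteq> 0 \<and> p = (\<lambda>j. c * q j))"

text \<open>The zero locus of the quadratic form \<open>C\<close> is a non-singular conic: the Jacobian criterion at
  all points over the algebraic closure. It excludes \<open>C = 0\<close>.\<close>

definition nonsingular_conic :: "'k::field poly3 \<Rightarrow> bool" where
  "nonsingular_conic C \<longleftrightarrow> homogeneous3 2 C \<and>
    (\<forall>p :: 3 \<Rightarrow> 'k alg_closure. p \<noteq> (\<lambda>_. 0) \<and> eval3 (Poly_Mapping.map to_ac C) p = 0 \<longrightarrow>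
       (\<exists>j. eval3 (Poly_Mapping.map to_ac (partial3 j C)) p \<noteq> 0))"

section \<open>Fat point schemes\<close>

definition vanishing_ideal :: "(3 \<Rightarrow> 'k::field) \<Rightarrow> 'k poly3 set" where
  "vanishing_ideal p = Idl\<^bsub>poly3_ring\<^esub> {f. (\<exists>i. homogeneous3 i f) \<and> eval3 f p = 0}"

text \<open>Powers are powers in the monoid \<^const>\<open>ideals_set\<close> of ideals under multiplication.\<close>

definition fat_ideal :: "nat \<Rightarrow> (nat \<Rightarrow> nat) \<Rightarrow> (nat \<Rightarrow> 3 \<Rightarrow> 'k::field) \<Rightarrow> 'k poly3 set" where
  "fat_ideal s m P = (\<Inter>j\<in>{1..s}. vanishing_ideal (P j) [^]\<^bsub>ideals_set poly3_ring\<^esub> m j)"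

text \<open>\<open>S/I\<close> as a \<open>K\<close>-algebra, and its homogeneous components.\<close>

definition coord_ring :: "'k::field poly3 set \<Rightarrow> ('k, 'k poly3 set) module" where
  "coord_ring I = ring.extend (poly3_ring Quot I)
     (module.fields (\<lambda>c x. (I +>\<^bsub>poly3_ring\<^esub> const3 c) \<otimes>\<^bsub>poly3_ring Quot I\<^esub> x))"

definition coord_ring_deg :: "'k::field poly3 set \<Rightarrow> int \<Rightarrow> 'k poly3 set set" where
  "coord_ring_deg I i = {I +>\<^bsub>poly3_ring\<^esub> f | f. homogeneous3 i f}"

definition HF :: "'k::field poly3 set \<Rightarrow> int \<Rightarrow> nat" where
  "HF I i = vectorspace.dim base_field ((coord_ring I)\<lparr>carrier := coord_ring_deg I i\<rparr>)"

text \<open>The Hilbert polynomial of a Hilbert function and the regularity index.\<close>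

definition hilbert_polynomial :: "(int \<Rightarrow> nat) \<Rightarrow> rat poly" where
  "hilbert_polynomial H = (THE q. \<forall>\<^sub>F i in at_top. of_nat (H i) = poly q (of_int i))"

definition regularity_index :: "(int \<Rightarrow> nat) \<Rightarrow> int" where
  "regularity_index H =
    (LEAST i. \<forall>j\<ge>i. of_nat (H j) = poly (hilbert_polynomial H) (of_int j))"

text \<open>The grading of \<open>\<Omega>\<close> with \<open>deg(dx\<^sub>j) = 1\<close>: its degree \<open>i\<close> component is
  \<open>R\<^sub>i\<^sub>-\<^sub>1 dx\<^sub>0 + R\<^sub>i\<^sub>-\<^sub>1 dx\<^sub>1 + R\<^sub>i\<^sub>-\<^sub>1 dx\<^sub>2\<close>.\<close>

definition kaehler_deg ::
    "'k::field poly3 set \<Rightarrow> int \<Rightarrow> ('k poly3 set \<Rightarrow> 'k poly3 set) set set" where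
  "kaehler_deg I i =
    (let R = coord_ring I; \<Omega> = kaehler base_field R in
      {\<Oplus>\<^bsub>\<Omega>\<^esub>j\<in>UNIV. a j \<odot>\<^bsub>\<Omega>\<^esub> kaehler_d base_field R (I +>\<^bsub>poly3_ring\<^esub> var3 j) | a.
        \<forall>j. a j \<in> coord_ring_deg I (i - 1)})"

definition HF_kaehler :: "'k::field poly3 set \<Rightarrow> int \<Rightarrow> nat" where
  "HF_kaehler I i =
    vectorspace.dim base_field
      ((restrict_scalars (coord_ring I) (kaehler base_field (coord_ring I)))
        \<lparr>carrier := kaehler_deg I i\<rparr>)"

end

theory Submission
  imports Defs "HOL-Library.Function_Algebras"
begin

text \<open>Let \<open>R = S/I\<^sub>W\<close> and let \<open>V\<close> be the scheme with multiplicities \<open>m\<^sub>j + 1\<close>. The map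
  \<open>b \<mapsto> \<Sum>\<^sub>j b\<^sub>j dx\<^sub>j\<close> presents \<open>\<Omega>\<close> as \<open>R\<^sup>3(-1)\<close> modulo the image of the gradient \<open>I\<^sub>W \<rightarrow> R\<^sup>3\<close>. In characteristic
  zero a form lies in the \<open>(m + 1)\<close>-st power of the ideal of a point if and only if the form and its partial
  derivatives lie in the \<open>m\<close>-th power (\<open>m > 0\<close>), so the kernel of the gradient is \<open>I\<^sub>V\<close>, and
  \<open>HF\<^sub>\<Omega>(i) = 3 HF\<^sub>W(i - 1) + HF\<^sub>W(i) - HF\<^sub>V(i)\<close>.

  The Hilbert function of \<open>V\<close> is found by Bezout arguments. A form of degree \<open>i\<close> in \<open>I\<^sub>V\<close> restricted to the
  line through \<open>P\<^sub>s\<^sub>-\<^sub>1\<close> and \<open>P\<^sub>s\<close> has \<open>\<rho> + 2\<close> zeros; if \<open>i \<le> \<rho> + 1\<close>, it is divisible by the equation of the line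
  and the quotient lies in \<open>I\<^sub>Y\<close>. Pulled back along a rational parametrization of the conic it has \<open>\<mu>\<close> zeros
  and degree at most \<open>2 i\<close>; if \<open>2 i < \<mu>\<close>, it is divisible by \<open>C\<close> and the quotient lies in \<open>I\<^sub>W\<close>. In the remaining
  degrees the points impose independent conditions.\<close>

text \<open>With multiplicities m_j + 1, independence of conditions needs i \<ge> \<rho> + 1 and 2 i
  + 1 \<ge> \<mu>. For \<mu> \<ge> 2 \<rho> + 4 the second condition implies the first, and every
  degree violating it lies in the conic range 2 i < \<mu>; for \<mu> \<le> 2 \<rho> + 3 the first
  implies the second, and every degree violating it lies in the line range. This is the origin of
  the two cases. The finer ranges only separate the degrees in which the Hilbert function of W is
  already stationary; r is never computed, an upper bound suffices. Independence results from two
  opposite estimates: counting Taylor coefficients bounds the space of forms from below, restriction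
  to lines through two points bounds it from above. Multiplicities are given by powers of ideals,
  while the Bezout arguments count roots of polynomials in one variable. A line of indeterminate
  slope makes the translation between the two an equivalence. Coordinate rings and differentials are
  records of cosets. All dimensions are computed for subspaces of S and S^3 and then transferred to
  these records.\<close>

abbreviation (input) lk where "lk \<equiv> Poly_Mapping.lookup"
abbreviation (input) ks where "ks \<equiv> Poly_Mapping.keys"

lemma UNIV_3: "(UNIV :: 3 set) = {0, 1, 2}"
proof -
  have "card {0, 1, 2 :: 3} = CARD(3)" by simp
  thus ?thesis by (intro card_subset_eq[symmetric]) auto
qed

lemma forall_3: "(\<forall>j::3. Q j) \<longleftrightarrow> Q 0 \<and> Q 1 \<and> Q 2"
proof -
  have "(\<forall>j::3. Q j) \<longleftrightarrow> (\<forall>j\<in>UNIV. Q j)" by simp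
  thus ?thesis unfolding UNIV_3 by simp
qed

lemma sum_UNIV_3: "(\<Sum>j\<in>(UNIV::3 set). f j) = f 0 + f 1 + (f 2 :: 'a::comm_monoid_add)"
  unfolding UNIV_3 by (simp add: add.assoc)

lemma prod_UNIV_3: "(\<Prod>j\<in>(UNIV::3 set). f j) = f 0 * f 1 * (f 2 :: 'a::comm_monoid_mult)"
  unfolding UNIV_3 by (simp add: mult.assoc)

lemma poly_mapping_sum_single: "f = (\<Sum>t\<in>ks f. Poly_Mapping.single t (lk f t))"
  by (rule poly_mapping_eqI)
    (auto simp: lookup_sum lookup_single when_def sum.delta' in_keys_iff cong: if_cong)

lemma const3_add: "const3 (a + b) = const3 a + const3 b"
  by (simp add: const3_def single_add)
lemma const3_mult: "const3 (a * b) = const3 a * const3 (b :: 'k::field)"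
  by (simp add: const3_def mult_single)
lemma const3_0 [simp]: "const3 0 = 0" and const3_1 [simp]: "const3 1 = 1"
  by (simp_all add: const3_def)
lemma single_Suc_degree:
  "Poly_Mapping.single (t + Poly_Mapping.single j 1) a = var3 j * Poly_Mapping.single t (a :: 'k::field)"
  by (simp add: var3_def mult_single add.commute)

lemma monomial_induct [case_names zero step]:
  fixes t :: "3 \<Rightarrow>\<^sub>0 nat"
  assumes "Q 0" and "\<And>t j. Q t \<Longrightarrow> Q (t + Poly_Mapping.single j 1)"
  shows "Q t"
proof (induction "\<Sum>j\<in>UNIV. lk t j" arbitrary: t)
  case 0
  hence "t = 0" by (intro poly_mapping_eqI) simp
  thus ?case using assms by simp
next
  case (Suc n)
  then obtain j where j: "lk t j \<noteq> 0" by (metis nat.distinct(1) sum.neutral)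
  define u where "u = t - Poly_Mapping.single j 1"
  have t: "t = u + Poly_Mapping.single j 1"
    unfolding u_def using j
    by (intro poly_mapping_eqI) (auto simp: lookup_add lookup_minus lookup_single when_def)
  have "(\<Sum>j\<in>UNIV. lk t j) = (\<Sum>j\<in>UNIV. lk u j) + 1"
    unfolding t by (simp add: lookup_add lookup_single sum.distrib when_def)
  with Suc have "Q u" by auto
  thus ?case unfolding t using assms by simp
qed

lemma poly3_induct [case_names const var add mult]:
  fixes f :: "'k::field poly3"
  assumes "\<And>c. Q (const3 c)" "\<And>j. Q (var3 j)" "\<And>f g. Q f \<Longrightarrow> Q g \<Longrightarrow> Q (f + g)"
    "\<And>f g. Q f \<Longrightarrow> Q g \<Longrightarrow> Q (f * g)"
  shows "Q f"
proof -
  have mono: "Q (Poly_Mapping.single t c)" for t c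
  proof (induction t rule: monomial_induct)
    case zero thus ?case using assms(1)[of c] by (simp add: const3_def)
  next
    case (step t j) thus ?case unfolding single_Suc_degree by (intro assms)
  qed
  have "Q (\<Sum>t\<in>A. Poly_Mapping.single t (lk f t))" if "finite A" for A
    using that
    by (induction A rule: finite_induct) (use assms(1)[of 0] mono assms(3) in auto)
  thus ?thesis by (subst poly_mapping_sum_single) simp
qed

section \<open>Algebra of S: substitution, grading, derivatives\<close>

section \<open>Evaluation\<close>

text \<open>A homomorphism \<open>c\<close> of coefficients and images \<open>q\<close> of the
  variables determine one substitution \<open>ev3 c q\<close>. The targets needed are K (values at
  points), S itself (linear changes of coordinates), K[t] (pullback to a parametrized curve) and
  K[z][e] (the generic line).\<close>

locale coeff_hom =
  fixes c :: "'k::field \<Rightarrow> 'b::comm_ring_1"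
  assumes c_0: "c 0 = 0" and c_1: "c 1 = 1"
    and c_add: "c (x + y) = c x + c y" and c_mult: "c (x * y) = c x * c y"

definition ev3 :: "('k::field \<Rightarrow> 'b::comm_ring_1) \<Rightarrow> (3 \<Rightarrow> 'b) \<Rightarrow> 'k poly3 \<Rightarrow> 'b" where
  "ev3 c q f = (\<Sum>t\<in>ks f. c (lk f t) * (\<Prod>j\<in>UNIV. q j ^ lk t j))"

context coeff_hom begin

lemma ev3_superset:
  assumes "finite A" "ks f \<subseteq> A"
  shows "ev3 c q f = (\<Sum>t\<in>A. c (lk f t) * (\<Prod>j\<in>UNIV. q j ^ lk t j))"
  unfolding ev3_def using assms
  by (intro sum.mono_neutral_left) (auto simp: in_keys_iff c_0)

lemma ev3_add [simp]: "ev3 c q (f + g) = ev3 c q f + ev3 c q g"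
proof -
  have "ev3 c q (f + g) = (\<Sum>t\<in>ks f \<union> ks g. c (lk (f + g) t) * (\<Prod>j\<in>UNIV. q j ^ lk t j))"
    by (intro ev3_superset) (auto simp: keys_add)
  also have "\<dots> = (\<Sum>t\<in>ks f \<union> ks g. c (lk f t) * (\<Prod>j\<in>UNIV. q j ^ lk t j)) +
      (\<Sum>t\<in>ks f \<union> ks g. c (lk g t) * (\<Prod>j\<in>UNIV. q j ^ lk t j))"
    by (simp add: lookup_add c_add distrib_right sum.distrib)
  also have "\<dots> = ev3 c q f + ev3 c q g"
    by (intro arg_cong2[where f = "(+)"] ev3_superset[symmetric]) auto
  finally show ?thesis .
qed

lemma ev3_0 [simp]: "ev3 c q 0 = 0"
  by (simp add: ev3_def)

lemma ev3_sum [simp]: "ev3 c q (\<Sum>x\<in>A. f x) = (\<Sum>x\<in>A. ev3 c q (f x))"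
  by (induction A rule: infinite_finite_induct) auto

lemma ev3_single: "ev3 c q (Poly_Mapping.single t a) = c a * (\<Prod>j\<in>UNIV. q j ^ lk t j)"
  using ev3_superset[of "{t}" "Poly_Mapping.single t a" q] by (auto simp: c_0 split: if_splits)

lemma ev3_const3 [simp]: "ev3 c q (const3 a) = c a"
  by (simp add: const3_def ev3_single)

lemma ev3_1 [simp]: "ev3 c q 1 = 1"
  using ev3_const3[of q 1] by (simp add: c_1)

lemma ev3_var3 [simp]: "ev3 c q (var3 j) = q j"
proof -
  have "(\<Prod>i\<in>UNIV. q i ^ lk (Poly_Mapping.single j 1 :: 3 \<Rightarrow>\<^sub>0 nat) i) = (\<Prod>i\<in>UNIV. if i = j then q j else 1)"
    by (intro prod.cong) (auto simp: lookup_single when_def)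
  thus ?thesis by (simp add: var3_def ev3_single c_1)
qed

lemma ev3_single_mult:
  "ev3 c q (Poly_Mapping.single t a * Poly_Mapping.single u b) =
   ev3 c q (Poly_Mapping.single t a) * ev3 c q (Poly_Mapping.single u b)"
  by (simp add: mult_single ev3_single c_mult lookup_add power_add prod.distrib mult_ac)

lemma ev3_mult [simp]: "ev3 c q (f * g) = ev3 c q f * ev3 c q g"
proof -
  let ?s = "\<lambda>f t. Poly_Mapping.single t (lk f t)"
  have "f * g = (\<Sum>t\<in>ks f. \<Sum>u\<in>ks g. ?s f t * ?s g u)"
    by (subst poly_mapping_sum_single[of f], subst poly_mapping_sum_single[of g]) (simp add: sum_product)
  hence "ev3 c q (f * g) = (\<Sum>t\<in>ks f. \<Sum>u\<in>ks g. ev3 c q (?s f t) * ev3 c q (?s g u))"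
    by (simp add: ev3_single_mult)
  also have "\<dots> = ev3 c q (\<Sum>t\<in>ks f. ?s f t) * ev3 c q (\<Sum>u\<in>ks g. ?s g u)"
    by (simp add: sum_product)
  finally show ?thesis by (simp flip: poly_mapping_sum_single)
qed

lemma ev3_minus [simp]: "ev3 c q (- f) = - ev3 c q f"
  using ev3_add[of q f "- f"] by (simp add: eq_neg_iff_add_eq_0 add.commute)

lemma ev3_diff [simp]: "ev3 c q (f - g) = ev3 c q f - ev3 c q g"
  using ev3_add[of q f "- g"] by simp

lemma ev3_power [simp]: "ev3 c q (f ^ n) = ev3 c q f ^ n"
  by (induction n) auto

text \<open>A ring homomorphism on S is determined by its values on constants and variables.
  Composition of substitutions and the values of a pulled-back form are identified in this
  way.\<close>

lemma ev3_unique: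
  assumes "\<And>a. H (const3 a) = c a" "\<And>j. H (var3 j) = q j"
    "\<And>f g. H (f + g) = H f + H g" "\<And>f g. H (f * g) = H f * H g"
  shows "H f = ev3 c q f"
proof (induction f rule: poly3_induct)
  case (const a) show ?case by (simp only: assms ev3_const3)
next
  case (var j) show ?case by (simp only: assms ev3_var3)
next
  case (add f g) thus ?case by (simp only: assms(3) ev3_add)
next
  case (mult f g) thus ?case by (simp only: assms(4) ev3_mult)
qed

end

interpretation const3: coeff_hom const3
  by unfold_locales (simp_all add: const3_add const3_mult)
interpretation id: coeff_hom "\<lambda>x. x"
  by unfold_locales simp_all
interpretation poly1: coeff_hom "\<lambda>x. [:x:]"
  by unfold_locales simp_all
interpretation poly2: coeff_hom "\<lambda>x. [:[:x:]:]"
  by unfold_locales (simp_all flip: one_pCons)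
interpretation ac: coeff_hom to_ac
  by unfold_locales simp_all

lemma eval3_eq_ev3: "eval3 f p = ev3 (\<lambda>x. x) p f"
  by (simp add: eval3_def ev3_def)

lemma eval3_simps [simp]:
  "eval3 (f + g) p = eval3 f p + eval3 g p" "eval3 (f * g) p = eval3 f p * eval3 g p"
  "eval3 (f - g) p = eval3 f p - eval3 g p" "eval3 (- f) p = - eval3 f p"
  "eval3 (const3 a) p = a" "eval3 (var3 j) p = p j" "eval3 0 p = 0" "eval3 1 p = 1"
  for f g :: "'k::field poly3"
  by (simp_all add: eval3_eq_ev3)

lemma ev3_comp:
  assumes "coeff_hom c"
  shows "ev3 c q (ev3 const3 r f) = ev3 c (\<lambda>j. ev3 c q (r j)) f"
proof -
  interpret coeff_hom c by fact
  show ?thesis by (rule ev3_unique) simp_all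
qed

lemma ev3_var3_id: "ev3 const3 var3 f = f"
  using const3.ev3_unique[of "\<lambda>f. f" var3 f] by simp

text \<open>Non-singularity is stated over the algebraic closure, whereas the points in use are
  K-rational. \<open>to_ac\<close> is injective, so mapping the coefficients preserves the set of
  monomials.\<close>

lemma eval3_map_to_ac: "eval3 (Poly_Mapping.map to_ac f) (\<lambda>j. to_ac (p j)) = to_ac (eval3 f p)"
proof -
  have keys: "ks (Poly_Mapping.map to_ac f) = ks f"
    by (auto simp: in_keys_iff Poly_Mapping.map.rep_eq when_def)
  show ?thesis
    unfolding eval3_def keys by (auto simp: to_ac_sum to_ac_prod Poly_Mapping.map.rep_eq when_def in_keys_iff intro!: sum.cong)
qed

definition deg3 :: "(3 \<Rightarrow>\<^sub>0 nat) \<Rightarrow> nat" where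
  "deg3 t = (\<Sum>j\<in>UNIV. lk t j)"

lemma deg3_0 [simp]: "deg3 0 = 0"
  by (simp add: deg3_def)

lemma deg3_add [simp]: "deg3 (t + u) = deg3 t + deg3 u"
  by (simp add: deg3_def lookup_add sum.distrib)

lemma deg3_single [simp]: "deg3 (Poly_Mapping.single j n) = n"
  by (simp add: deg3_def lookup_single when_def)

lemma deg3_eq_0_iff: "deg3 t = 0 \<longleftrightarrow> t = 0"
  by (auto simp: deg3_def intro: poly_mapping_eqI)

lemma deg3_eq: "deg3 t = lk t 0 + lk t 1 + lk t 2"
  by (simp add: deg3_def sum_UNIV_3)

section \<open>Homogeneous polynomials\<close>

lemma homogeneous3_iff: "homogeneous3 i f \<longleftrightarrow> (\<forall>t. lk f t \<noteq> 0 \<longrightarrow> int (deg3 t) = i)"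
  by (auto simp: homogeneous3_def deg3_def in_keys_iff)

lemma homogeneous3_0 [simp]: "homogeneous3 i 0"
  by (simp add: homogeneous3_iff)

lemma homogeneous3_add: "homogeneous3 i f \<Longrightarrow> homogeneous3 i g \<Longrightarrow> homogeneous3 i (f + g)"
  by (auto simp: homogeneous3_iff lookup_add) (metis add.right_neutral)+

lemma homogeneous3_minus: "homogeneous3 i (f :: 'k::field poly3) \<Longrightarrow> homogeneous3 i (- f)"
  by (auto simp: homogeneous3_iff)

lemma homogeneous3_diff:
  "homogeneous3 i (f :: 'k::field poly3) \<Longrightarrow> homogeneous3 i g \<Longrightarrow> homogeneous3 i (f - g)"
  using homogeneous3_add[of i f "- g"] homogeneous3_minus[of i g] by simp

lemma homogeneous3_sum: "(\<And>x. x \<in> A \<Longrightarrow> homogeneous3 i (f x)) \<Longrightarrow> homogeneous3 i (\<Sum>x\<in>A. f x)"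
  by (induction A rule: infinite_finite_induct) (auto intro: homogeneous3_add)

lemma homogeneous3_single: "homogeneous3 (int (deg3 t)) (Poly_Mapping.single t a)"
  by (auto simp: homogeneous3_iff lookup_single when_def)

lemma homogeneous3_var3: "homogeneous3 1 (var3 j)"
  using homogeneous3_single[of "Poly_Mapping.single j 1" 1] by (simp add: var3_def)

lemma homogeneous3_const3: "homogeneous3 0 (const3 a)"
  using homogeneous3_single[of 0 a] by (simp add: const3_def)

lemma homogeneous3_1 [simp]: "homogeneous3 0 (1 :: 'k::field poly3)"
  using homogeneous3_const3[of "1 :: 'k"] by simp

lemma homogeneous3_mult:
  fixes f g :: "'k::field poly3"
  assumes "homogeneous3 i f" "homogeneous3 j g"
  shows "homogeneous3 (i + j) (f * g)"
proof -
  have "int (deg3 u) = i + j" if "u \<in> ks (f * g)" for u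
  proof -
    from that keys_mult[of f g] obtain s t where "u = s + t" "s \<in> ks f" "t \<in> ks g" by auto
    thus ?thesis using assms by (simp add: homogeneous3_def deg3_def lookup_add sum.distrib flip: of_nat_sum)
  qed
  thus ?thesis by (simp add: homogeneous3_def deg3_def)
qed

lemma homogeneous3_const3_mult:
  "homogeneous3 i (f :: 'k::field poly3) \<Longrightarrow> homogeneous3 i (const3 a * f)"
  using homogeneous3_mult[OF homogeneous3_const3, of i f a] by simp

lemma homogeneous3_power:
  "homogeneous3 i (f :: 'k::field poly3) \<Longrightarrow> homogeneous3 (int n * i) (f ^ n)"
  by (induction n) (auto simp: algebra_simps homogeneous3_mult)

lemma homogeneous3_neg: "homogeneous3 i f \<Longrightarrow> i < 0 \<Longrightarrow> f = 0"
  by (rule poly_mapping_eqI) (force simp: homogeneous3_iff)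

lemma homogeneous3_degree_0: "homogeneous3 0 f \<Longrightarrow> f = const3 (lk f 0)"
  by (rule poly_mapping_eqI) (auto simp: homogeneous3_iff const3_def lookup_single when_def deg3_eq_0_iff)

text \<open>Every monomial of positive degree contains a variable; one such variable is chosen per
  monomial, and the monomials are grouped by it. This yields induction on the degree of
  forms.\<close>

lemma homogeneous3_decompose:
  fixes f :: "'k::field poly3"
  assumes "homogeneous3 (i + 1) f" "i \<ge> 0"
  obtains g where "\<And>j. homogeneous3 i (g j)" "f = (\<Sum>j\<in>UNIV. var3 j * g j)"
proof -
  have *: "\<exists>j u. t = u + Poly_Mapping.single j 1 \<and> int (deg3 u) = i" if "t \<in> ks f" for t
  proof -
    have d: "int (deg3 t) = i + 1" using assms(1) that by (simp add: homogeneous3_def deg3_def)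
    then obtain j where j: "lk t j \<noteq> 0" using assms(2) unfolding deg3_def by (metis add_le_same_cancel1 int_ops(1) not_one_le_zero sum.neutral)
    have t: "t = (t - Poly_Mapping.single j 1) + Poly_Mapping.single j 1"
      using j by (intro poly_mapping_eqI) (auto simp: lookup_add lookup_minus lookup_single when_def)
    have "int (deg3 t) = int (deg3 (t - Poly_Mapping.single j 1)) + 1"
      by (subst t) simp
    with d t show ?thesis by (metis add_right_cancel)
  qed
  then obtain J U where JU: "\<And>t. t \<in> ks f \<Longrightarrow> t = U t + Poly_Mapping.single (J t) 1"
      "\<And>t. t \<in> ks f \<Longrightarrow> int (deg3 (U t)) = i" by metis
  define g where "g j = (\<Sum>t\<in>{t\<in>ks f. J t = j}. Poly_Mapping.single (U t) (lk f t))" for j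
  have "f = (\<Sum>t\<in>ks f. var3 (J t) * Poly_Mapping.single (U t) (lk f t))"
    by (subst poly_mapping_sum_single, intro sum.cong refl)
      (metis JU(1) single_Suc_degree)
  also have "\<dots> = (\<Sum>j\<in>UNIV. \<Sum>t\<in>{t\<in>ks f. J t = j}. var3 (J t) * Poly_Mapping.single (U t) (lk f t))"
    by (rule sum.group[symmetric]) auto
  also have "\<dots> = (\<Sum>j\<in>UNIV. var3 j * g j)"
    by (simp add: g_def sum_distrib_left)
  finally have "f = (\<Sum>j\<in>UNIV. var3 j * g j)" .
  moreover have "homogeneous3 i (g j)" for j
    unfolding g_def
  proof (rule homogeneous3_sum)
    fix t assume "t \<in> {t \<in> ks f. J t = j}"
    hence "int (deg3 (U t)) = i" using JU(2) by auto
    thus "homogeneous3 i (Poly_Mapping.single (U t) (lk f t))"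
      using homogeneous3_single[of "U t"] by simp
  qed
  ultimately show ?thesis by (rule that[rotated])
qed

lemma homogeneous3_induct [consumes 1, case_names const step]:
  fixes f :: "'k::field poly3"
  assumes "homogeneous3 (int n) f" "\<And>a. Q 0 (const3 a)"
    "\<And>n g. (\<And>j. homogeneous3 (int n) (g j)) \<Longrightarrow> (\<And>j. Q n (g j)) \<Longrightarrow> Q (Suc n) (\<Sum>j\<in>UNIV. var3 j * g j)"
  shows "Q n f"
  using assms(1)
proof (induction n arbitrary: f)
  case 0
  thus ?case using homogeneous3_degree_0[of f] assms(2)[of "lk f 0"] by simp
next
  case (Suc n)
  from Suc.prems have "homogeneous3 (int n + 1) f" by (simp add: add.commute)
  then obtain g where g: "\<And>j. homogeneous3 (int n) (g j)" "f = (\<Sum>j\<in>UNIV. var3 j * g j)"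
    by (rule homogeneous3_decompose) auto
  show ?case unfolding g(2) by (rule assms(3)) (use g Suc.IH in auto)
qed

section \<open>Homogeneous components\<close>

definition hcomp :: "int \<Rightarrow> 'k::field poly3 \<Rightarrow> 'k poly3" where
  "hcomp i f = (\<Sum>t\<in>{t\<in>ks f. int (deg3 t) = i}. Poly_Mapping.single t (lk f t))"

lemma lookup_hcomp: "lk (hcomp i f) t = (if int (deg3 t) = i then lk f t else 0)"
proof -
  have "lk (hcomp i f) t = (\<Sum>u\<in>{u\<in>ks f. int (deg3 u) = i}. if u = t then lk f t else 0)"
    by (auto simp: hcomp_def lookup_sum lookup_single when_def intro!: sum.cong)
  thus ?thesis by (simp add: in_keys_iff)
qed

lemma homogeneous3_hcomp: "homogeneous3 i (hcomp i f)"
  by (simp add: homogeneous3_iff lookup_hcomp)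

lemma hcomp_add: "hcomp i (f + g) = hcomp i f + hcomp i g"
  by (rule poly_mapping_eqI) (simp add: lookup_hcomp lookup_add)

lemma hcomp_0 [simp]: "hcomp i 0 = 0"
  by (rule poly_mapping_eqI) (simp add: lookup_hcomp)

lemma hcomp_diff: "hcomp i (f - g) = hcomp i f - hcomp i g"
  by (rule poly_mapping_eqI) (simp add: lookup_hcomp lookup_minus)

lemma hcomp_sum: "hcomp i (\<Sum>x\<in>A. f x) = (\<Sum>x\<in>A. hcomp i (f x))"
  by (induction A rule: infinite_finite_induct) (auto simp: hcomp_add)

lemma hcomp_homogeneous: "homogeneous3 j f \<Longrightarrow> hcomp i f = (if i = j then f else 0)"
  by (rule poly_mapping_eqI) (auto simp: lookup_hcomp homogeneous3_iff)

lemma sum_hcomp: "f = (\<Sum>i\<in>(\<lambda>t. int (deg3 t)) ` ks f. hcomp i f)"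
proof (rule poly_mapping_eqI)
  fix t
  show "lk f t = lk (\<Sum>i\<in>(\<lambda>t. int (deg3 t)) ` ks f. hcomp i f) t"
    by (auto simp: lookup_sum lookup_hcomp in_keys_iff)
qed

lemma hcomp_mult:
  assumes "homogeneous3 k g"
  shows "hcomp i (f * g) = hcomp (i - k) f * g"
proof -
  let ?A = "(\<lambda>t. int (deg3 t)) ` ks f"
  have "hcomp i (f * g) = (\<Sum>j\<in>?A. hcomp i (hcomp j f * g))"
    by (subst sum_hcomp[of f]) (simp add: sum_distrib_right hcomp_sum)
  also have "\<dots> = (\<Sum>j\<in>?A. if j = i - k then hcomp j f * g else 0)"
    by (intro sum.cong refl) (auto simp: hcomp_homogeneous[OF homogeneous3_mult[OF homogeneous3_hcomp assms]])
  also have "\<dots> = hcomp (i - k) f * g"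
  proof (cases "i - k \<in> ?A")
    case False
    hence "hcomp (i - k) f = 0"
      by (intro poly_mapping_eqI) (simp add: lookup_hcomp, metis (mono_tags, lifting) image_eqI in_keys_iff)
    thus ?thesis using False by (auto intro!: sum.neutral)
  qed auto
  finally show ?thesis .
qed

text \<open>The cofactor \<open>g\<close> may be inhomogeneous, but comparing components of degree
  \<open>i\<close> shows that its component of degree \<open>i - k\<close> serves as well.\<close>

lemma homogeneous3_cofactor:
  fixes f g :: "'k::field poly3"
  assumes "homogeneous3 i f" "homogeneous3 k L" "f = L * g"
  obtains h where "homogeneous3 (i - k) h" "f = L * h"
proof
  show "homogeneous3 (i - k) (hcomp (i - k) g)" by (rule homogeneous3_hcomp)
  show "f = L * hcomp (i - k) g"
    using hcomp_mult[OF assms(2), of i g] hcomp_homogeneous[OF assms(1), of i] assms(3)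
    by (metis mult.commute)
qed

section \<open>Evaluation of homogeneous polynomials\<close>

lemma (in coeff_hom) ev3_scale:
  assumes "homogeneous3 (int n) f"
  shows "ev3 c (\<lambda>j. a * q j) f = a ^ n * ev3 c q f"
  using assms
  by (induction rule: homogeneous3_induct) (simp_all add: sum_distrib_left mult_ac)

lemma (in coeff_hom) ev3_homogeneous3_eq:
  "ev3 c q f = (\<Sum>t\<in>ks f. c (lk f t) * (q 0 ^ lk t 0 * q 1 ^ lk t 1 * q 2 ^ lk t 2))"
  by (simp add: ev3_def prod_UNIV_3)

lemma degree_ev3_le:
  assumes "homogeneous3 (int n) f" "\<And>j. degree (q j) \<le> k"
  shows "degree (ev3 (\<lambda>x. [:x:]) q f) \<le> n * k"
  using assms(1)
proof (induction rule: homogeneous3_induct)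
  case (const a) thus ?case by simp
next
  case (step n g)
  have "degree (q j * ev3 (\<lambda>x. [:x:]) q (g j)) \<le> Suc n * k" for j
    using degree_mult_le[of "q j" "ev3 (\<lambda>x. [:x:]) q (g j)"] assms(2)[of j] step(2)[of j] by simp
  thus ?case by (simp add: degree_sum_le)
qed

lemma homogeneous3_ev3:
  fixes f :: "'k::field poly3"
  assumes "homogeneous3 (int n) f" "\<And>j. homogeneous3 1 (q j)"
  shows "homogeneous3 (int n) (ev3 const3 q f)"
  using assms(1)
proof (induction rule: homogeneous3_induct)
  case (const a) thus ?case by (simp add: homogeneous3_const3)
next
  case (step n g)
  have "homogeneous3 (int (Suc n)) (q j * ev3 const3 q (g j))" for j
    using homogeneous3_mult[OF assms(2)[of j] step(2)[of j]] by simp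
  thus ?case by (simp add: homogeneous3_sum)
qed

section \<open>Partial derivatives\<close>

lemma partial3_superset:
  assumes "finite A" "ks f \<subseteq> A"
  shows "partial3 j f = (\<Sum>t\<in>A. Poly_Mapping.single (t - Poly_Mapping.single j 1)
       (of_nat (lk t j) * lk f t))"
  unfolding partial3_def using assms
  by (intro sum.mono_neutral_left) (auto simp: in_keys_iff)

lemma partial3_add [simp]: "partial3 j (f + g) = partial3 j f + partial3 j (g :: 'k::field poly3)"
proof -
  let ?s = "\<lambda>f t. Poly_Mapping.single (t - Poly_Mapping.single j 1) (of_nat (lk t j) * lk f t)"
  have "partial3 j (f + g) = (\<Sum>t\<in>ks f \<union> ks g. ?s (f + g) t)"
    by (intro partial3_superset) (auto simp: keys_add)
  also have "\<dots> = (\<Sum>t\<in>ks f \<union> ks g. ?s f t) + (\<Sum>t\<in>ks f \<union> ks g. ?s g t)"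
    by (simp add: lookup_add distrib_left single_add sum.distrib)
  also have "\<dots> = partial3 j f + partial3 j g"
    by (intro arg_cong2[where f = "(+)"] partial3_superset[symmetric]) auto
  finally show ?thesis .
qed

lemma partial3_0 [simp]: "partial3 j 0 = 0"
  by (simp add: partial3_def)

lemma partial3_sum [simp]: "partial3 j (\<Sum>x\<in>A. f x) = (\<Sum>x\<in>A. partial3 j (f x :: 'k::field poly3))"
  by (induction A rule: infinite_finite_induct) auto

lemma partial3_single:
  "partial3 j (Poly_Mapping.single t a) =
    Poly_Mapping.single (t - Poly_Mapping.single j 1) (of_nat (lk t j) * (a :: 'k::field))"
  using partial3_superset[of "{t}" "Poly_Mapping.single t a" j] by (auto split: if_splits)

lemma partial3_const3 [simp]: "partial3 j (const3 a) = (0 :: 'k::field poly3)"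
  by (simp add: const3_def partial3_single)

lemma partial3_var3: "partial3 j (var3 i :: 'k::field poly3) = (if i = j then 1 else 0)"
  by (simp add: var3_def partial3_single lookup_single when_def)

lemma partial3_single_mult:
  fixes a b :: "'k::field"
  defines "s \<equiv> Poly_Mapping.single"
  shows "partial3 j (s t a * s u b) = s t a * partial3 j (s u b) + s u b * partial3 j (s t a)"
proof -
  \<comment> \<open>Subtraction of exponents is truncated: if \<open>u\<close> does not contain the
    variable, the two exponents may differ, but then the coefficient is 0.\<close>
  have *: "s (t + u - Poly_Mapping.single j 1) (of_nat (lk u j) * (a * b)) =
      s (t + (u - Poly_Mapping.single j 1)) (of_nat (lk u j) * (a * b))"
    for t u :: "3 \<Rightarrow>\<^sub>0 nat" and a b :: 'k
  proof (cases "lk u j = 0")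
    case False
    hence "t + u - Poly_Mapping.single j 1 = t + (u - Poly_Mapping.single j 1)"
      by (intro poly_mapping_eqI) (auto simp: lookup_add lookup_minus lookup_single when_def)
    thus ?thesis by simp
  qed (simp add: s_def)
  have "partial3 j (s t a * s u b) =
      s (t + u - Poly_Mapping.single j 1) (of_nat (lk u j) * (a * b)) +
      s (u + t - Poly_Mapping.single j 1) (of_nat (lk t j) * (b * a))"
    by (simp add: s_def mult_single partial3_single lookup_add add.commute[of u t] flip: single_add)
      (simp add: algebra_simps)
  also have "\<dots> = s t a * partial3 j (s u b) + s u b * partial3 j (s t a)"
    unfolding * by (simp add: s_def mult_single partial3_single mult_ac)
  finally show ?thesis .
qed

lemma partial3_mult [simp]: "partial3 j (f * g) = f * partial3 j g + g * partial3 j (f :: 'k::field poly3)"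
proof -
  let ?s = "\<lambda>f t. Poly_Mapping.single t (lk f t)"
  have "f * g = (\<Sum>t\<in>ks f. \<Sum>u\<in>ks g. ?s f t * ?s g u)"
    by (subst poly_mapping_sum_single[of f], subst poly_mapping_sum_single[of g]) (simp add: sum_product)
  hence "partial3 j (f * g) = (\<Sum>t\<in>ks f. \<Sum>u\<in>ks g. ?s f t * partial3 j (?s g u) + ?s g u * partial3 j (?s f t))"
    by (simp only: partial3_sum partial3_single_mult)
  also have "\<dots> = (\<Sum>t\<in>ks f. ?s f t) * partial3 j (\<Sum>u\<in>ks g. ?s g u) +
      (\<Sum>u\<in>ks g. ?s g u) * partial3 j (\<Sum>t\<in>ks f. ?s f t)"
    by (simp only: partial3_sum sum.distrib sum_product) (subst (2) sum.swap, rule refl)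
  finally show ?thesis by (simp only: poly_mapping_sum_single[symmetric])
qed

lemma partial3_minus [simp]: "partial3 j (- f) = - partial3 j (f :: 'k::field poly3)"
  using partial3_add[of j f "- f"] by (simp add: eq_neg_iff_add_eq_0 add.commute)

lemma partial3_diff [simp]: "partial3 j (f - g) = partial3 j f - partial3 j (g :: 'k::field poly3)"
  using partial3_add[of j f "- g"] by simp

lemma homogeneous3_partial3:
  assumes "homogeneous3 i (f :: 'k::field poly3)"
  shows "homogeneous3 (i - 1) (partial3 j f)"
  unfolding partial3_def
proof (rule homogeneous3_sum)
  fix t assume t: "t \<in> ks f"
  show "homogeneous3 (i - 1) (Poly_Mapping.single (t - Poly_Mapping.single j 1) (of_nat (lk t j) * lk f t))"
  proof (cases "lk t j = 0")
    case False
    have "t = (t - Poly_Mapping.single j 1) + Poly_Mapping.single j 1"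
      using False by (intro poly_mapping_eqI) (auto simp: lookup_add lookup_minus lookup_single when_def)
    hence "deg3 t = deg3 (t - Poly_Mapping.single j 1) + 1" by (metis deg3_add deg3_single)
    moreover have "int (deg3 t) = i" using assms t by (simp add: homogeneous3_def deg3_def)
    ultimately have "i - 1 = int (deg3 (t - Poly_Mapping.single j 1))" by simp
    thus ?thesis by (simp only: homogeneous3_single)
  qed simp
qed

lemma hcomp_partial3: "hcomp i (partial3 j f) = partial3 j (hcomp (i + 1) f)"
proof -
  let ?A = "(\<lambda>t. int (deg3 t)) ` ks f"
  have "hcomp i (partial3 j f) = (\<Sum>k\<in>?A. hcomp i (partial3 j (hcomp k f)))"
    by (subst sum_hcomp[of f]) (simp add: hcomp_sum)
  also have "\<dots> = (\<Sum>k\<in>?A. if k = i + 1 then partial3 j (hcomp k f) else 0)"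
    by (intro sum.cong refl) (auto simp: hcomp_homogeneous[OF homogeneous3_partial3[OF homogeneous3_hcomp]])
  also have "\<dots> = partial3 j (hcomp (i + 1) f)"
  proof (cases "i + 1 \<in> ?A")
    case False
    hence "hcomp (i + 1) f = 0"
      by (intro poly_mapping_eqI) (simp add: lookup_hcomp, metis (mono_tags, lifting) image_eqI in_keys_iff)
    thus ?thesis using False by (auto intro!: sum.neutral)
  qed auto
  finally show ?thesis .
qed

text \<open>Chain rule along a curve; the second hypothesis says that coefficients are constants for
  the derivation.\<close>

lemma pderiv_ev3:
  fixes c :: "'k::field \<Rightarrow> 'b::idom poly"
  assumes "coeff_hom c" "\<And>a. pderiv (c a) = 0"
  shows "pderiv (ev3 c q f) = (\<Sum>j\<in>UNIV. pderiv (q j) * ev3 c q (partial3 j f))"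
proof -
  interpret coeff_hom c by fact
  show ?thesis
  proof (induction f rule: poly3_induct)
    case (const a) show ?case by (simp add: assms)
  next
    case (var i)
    have "(\<Sum>j\<in>UNIV. pderiv (q j) * ev3 c q (partial3 j (var3 i))) = (\<Sum>j\<in>UNIV. if j = i then pderiv (q i) else 0)"
      by (intro sum.cong) (auto simp: partial3_var3)
    thus ?case by simp
  next
    case (add f g) thus ?case by (simp add: pderiv_add sum.distrib distrib_left)
  next
    case (mult f g) thus ?case
      by (simp add: pderiv_mult sum.distrib distrib_left sum_distrib_left mult_ac)
  qed
qed

lemma euler3:
  fixes f :: "'k::field poly3"
  assumes "homogeneous3 (int n) f"
  shows "(\<Sum>j\<in>UNIV. var3 j * partial3 j f) = of_nat n * f"
  using assms
proof (induction rule: homogeneous3_induct)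
  case (const a) thus ?case by simp
next
  case (step n g)
  have "(\<Sum>j\<in>UNIV. var3 j * partial3 j (\<Sum>i\<in>UNIV. var3 i * g i)) =
    (\<Sum>j\<in>UNIV. \<Sum>i\<in>UNIV. var3 j * (var3 i * partial3 j (g i))) + (\<Sum>j\<in>UNIV. var3 j * (\<Sum>i\<in>UNIV. g i * partial3 j (var3 i)))"
    by (simp add: sum.distrib distrib_left sum_distrib_left)
  also have "(\<Sum>j\<in>UNIV. var3 j * (\<Sum>i\<in>UNIV. g i * partial3 j (var3 i))) = (\<Sum>j\<in>UNIV. var3 j * g j)"
    by (simp add: partial3_var3 if_distrib[of "\<lambda>x. _ * x"] cong: if_cong)
  also have "(\<Sum>j\<in>UNIV. \<Sum>i\<in>UNIV. var3 j * (var3 i * partial3 j (g i))) =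
     (\<Sum>i\<in>UNIV. var3 i * (\<Sum>j\<in>UNIV. var3 j * partial3 j (g i)))"
    by (subst sum.swap) (simp add: sum_distrib_left mult_ac)
  also have "\<dots> = (\<Sum>i\<in>UNIV. var3 i * (of_nat n * g i))" by (simp only: step)
  finally have "(\<Sum>j\<in>UNIV. var3 j * partial3 j (\<Sum>i\<in>UNIV. var3 i * g i)) =
     (\<Sum>i\<in>UNIV. var3 i * (of_nat n * g i)) + (\<Sum>j\<in>UNIV. var3 j * g j)" .
  also have "\<dots> = of_nat (Suc n) * (\<Sum>j\<in>UNIV. var3 j * g j)"
    by (simp add: algebra_simps sum_distrib_left sum.distrib)
  finally show ?case .
qed

section \<open>Linear algebra: dimensions of subspaces and of quotients given as records\<close>

section \<open>Dimensions of finite-dimensional subspaces\<close>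

text \<open>S, S^3 and K[t] are infinite-dimensional, so finite dimension is recorded for each
  subspace by a finite spanning set.\<close>

definition fin_subspace :: "('a::field \<Rightarrow> 'b::ab_group_add \<Rightarrow> 'b) \<Rightarrow> 'b set \<Rightarrow> bool" where
  "fin_subspace s U \<longleftrightarrow>
    Modules.module.subspace s U \<and> (\<exists>W. finite W \<and> U \<subseteq> Modules.module.span s W)"

context vector_space begin

lemma fin_subspaceI: "subspace U \<Longrightarrow> finite W \<Longrightarrow> U \<subseteq> span W \<Longrightarrow> fin_subspace scale U"
  by (auto simp: fin_subspace_def)

lemma fin_subspace_subspace: "fin_subspace scale U \<Longrightarrow> subspace U"
  by (simp add: fin_subspace_def)

lemma fin_subspace_subset: "fin_subspace scale U \<Longrightarrow> subspace T \<Longrightarrow> T \<subseteq> U \<Longrightarrow> fin_subspace scale T"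
  by (auto simp: fin_subspace_def)

lemma fin_subspace_independent_finite:
  assumes "fin_subspace scale U" "independent B" "B \<subseteq> U" shows "finite B"
  using assms independent_span_bound unfolding fin_subspace_def by (metis order_trans)

lemma fin_subspace_extend_basis:
  assumes "fin_subspace scale U" "independent B" "B \<subseteq> U"
  obtains B' where "B \<subseteq> B'" "finite B'" "independent B'" "span B' = U" "dim U = card B'"
proof -
  obtain B' where B': "B \<subseteq> B'" "B' \<subseteq> U" "independent B'" "U \<subseteq> span B'"
    using maximal_independent_subset_extend[OF assms(3,2)] by blast
  have "span B' = U" using B' fin_subspace_subspace[OF assms(1)] by (intro span_subspace)
  moreover have "finite B'" by (rule fin_subspace_independent_finite[OF assms(1) B'(3,2)])
  moreover have "dim U = card B'" using basis_card_eq_dim B' by metis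
  ultimately show ?thesis using B' by (intro that)
qed

lemma fin_subspace_basis:
  assumes "fin_subspace scale U"
  obtains B where "finite B" "independent B" "span B = U" "dim U = card B"
  using fin_subspace_extend_basis[OF assms independent_empty] by blast

lemma dim_subspace_mono: "fin_subspace scale U \<Longrightarrow> subspace T \<Longrightarrow> T \<subseteq> U \<Longrightarrow> dim T \<le> dim U"
  by (metis fin_subspace_basis dim_le_card)

lemma span_disjoint_Int:
  assumes "independent (A \<union> B)" "finite A" "finite B" "A \<inter> B = {}" "x \<in> span A" "x \<in> span B"
  shows "x = 0"
proof -
  from assms(5) obtain u where u: "x = (\<Sum>v\<in>A. u v *s v)" using span_finite[OF assms(2)] by auto
  from assms(6) obtain w where w: "x = (\<Sum>v\<in>B. w v *s v)" using span_finite[OF assms(3)] by auto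
  define z where "z v = (if v \<in> A then u v else - w v)" for v
  have "(\<Sum>v\<in>A \<union> B. z v *s v) = (\<Sum>v\<in>A. z v *s v) + (\<Sum>v\<in>B. z v *s v)"
    using assms by (intro sum.union_disjoint) auto
  also have "(\<Sum>v\<in>A. z v *s v) = x" unfolding u by (intro sum.cong) (auto simp: z_def)
  also have "(\<Sum>v\<in>B. z v *s v) = (\<Sum>v\<in>B. - (w v *s v))"
    using assms(4) by (intro sum.cong) (auto simp: z_def)
  also have "\<dots> = - x" unfolding w by (simp add: sum_negf)
  finally have "(\<Sum>v\<in>A \<union> B. z v *s v) = 0" by simp
  hence "z v = 0" if "v \<in> A" for v
    using independentD[OF assms(1) _ subset_refl] assms(2,3) that by auto
  thus ?thesis unfolding u z_def by simp
qed

end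

context vector_space_pair begin

text \<open>Rank-nullity: a basis of the kernel is extended to one of \<open>U\<close>, and the
  added vectors are mapped injectively to a basis of the image.\<close>

lemma dim_kernel_image:
  assumes f: "Vector_Spaces.linear s1 s2 f" and U: "fin_subspace s1 U"
  shows "vs1.dim U = vs2.dim (f ` U) + vs1.dim {x\<in>U. f x = 0}"
proof -
  interpret f: Vector_Spaces.linear s1 s2 f by fact
  let ?K = "{x\<in>U. f x = 0}"
  note subU = vs1.fin_subspace_subspace[OF U]
  have subK: "vs1.subspace ?K"
    using vs1.subspace_inter[OF subU f.subspace_kernel] by (simp add: Int_def)
  obtain B where B: "finite B" "vs1.independent B" "vs1.span B = ?K" "vs1.dim ?K = card B"
    by (rule vs1.fin_subspace_basis[OF vs1.fin_subspace_subset[OF U subK]]) auto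
  have "B \<subseteq> U" using B(3) vs1.span_superset[of B] by auto
  then obtain B' where B': "B \<subseteq> B'" "finite B'" "vs1.independent B'" "vs1.span B' = U" "vs1.dim U = card B'"
    by (rule vs1.fin_subspace_extend_basis[OF U B(2)])
  have inj: "inj_on f (vs1.span (B' - B))"
  proof (subst linear_inj_on_iff_eq_0[OF f])
    show "vs1.subspace (vs1.span (B' - B))" by simp
    show "\<forall>x\<in>vs1.span (B' - B). f x = 0 \<longrightarrow> x = 0"
    proof (intro ballI impI)
      fix x assume x: "x \<in> vs1.span (B' - B)" "f x = 0"
      have "x \<in> U" using x vs1.span_mono[of "B' - B" B'] B'(4) by auto
      hence "x \<in> vs1.span B" using x B(3) by auto
      moreover have "(B' - B) \<union> B = B'" using B'(1) by auto
      ultimately show "x = 0" using x B' B by (intro vs1.span_disjoint_Int[of "B' - B" B]) auto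
    qed
  qed
  have ind: "vs2.independent (f ` (B' - B))"
    by (rule f.independent_injective_image[OF vs1.independent_mono[OF B'(3)] inj]) auto
  have fB: "f ` B \<subseteq> {0}" using B(3) vs1.span_superset[of B] by auto
  have "f ` U = vs2.span (f ` B')" unfolding B'(4)[symmetric] by (simp add: f.span_image)
  also have "f ` B' = f ` (B' - B) \<union> f ` B" using B'(1) by auto
  also have "vs2.span (f ` (B' - B) \<union> f ` B) = vs2.span (f ` (B' - B))"
  proof
    have "f ` (B' - B) \<union> f ` B \<subseteq> vs2.span (f ` (B' - B))"
      using fB vs2.span_superset[of "f ` (B' - B)"] vs2.span_zero by auto
    thus "vs2.span (f ` (B' - B) \<union> f ` B) \<subseteq> vs2.span (f ` (B' - B))"
      by (rule vs2.span_minimal) simp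
  qed (rule vs2.span_mono, auto)
  finally have "vs2.dim (f ` U) = card (f ` (B' - B))"
    using ind by (simp add: vs2.dim_eq_card_independent)
  also have "\<dots> = card (B' - B)"
    using inj vs1.span_superset[of "B' - B"] by (intro card_image) (rule inj_on_subset)
  also have "\<dots> = card B' - card B" using B'(1) B(1) by (intro card_Diff_subset)
  finally show ?thesis using B(4) B'(5) card_mono[OF B'(2,1)] by simp
qed

lemma fin_subspace_image:
  assumes f: "Vector_Spaces.linear s1 s2 f" and U: "fin_subspace s1 U"
  shows "fin_subspace s2 (f ` U)"
proof -
  interpret f: Vector_Spaces.linear s1 s2 f by fact
  from U obtain W where W: "finite W" "U \<subseteq> vs1.span W" by (auto simp: fin_subspace_def)
  show ?thesis
    by (rule vs2.fin_subspaceI[of _ "f ` W"])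
      (use W f.spans_image f.subspace_image vs1.fin_subspace_subspace[OF U] in auto)
qed

lemma dim_image_inj:
  assumes f: "Vector_Spaces.linear s1 s2 f" and U: "fin_subspace s1 U" and "\<And>x. x \<in> U \<Longrightarrow> f x = 0 \<Longrightarrow> x = 0"
  shows "vs2.dim (f ` U) = vs1.dim U"
proof -
  interpret f: Vector_Spaces.linear s1 s2 f by fact
  have "{x\<in>U. f x = 0} = {0}" using assms(3) vs1.subspace_0[OF vs1.fin_subspace_subspace[OF U]] by auto
  moreover have "vs1.dim {0} = 0" using vs1.dim_le_card[of "{0}" "{}"] by simp
  ultimately show ?thesis using dim_kernel_image[OF f U] by simp
qed

end

context vector_space begin

text \<open>A basis of \<open>A\<close> is extended to the whole space; its members are sent to 0
  and the added vectors to themselves. Every subspace is thus a kernel, and quotients can be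
  replaced by images.\<close>

lemma exists_linear_kernel:
  assumes "subspace A"
  obtains p where "Vector_Spaces.linear scale scale p" "\<And>x. p x = 0 \<longleftrightarrow> x \<in> A"
proof -
  interpret vector_space_pair scale scale by unfold_locales
  obtain A0 where A0: "A0 \<subseteq> A" "independent A0" "A \<subseteq> span A0" using maximal_independent_subset[of A] by blast
  have spA0: "span A0 = A" using A0 assms by (intro span_subspace)
  obtain A1 where A1: "A0 \<subseteq> A1" "independent A1" "UNIV \<subseteq> span A1"
    using maximal_independent_subset_extend[of A0 UNIV] A0 by auto
  define p where "p = construct A1 (\<lambda>b. if b \<in> A0 then 0 else b)"
  have lin: "Vector_Spaces.linear scale scale p" unfolding p_def by (rule linear_construct[OF A1(2)])
  interpret p: Vector_Spaces.linear scale scale p by fact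
  have pb: "p b = (if b \<in> A0 then 0 else b)" if "b \<in> A1" for b
    unfolding p_def by (rule construct_basis[OF A1(2) that])
  have "p x = 0 \<longleftrightarrow> x \<in> A" for x
  proof
    assume "x \<in> A"
    hence "x \<in> span A0" using spA0 by simp
    thus "p x = 0" by (rule p.eq_0_on_span[rotated]) (use A1(1) pb in auto)
  next
    assume px: "p x = 0"
    have "x \<in> span A1" using A1 by auto
    then obtain T u where T: "finite T" "T \<subseteq> A1" "x = (\<Sum>b\<in>T. u b *s b)"
      unfolding span_explicit by auto
    have "p x = (\<Sum>b\<in>T. u b *s p b)" by (simp add: T p.sum p.scale)
    also have "\<dots> = (\<Sum>b\<in>T. if b \<in> A0 then 0 else u b *s b)"
      using T(2) pb by (intro sum.cong) auto
    also have "\<dots> = (\<Sum>b\<in>T - A0. u b *s b)"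
      using T(1) by (intro sum.mono_neutral_cong_right) auto
    finally have "(\<Sum>b\<in>T - A0. u b *s b) = 0" using px by simp
    hence z: "u b = 0" if "b \<in> T - A0" for b
      using independentD[OF A1(2), of "T - A0" u b] T that by auto
    have "u b *s b \<in> span A0" if "b \<in> T" for b
      by (cases "b \<in> A0") (use z that in \<open>auto intro: span_scale span_base span_zero\<close>)
    hence "x \<in> span A0" unfolding T(3) by (rule span_sum)
    thus "x \<in> A" using spA0 by simp
  qed
  with lin show ?thesis by (rule that)
qed

text \<open>Let \<open>p\<close> have kernel \<open>A\<close>. It has the same image on the sum as
  on \<open>B\<close>, with kernels \<open>A\<close> and the intersection respectively, so
  rank-nullity applied twice gives the formula.\<close>

lemma dim_sum_Int:
  assumes U: "fin_subspace scale U" and A: "subspace A" "A \<subseteq> U" and B: "subspace B" "B \<subseteq> U"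
  shows "dim {a + b | a b. a \<in> A \<and> b \<in> B} + dim (A \<inter> B) = dim A + dim B"
proof -
  interpret vector_space_pair scale scale by unfold_locales
  let ?S = "{a + b | a b. a \<in> A \<and> b \<in> B}"
  obtain p where p: "Vector_Spaces.linear scale scale p" "\<And>x. p x = 0 \<longleftrightarrow> x \<in> A"
    using exists_linear_kernel[OF A(1)] by blast
  interpret p: Vector_Spaces.linear scale scale p by fact
  note subU = fin_subspace_subspace[OF U]
  have S: "?S \<subseteq> U" using A(2) B(2) subspace_add[OF subU] by auto
  have fS: "fin_subspace scale ?S" by (rule fin_subspace_subset[OF U subspace_sums[OF A(1) B(1)] S])
  have fB: "fin_subspace scale B" by (rule fin_subspace_subset[OF U B])
  have "p ` ?S = p ` B"
  proof
    show "p ` ?S \<subseteq> p ` B" using p(2) by (auto simp: p.add iffD2[OF p(2)])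
    show "p ` B \<subseteq> p ` ?S"
    proof
      fix y assume "y \<in> p ` B"
      then obtain b where "b \<in> B" "y = p b" by auto
      moreover have "b = 0 + b" by simp
      ultimately show "y \<in> p ` ?S" using subspace_0[OF A(1)] by blast
    qed
  qed
  moreover have "{x\<in>?S. p x = 0} = A"
  proof
    show "A \<subseteq> {x\<in>?S. p x = 0}"
    proof
      fix a assume "a \<in> A"
      moreover have "a = a + 0" by simp
      ultimately show "a \<in> {x\<in>?S. p x = 0}" using subspace_0[OF B(1)] p(2) by blast
    qed
  qed (use p(2) in auto)
  moreover have "{x\<in>B. p x = 0} = A \<inter> B" using p(2) by auto
  ultimately show ?thesis
    using dim_kernel_image[OF p(1) fS] dim_kernel_image[OF p(1) fB] by simp
qed

end

section \<open>Transfer of dimensions to records\<close>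

context vector_space begin

text \<open>\<open>V\<close> is a record model of U / N: \<open>T\<close> maps onto the carrier and
  its fibres are the cosets of \<open>N\<close>. The dimension of a record is the least size of a
  finite generating set, which calls for two estimates: the basis vectors of \<open>U\<close>
  outside a basis of \<open>N\<close> generate, and preimages of any finite generating set together
  with a basis of \<open>N\<close> span \<open>U\<close>.\<close>

lemma
  fixes V :: "('a, 'c, 'z) module_scheme" and T :: "'b \<Rightarrow> 'c"
  assumes U: "fin_subspace scale U" and N: "subspace N" "N \<subseteq> U"
    and car: "carrier V = T ` U"
    and add: "\<And>x y. x \<in> U \<Longrightarrow> y \<in> U \<Longrightarrow> T x \<oplus>\<^bsub>V\<^esub> T y = T (x + y)"
    and smult: "\<And>c x. x \<in> U \<Longrightarrow> c \<odot>\<^bsub>V\<^esub> T x = T (c *s x)"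
    and zero: "\<zero>\<^bsub>V\<^esub> = T 0"
    and eq: "\<And>x y. x \<in> U \<Longrightarrow> y \<in> U \<Longrightarrow> T x = T y \<longleftrightarrow> x - y \<in> N"
  shows vectorspace_dim_quotient: "int (vectorspace.dim base_field V) = int (dim U) - int (dim N)"
proof -
  note subU = fin_subspace_subspace[OF U]
  have F: "field (base_field :: 'a ring)" by (rule field_from_type_algebra)
  have simps: "carrier (base_field :: 'a ring) = UNIV" "\<And>x y. x \<oplus>\<^bsub>(base_field :: 'a ring)\<^esub> y = x + y"
    "\<And>x y. x \<otimes>\<^bsub>(base_field :: 'a ring)\<^esub> y = x * y" "\<one>\<^bsub>(base_field :: 'a ring)\<^esub> = 1"
    by (simp_all add: ring_of_type_algebra_def)
  have ab: "abelian_group V"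
  proof (rule abelian_groupI)
    fix x y z assume "x \<in> carrier V" "y \<in> carrier V" "z \<in> carrier V"
    thus "x \<oplus>\<^bsub>V\<^esub> y \<oplus>\<^bsub>V\<^esub> z = x \<oplus>\<^bsub>V\<^esub> (y \<oplus>\<^bsub>V\<^esub> z)"
      using subspace_add[OF subU] by (auto simp: car add add.assoc)
  next
    fix x y assume "x \<in> carrier V" "y \<in> carrier V"
    thus "x \<oplus>\<^bsub>V\<^esub> y \<in> carrier V" "x \<oplus>\<^bsub>V\<^esub> y = y \<oplus>\<^bsub>V\<^esub> x"
      using subspace_add[OF subU] by (auto simp: car add add.commute)
  next
    show "\<zero>\<^bsub>V\<^esub> \<in> carrier V" using subspace_0[OF subU] by (auto simp: car zero)
  next
    fix x assume "x \<in> carrier V"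
    then obtain u where u: "u \<in> U" "x = T u" by (auto simp: car)
    have "T (- u) \<in> carrier V" "T (- u) \<oplus>\<^bsub>V\<^esub> x = \<zero>\<^bsub>V\<^esub>"
      using u subspace_neg[OF subU] by (auto simp: car zero add)
    thus "\<exists>y\<in>carrier V. y \<oplus>\<^bsub>V\<^esub> x = \<zero>\<^bsub>V\<^esub>" by blast
    show "\<zero>\<^bsub>V\<^esub> \<oplus>\<^bsub>V\<^esub> x = x" using u subspace_0[OF subU] by (auto simp: zero add)
  qed
  have "Module.module base_field V"
  proof (rule moduleI)
    show "cring (base_field :: 'a ring)" by (rule cring_from_type_algebra)
    show "abelian_group V" by fact
  qed (auto simp: simps car smult add subspace_scale[OF subU] subspace_add[OF subU] scale_left_distrib scale_right_distrib)
  then interpret V: vectorspace base_field V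
    unfolding vectorspace_def using F by simp
  obtain BN where BN: "finite BN" "independent BN" "span BN = N" "dim N = card BN"
    by (rule fin_subspace_basis[OF fin_subspace_subset[OF U N]])
  have "BN \<subseteq> U" using BN(3) span_superset[of BN] N by auto
  then obtain B where B: "BN \<subseteq> B" "finite B" "independent B" "span B = U" "dim U = card B"
    by (rule fin_subspace_extend_basis[OF U BN(2)])
  have BU: "B \<subseteq> U" using B(4) span_superset[of B] by auto
  have Tadd_N: "T (x + n) = T x" if "x \<in> U" "n \<in> N" for x n
    using that N subspace_add[OF subU] by (subst eq) auto
  let ?D = "T ` (B - BN)"
  have D: "?D \<subseteq> carrier V" using BU by (auto simp: car)
  have gen: "V.span ?D = carrier V"
  proof
    show "V.span ?D \<subseteq> carrier V" by (rule V.span_is_subset2[OF D])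
    interpret S: LinearCombinations.submodule base_field "V.span ?D" V
      by (rule V.span_is_submodule[OF D])
    have "U \<subseteq> {x\<in>U. T x \<in> V.span ?D}"
    proof -
      have "BN \<subseteq> {x\<in>U. T x \<in> V.span ?D}"
      proof
        fix x assume "x \<in> BN"
        hence "x \<in> N" using BN(3) span_superset[of BN] by auto
        hence "T x = T 0" using N subspace_0[OF subU] by (subst eq) auto
        thus "x \<in> {x\<in>U. T x \<in> V.span ?D}" using \<open>x \<in> N\<close> N S.zero_closed zero by auto
      qed
      moreover have "B - BN \<subseteq> {x\<in>U. T x \<in> V.span ?D}"
        using BU V.in_own_span[OF D] by auto
      ultimately have "B \<subseteq> {x\<in>U. T x \<in> V.span ?D}" by auto
      moreover have "subspace {x\<in>U. T x \<in> V.span ?D}"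
      proof (rule subspaceI)
        show "0 \<in> {x\<in>U. T x \<in> V.span ?D}" using subspace_0[OF subU] zero S.zero_closed by auto
        show "x + y \<in> {x\<in>U. T x \<in> V.span ?D}" if "x \<in> {x\<in>U. T x \<in> V.span ?D}" "y \<in> {x\<in>U. T x \<in> V.span ?D}" for x y
          using that subspace_add[OF subU] add S.m_closed by (auto simp flip: add)
        show "c *s x \<in> {x\<in>U. T x \<in> V.span ?D}" if "x \<in> {x\<in>U. T x \<in> V.span ?D}" for c x
          using that subspace_scale[OF subU] S.smult_closed[of c "T x"] by (auto simp: simps simp flip: smult)
      qed
      ultimately show ?thesis using span_minimal[of B] B(4) by auto
    qed
    thus "carrier V \<subseteq> V.span ?D" by (auto simp: car)
  qed
  have le: "V.dim \<le> card (B - BN)"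
    using V.gen_ge_dim[OF _ D gen] card_image_le[of "B - BN" T] B(2) by fastforce
  have ge: "dim U \<le> card A + dim N" if A: "finite A" "A \<subseteq> carrier V" "V.span A = carrier V" for A
  proof -
    obtain A' where A': "A' \<subseteq> U" "finite A'" "card A' = card A" "A = T ` A'"
      using A(1,2) unfolding car by (metis card_image finite_imageD subset_image_inj)
    let ?S = "span (A' \<union> BN)"
    have SU: "?S \<subseteq> U" using A'(1) \<open>BN \<subseteq> U\<close> subU by (intro span_minimal) auto
    have "LinearCombinations.submodule base_field (T ` ?S) V"
    proof (unfold_locales)
      show "T ` ?S \<subseteq> carrier V" using SU by (auto simp: car)
      show "v \<oplus>\<^bsub>V\<^esub> w \<in> T ` ?S" if vw: "v \<in> T ` ?S" "w \<in> T ` ?S" for v w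
      proof -
        from vw obtain x y where "x \<in> ?S" "y \<in> ?S" "v = T x" "w = T y" by auto
        thus ?thesis using SU add[of x y] span_add[of x _ y] by auto
      qed
      show "\<zero>\<^bsub>V\<^esub> \<in> T ` ?S" using zero span_zero by auto
      show "c \<odot>\<^bsub>V\<^esub> v \<in> T ` ?S" if v: "v \<in> T ` ?S" for c v
      proof -
        from v obtain x where "x \<in> ?S" "v = T x" by auto
        thus ?thesis using SU smult[of x c] span_scale[of x _ c] by auto
      qed
    qed
    moreover have "A \<subseteq> T ` ?S" using A'(4) span_superset[of "A' \<union> BN"] by auto
    ultimately have "V.span A \<subseteq> T ` ?S" by (intro V.span_is_subset)
    hence im: "T ` U \<subseteq> T ` ?S" using A(3) car by simp
    have "U \<subseteq> ?S"
    proof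
      fix x assume x: "x \<in> U"
      then obtain y where y: "y \<in> ?S" "T x = T y" using im by blast
      hence "x - y \<in> N" using x SU by (subst eq[symmetric]) auto
      hence "x - y \<in> ?S" using BN(3) span_mono[of BN "A' \<union> BN"] by auto
      thus "x \<in> ?S" using span_add[OF _ y(1), of "x - y"] by simp
    qed
    hence "dim U \<le> card (A' \<union> BN)" using dim_le_card A'(2) BN(1) by auto
    also have "\<dots> \<le> card A' + card BN" by (rule card_Un_le)
    finally show ?thesis using A' BN by simp
  qed
  obtain A where A: "finite A" "card A = V.dim" "A \<subseteq> carrier V" "V.span A = carrier V"
  proof -
    have "\<exists>n A. finite A \<and> card A = n \<and> A \<subseteq> carrier V \<and> V.span A = carrier V"
      by (intro exI[of _ "card ?D"] exI[of _ ?D] conjI D gen refl) (use B(2) in auto)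
    from LeastI_ex[OF this] obtain A where
      "finite A" "card A = V.dim" "A \<subseteq> carrier V" "V.span A = carrier V"
      unfolding V.dim_def by auto
    thus ?thesis by (rule that)
  qed
  have "card (B - BN) = card B - card BN" using B(1) BN(1) by (intro card_Diff_subset)
  thus ?thesis using le ge[OF A(1,3,4)] A(2) BN(4) B(5) card_mono[OF B(2,1)] by simp
qed

end

definition scale3 :: "'k::field \<Rightarrow> 'k poly3 \<Rightarrow> 'k poly3" where
  "scale3 a f = const3 a * f"

definition scaleF :: "'k::field \<Rightarrow> (3 \<Rightarrow> 'k poly3) \<Rightarrow> 3 \<Rightarrow> 'k poly3" where
  "scaleF a b = (\<lambda>j. scale3 a (b j))"

interpretation v3: vector_space scale3
  by unfold_locales (simp_all add: scale3_def const3_add const3_mult algebra_simps)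

interpretation vF: vector_space scaleF
  by unfold_locales (simp_all add: scaleF_def fun_eq_iff algebra_simps)

interpretation vp: vector_space "smult :: 'k::field \<Rightarrow> 'k poly \<Rightarrow> 'k poly"
  by unfold_locales (simp_all add: smult_add_right smult_add_left)

interpretation v3p: vector_space_pair "scale3 :: 'k::field \<Rightarrow> 'k poly3 \<Rightarrow> 'k poly3" smult
  by unfold_locales
interpretation v33: vector_space_pair "scale3 :: 'k::field \<Rightarrow> 'k poly3 \<Rightarrow> 'k poly3" scale3
  by unfold_locales
interpretation v3F: vector_space_pair "scale3 :: 'k::field \<Rightarrow> 'k poly3 \<Rightarrow> 'k poly3" scaleF
  by unfold_locales
interpretation vF3: vector_space_pair "scaleF :: 'k::field \<Rightarrow> _" scale3
  by unfold_locales

definition forms :: "int \<Rightarrow> 'k::field poly3 set" where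
  "forms i = {f. homogeneous3 i f}"

lemma mem_forms [simp]: "f \<in> forms i \<longleftrightarrow> homogeneous3 i f"
  by (simp add: forms_def)

lemma subspace_forms: "v3.subspace (forms i)"
  by (rule v3.subspaceI) (auto simp: scale3_def homogeneous3_add homogeneous3_const3_mult)

lemma forms_neg: "i < 0 \<Longrightarrow> forms i = {0}"
  using homogeneous3_neg by auto

lemma fin_subspace_forms: "fin_subspace scale3 (forms i :: 'k::field poly3 set)"
proof -
  have *: "\<exists>W :: 'k poly3 set. finite W \<and> (\<forall>f. homogeneous3 (int n) f \<longrightarrow> f \<in> v3.span W)" for n
  proof (induction n)
    case 0
    have "f \<in> v3.span {1}" if "homogeneous3 0 f" for f :: "'k poly3"
    proof -
      have "f = scale3 (lk f 0) 1" using homogeneous3_degree_0[OF that] by (simp add: scale3_def)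
      thus ?thesis by (metis v3.span_base v3.span_scale singletonI)
    qed
    thus ?case by (intro exI[of _ "{1}"]) auto
  next
    case (Suc n)
    then obtain W :: "'k poly3 set" where W: "finite W" "\<And>f. homogeneous3 (int n) f \<Longrightarrow> f \<in> v3.span W" by auto
    define V where "V = (\<lambda>(j, w). var3 j * w) ` (UNIV \<times> W)"
    have lin: "Vector_Spaces.linear scale3 scale3 ((*) (var3 j :: 'k poly3))" for j
      by unfold_locales (simp_all add: scale3_def algebra_simps)
    have "f \<in> v3.span V" if "homogeneous3 (int (Suc n)) f" for f
    proof -
      have "homogeneous3 (int n + 1) f" using that by (simp add: add.commute)
      then obtain g where g: "\<And>j. homogeneous3 (int n) (g j)" "f = (\<Sum>j\<in>UNIV. var3 j * g j)"
        by (rule homogeneous3_decompose) auto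
      have "var3 j * g j \<in> v3.span V" for j
      proof -
        interpret Vector_Spaces.linear scale3 scale3 "(*) (var3 j :: 'k poly3)" by (rule lin)
        have "var3 j * g j \<in> (*) (var3 j) ` v3.span W" using W(2)[OF g(1)[of j]] by auto
        also have "\<dots> = v3.span ((*) (var3 j) ` W)" by (simp add: span_image)
        also have "\<dots> \<subseteq> v3.span V" by (rule v3.span_mono) (auto simp: V_def image_iff)
        finally show ?thesis .
      qed
      thus ?thesis unfolding g(2) by (intro v3.span_sum)
    qed
    moreover have "finite V" using W(1) by (simp add: V_def)
    ultimately show ?case by blast
  qed
  show ?thesis
  proof (cases "i < 0")
    case True
    thus ?thesis by (intro v3.fin_subspaceI[of _ "{}"] subspace_forms) (auto simp: forms_neg)
  next
    case False
    then obtain n where "i = int n" using nonneg_int_cases by (metis not_less)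
    with * obtain W :: "'k poly3 set" where "finite W" "\<forall>f. homogeneous3 i f \<longrightarrow> f \<in> v3.span W" by metis
    thus ?thesis by (intro v3.fin_subspaceI[of _ W] subspace_forms) auto
  qed
qed

lemma fin_subspace_forms_subset:
  "v3.subspace T \<Longrightarrow> T \<subseteq> forms i \<Longrightarrow> fin_subspace scale3 T"
  by (rule v3.fin_subspace_subset[OF fin_subspace_forms])

section \<open>Forms restricted to a line, and the dimension of S_i\<close>

section \<open>Restriction to a line\<close>

text \<open>The point (1 : t : 0), that is, the affine chart of the line X_2 = 0.\<close>

definition std_line :: "3 \<Rightarrow> 'k::field poly" where
  "std_line j = (if j = 0 then 1 else if j = 1 then [:0, 1:] else 0)"

lemma std_line_simps [simp]: "std_line 0 = 1" "std_line 1 = [:0, 1:]" "std_line 2 = 0"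
  by (simp_all add: std_line_def)

lemma monomial_eqI: "lk t 0 = lk u 0 \<Longrightarrow> lk t 1 = lk u 1 \<Longrightarrow> lk t 2 = lk u 2 \<Longrightarrow> t = u"
  for t u :: "3 \<Rightarrow>\<^sub>0 nat"
proof (rule poly_mapping_eqI)
  fix k :: 3
  assume "lk t 0 = lk u 0" "lk t 1 = lk u 1" "lk t 2 = lk u 2"
  hence "\<forall>k. lk t k = lk u k" by (simp add: forall_3)
  thus "lk t k = lk u k" ..
qed

lemma ev3_std_line:
  "ev3 (\<lambda>x. [:x:]) std_line f = (\<Sum>t\<in>ks f. monom (if lk t 2 = 0 then lk f t else 0) (lk t 1))"
  unfolding poly1.ev3_homogeneous3_eq
  by (intro sum.cong) (auto simp: monom_altdef zero_power)

text \<open>For a form of fixed degree, a monomial without X_2 is determined by its exponent of X_1,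
  so nothing cancels in the restriction to X_2 = 0. If the restriction is 0, every monomial contains
  X_2.\<close>

lemma vanish_std_line:
  assumes "homogeneous3 i f" "ev3 (\<lambda>x. [:x:]) std_line f = 0"
  obtains g where "f = var3 2 * g"
proof -
  have *: "lk t 2 \<noteq> 0" if t: "t \<in> ks f" for t
  proof
    assume t2: "lk t 2 = 0"
    have "(if lk u 1 = lk t 1 then if lk u 2 = 0 then lk f u else 0 else 0) = (if u = t then lk f t else 0)"
      if u: "u \<in> ks f" for u
    proof (cases "lk u 1 = lk t 1 \<and> lk u 2 = 0")
      case True
      have "int (deg3 u) = i" "int (deg3 t) = i" using assms(1) t u by (auto simp: homogeneous3_def deg3_def)
      hence "u = t" using True t2 by (intro monomial_eqI) (auto simp: deg3_eq)
      thus ?thesis using t2 by simp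
    qed (use t2 in auto)
    hence "coeff (ev3 (\<lambda>x. [:x:]) std_line f) (lk t 1) = (\<Sum>u\<in>ks f. if u = t then lk f t else 0)"
      unfolding ev3_std_line coeff_sum coeff_monom by (intro sum.cong) auto
    also have "\<dots> = lk f t" using t by simp
    finally show False using assms(2) t by (simp add: in_keys_iff)
  qed
  have "f = (\<Sum>t\<in>ks f. var3 2 * Poly_Mapping.single (t - Poly_Mapping.single 2 1) (lk f t))"
  proof (subst poly_mapping_sum_single, intro sum.cong refl)
    fix t assume "t \<in> ks f"
    hence "t = (t - Poly_Mapping.single 2 1) + Poly_Mapping.single 2 1"
      using *[of t] by (intro poly_mapping_eqI) (auto simp: lookup_add lookup_minus lookup_single when_def)
    thus "Poly_Mapping.single t (lk f t) = var3 2 * Poly_Mapping.single (t - Poly_Mapping.single 2 1) (lk f t)"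
      by (metis single_Suc_degree)
  qed
  thus ?thesis by (intro that) (simp flip: sum_distrib_left)
qed

lemma std_line_surj:
  assumes "degree p \<le> n"
  obtains f :: "'k::field poly3" where "homogeneous3 (int n) f" "ev3 (\<lambda>x. [:x:]) std_line f = p"
proof
  let ?f = "\<Sum>k\<le>n. const3 (coeff p k) * (var3 0 ^ (n - k) * var3 1 ^ k)"
  have *: "homogeneous3 (int (n - k) * 1 + int k * 1) (var3 0 ^ (n - k) * var3 1 ^ k :: 'k poly3)" for k
    by (intro homogeneous3_mult homogeneous3_power homogeneous3_var3)
  have "homogeneous3 (int n) (var3 0 ^ (n - k) * var3 1 ^ k :: 'k poly3)" if "k \<le> n" for k
  proof -
    have "int (n - k) * 1 + int k * 1 = int n" using that by simp
    from *[of k, unfolded this] show ?thesis .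
  qed
  thus "homogeneous3 (int n) ?f" by (intro homogeneous3_sum homogeneous3_const3_mult) auto
  have "ev3 (\<lambda>x. [:x:]) std_line ?f = (\<Sum>k\<le>n. monom (coeff p k) k)"
    by (simp add: monom_altdef)
  also have "\<dots> = p" using poly_as_sum_of_monoms'[OF assms] .
  finally show "ev3 (\<lambda>x. [:x:]) std_line ?f = p" .
qed

text \<open>\<open>L\<close> and \<open>r\<close> are mutually inverse linear changes of coordinates, and \<open>q\<close> parametrizes the affine
  part of the line \<open>L 2 = 0\<close>.\<close>

locale line_coords =
  fixes L r :: "3 \<Rightarrow> 'k::field poly3" and q :: "3 \<Rightarrow> 'k poly"
  assumes L_hom: "\<And>j. homogeneous3 1 (L j)" and r_hom: "\<And>j. homogeneous3 1 (r j)"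
    and L_r: "\<And>j. ev3 const3 L (r j) = var3 j"
    and q_L: "\<And>j. ev3 (\<lambda>x. [:x:]) q (L j) = std_line j"
begin

lemma q_r: "ev3 (\<lambda>x. [:x:]) std_line (r j) = q j"
proof -
  have "ev3 (\<lambda>x. [:x:]) q (ev3 const3 L (r j)) = ev3 (\<lambda>x. [:x:]) std_line (r j)"
    by (subst ev3_comp[OF poly1.coeff_hom_axioms]) (simp add: q_L)
  thus ?thesis by (simp add: L_r)
qed

lemma change: "ev3 const3 L (ev3 const3 r f) = f"
  by (subst ev3_comp[OF const3.coeff_hom_axioms]) (simp add: L_r ev3_var3_id)

text \<open>The substitution of \<open>r\<close> carries the problem to the line X_2 = 0, and that
  of \<open>L\<close> carries the factorization back.\<close>

lemma vanish:
  assumes "homogeneous3 (int n) f" "ev3 (\<lambda>x. [:x:]) q f = 0"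
  obtains g where "homogeneous3 (int n - 1) g" "f = L 2 * g"
proof -
  let ?f = "ev3 const3 r f"
  have "ev3 (\<lambda>x. [:x:]) std_line ?f = 0"
    by (subst ev3_comp[OF poly1.coeff_hom_axioms]) (simp add: q_r assms(2))
  from vanish_std_line[OF homogeneous3_ev3[OF assms(1) r_hom] this] obtain g where "?f = var3 2 * g" .
  hence "f = L 2 * ev3 const3 L g" by (metis change const3.ev3_mult const3.ev3_var3)
  thus ?thesis using homogeneous3_cofactor[OF assms(1) L_hom] that by blast
qed

lemma surj:
  assumes "degree p \<le> n"
  obtains f where "homogeneous3 (int n) f" "ev3 (\<lambda>x. [:x:]) q f = p"
proof -
  obtain f where f: "homogeneous3 (int n) f" "ev3 (\<lambda>x. [:x:]) std_line f = p"
    using std_line_surj[OF assms] .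
  have "ev3 (\<lambda>x. [:x:]) q (ev3 const3 L f) = p"
    by (subst ev3_comp[OF poly1.coeff_hom_axioms]) (simp add: q_L f(2))
  thus ?thesis by (rule that[OF homogeneous3_ev3[OF f(1) L_hom]])
qed

lemma q_deg: "degree (ev3 (\<lambda>x. [:x:]) q f) \<le> n" if "homogeneous3 (int n) f"
proof -
  have "degree (q j) \<le> 1 * 1" for j
    unfolding q_r[symmetric]
    by (rule degree_ev3_le) (use r_hom in \<open>auto simp: std_line_def\<close>)
  thus ?thesis using degree_ev3_le[OF that, of q 1] by simp
qed

end

lemma linear_ev3_poly: "Vector_Spaces.linear scale3 smult (ev3 (\<lambda>x. [:x:]) q)"
  by unfold_locales (simp_all add: scale3_def)

lemma linear_mult: "Vector_Spaces.linear scale3 scale3 ((*) g)"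
  by unfold_locales (simp_all add: scale3_def algebra_simps)

lemma dim_mult_image:
  assumes "fin_subspace scale3 U" "g \<noteq> 0"
  shows "v3.dim ((*) g ` U) = v3.dim U"
  by (rule v33.dim_image_inj[OF linear_mult assms(1)]) (use assms(2) in auto)

lemma independent_monoms: "vp.independent ((\<lambda>k. monom 1 k) ` A :: 'k::field poly set)"
proof -
  have "\<not> vp.dependent ((\<lambda>k. monom 1 k :: 'k poly) ` A)"
    unfolding vp.dependent_explicit
  proof safe
    fix T u v
    assume T: "finite T" "T \<subseteq> (\<lambda>k. monom 1 k) ` A" "v \<in> T" "u v \<noteq> (0::'k)"
      and s: "(\<Sum>v\<in>T. smult (u v) v) = 0"
    from T obtain k where k: "v = monom 1 k" by auto
    have "coeff (\<Sum>v\<in>T. smult (u v) v) k = (\<Sum>w\<in>T. if w = v then u v else 0)"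
      unfolding coeff_sum
    proof (intro sum.cong refl)
      fix w assume "w \<in> T"
      then obtain l where "w = monom 1 l" using T by auto
      thus "coeff (smult (u w) w) k = (if w = v then u v else 0)"
        using k by (auto simp: monom_eq_iff')
    qed
    thus False using s T by simp
  qed
  thus ?thesis .
qed

lemma dim_degree_le: "vp.dim {p :: 'k::field poly. degree p \<le> n} = n + 1"
proof -
  let ?B = "(\<lambda>k. monom 1 k :: 'k poly) ` {..n}"
  have "vp.dim {p :: 'k poly. degree p \<le> n} = card ?B"
  proof (rule vp.dim_unique)
    show "?B \<subseteq> {p. degree p \<le> n}" by (auto intro: order_trans[OF degree_monom_le])
    show "{p :: 'k poly. degree p \<le> n} \<subseteq> vp.span ?B"
    proof
      fix p :: "'k poly" assume "p \<in> {p. degree p \<le> n}"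
      hence "p = (\<Sum>k\<le>n. smult (coeff p k) (monom 1 k))"
        using poly_as_sum_of_monoms'[of p n] by (simp add: smult_monom)
      moreover have "\<dots> \<in> vp.span ?B" by (intro vp.span_sum vp.span_scale vp.span_base) auto
      ultimately show "p \<in> vp.span ?B" by simp
    qed
  qed (use independent_monoms in auto)
  also have "\<dots> = n + 1" by (subst card_image) (auto intro!: inj_onI simp: monom_eq_iff')
  finally show ?thesis .
qed

interpretation std: line_coords var3 var3 std_line
  by unfold_locales (simp_all add: homogeneous3_var3)

lemma var3_nonzero: "(var3 j :: 'k::field poly3) \<noteq> 0"
proof
  assume "(var3 j :: 'k poly3) = 0"
  hence "lk (var3 j :: 'k poly3) (Poly_Mapping.single j 1) = 0" by simp
  thus False by (simp add: var3_def)
qed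

text \<open>Rank-nullity for the restriction to X_2 = 0: the image consists of all polynomials of
  degree at most n, and the kernel is X_2 times the forms of degree n - 1.\<close>

lemma dim_forms_Suc:
  "v3.dim (forms (int n) :: 'k::field poly3 set) = (n + 1) + v3.dim (forms (int n - 1) :: 'k poly3 set)"
proof -
  let ?f = "ev3 (\<lambda>x. [:x::'k:]) std_line"
  have "?f ` forms (int n) = {p. degree p \<le> n}"
  proof
    show "?f ` forms (int n) \<subseteq> {p. degree p \<le> n}" using std.q_deg by auto
    show "{p. degree p \<le> n} \<subseteq> ?f ` forms (int n)"
    proof
      fix p :: "'k poly" assume "p \<in> {p. degree p \<le> n}"
      then obtain f where "homogeneous3 (int n) f" "?f f = p" using std.surj by auto
      thus "p \<in> ?f ` forms (int n)" by auto
    qed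
  qed
  moreover have "{f\<in>forms (int n). ?f f = 0} = (*) (var3 2) ` forms (int n - 1)"
  proof
    show "{f\<in>forms (int n). ?f f = 0} \<subseteq> (*) (var3 2) ` forms (int n - 1)"
      by (auto elim!: std.vanish)
    show "(*) (var3 2) ` forms (int n - 1) \<subseteq> {f\<in>forms (int n). ?f f = 0}"
      using homogeneous3_mult[OF homogeneous3_var3] by fastforce
  qed
  moreover have "(var3 2 :: 'k poly3) \<noteq> 0"
    by (rule var3_nonzero)
  moreover have "v3.dim (forms (int n) :: 'k poly3 set) =
      vp.dim (?f ` forms (int n)) + v3.dim {f\<in>forms (int n). ?f f = 0}"
    by (rule v3p.dim_kernel_image[OF linear_ev3_poly fin_subspace_forms])
  ultimately show ?thesis
    by (simp add: dim_degree_le dim_mult_image fin_subspace_forms del: mem_forms)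
qed

lemma dim_forms_neg: "i < 0 \<Longrightarrow> v3.dim (forms i :: 'k::field poly3 set) = 0"
  using v3.dim_le_card[of "{0}" "{}"] by (simp add: forms_neg)

lemma dim_forms: "2 * v3.dim (forms (int n) :: 'k::field poly3 set) = (n + 1) * (n + 2)"
proof (induction n)
  case 0
  show ?case using dim_forms_Suc[where ?'k = 'k, of 0] dim_forms_neg[where ?'k = 'k, of "-1"] by simp
next
  case (Suc n)
  show ?case using dim_forms_Suc[where ?'k = 'k, of "Suc n"] Suc by (simp add: algebra_simps)
qed

section \<open>Multiplicity at a point: powers of ideals and Taylor order\<close>

section \<open>Powers of vanishing ideals\<close>

lemma poly3_ring_simps [simp]:
  "carrier (poly3_ring :: 'k::field poly3 ring) = UNIV"
  "x \<oplus>\<^bsub>(poly3_ring :: 'k poly3 ring)\<^esub> y = x + y"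
  "x \<otimes>\<^bsub>(poly3_ring :: 'k poly3 ring)\<^esub> y = x * y"
  "\<one>\<^bsub>(poly3_ring :: 'k poly3 ring)\<^esub> = 1" "\<zero>\<^bsub>(poly3_ring :: 'k poly3 ring)\<^esub> = 0"
  by (simp_all add: ring_of_type_algebra_def)

lemma ring_poly3: "ring (poly3_ring :: 'k::field poly3 ring)"
  by (rule ring_from_type_algebra)

lemma a_inv_poly3 [simp]: "\<ominus>\<^bsub>(poly3_ring :: 'k::field poly3 ring)\<^esub> x = - x"
proof -
  interpret ring "poly3_ring :: 'k poly3 ring" by (rule ring_poly3)
  show ?thesis using minus_equality[of "- x" x] by simp
qed

lemma ideal_poly3I:
  fixes I :: "'k::field poly3 set"
  assumes "0 \<in> I" "\<And>f g. f \<in> I \<Longrightarrow> g \<in> I \<Longrightarrow> f + g \<in> I" "\<And>f g. f \<in> I \<Longrightarrow> g * f \<in> I"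
  shows "ideal I poly3_ring"
proof (rule idealI[OF ring_poly3])
  interpret ring "poly3_ring :: 'k poly3 ring" by (rule ring_poly3)
  show "subgroup I (add_monoid poly3_ring)"
  proof (rule add.subgroupI)
    show "\<ominus>\<^bsub>poly3_ring\<^esub> a \<in> I" if "a \<in> I" for a
      using assms(3)[OF that, of "- 1"] by simp
  qed (use assms in auto)
qed (use assms in \<open>auto simp: mult.commute\<close>)

lemma
  fixes I :: "'k::field poly3 set"
  assumes "ideal I poly3_ring"
  shows ideal_poly3_0: "0 \<in> I" and ideal_poly3_add: "f \<in> I \<Longrightarrow> g \<in> I \<Longrightarrow> f + g \<in> I"
    and ideal_poly3_mult: "f \<in> I \<Longrightarrow> g * f \<in> I" and ideal_poly3_mult': "f \<in> I \<Longrightarrow> f * g \<in> I"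
    and ideal_poly3_diff: "f \<in> I \<Longrightarrow> g \<in> I \<Longrightarrow> f - g \<in> I"
    and ideal_poly3_sum: "(\<And>x. x \<in> A \<Longrightarrow> h x \<in> I) \<Longrightarrow> (\<Sum>x\<in>A. h x) \<in> I"
proof -
  show 0: "0 \<in> I"
    using additive_subgroup.zero_closed[OF ideal.axioms(1)[OF assms]] by simp
  show add: "f + g \<in> I" if "f \<in> I" "g \<in> I" for f g
    using additive_subgroup.a_closed[OF ideal.axioms(1)[OF assms] that] by simp
  show mult: "g * f \<in> I" if "f \<in> I" for f g
    using ideal.I_l_closed[OF assms that, of g] by simp
  show "f * g \<in> I" if "f \<in> I" using mult[OF that, of g] by (simp add: mult.commute)
  show "f - g \<in> I" if "f \<in> I" "g \<in> I" using add[OF that(1) mult[OF that(2), of "- 1"]] by simp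
  show "(\<And>x. x \<in> A \<Longrightarrow> h x \<in> I) \<Longrightarrow> (\<Sum>x\<in>A. h x) \<in> I"
    by (induction A rule: infinite_finite_induct) (auto intro: 0 add)
qed

lemma subspace_ideal:
  assumes "ideal I poly3_ring" shows "v3.subspace I"
  by (rule v3.subspaceI)
    (auto simp: scale3_def intro: ideal_poly3_0[OF assms] ideal_poly3_add[OF assms] ideal_poly3_mult[OF assms])

lemma ideal_vanishing_ideal: "ideal (vanishing_ideal p) poly3_ring"
  unfolding vanishing_ideal_def by (rule ring.genideal_ideal[OF ring_poly3]) simp

lemma vanishing_ideal_subset:
  assumes "ideal I poly3_ring" "\<And>i f. homogeneous3 i f \<Longrightarrow> eval3 f p = 0 \<Longrightarrow> f \<in> I"
  shows "vanishing_ideal p \<subseteq> I"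
  unfolding vanishing_ideal_def using assms by (intro ring.genideal_minimal[OF ring_poly3]) auto

lemma vanishing_idealI: "homogeneous3 i f \<Longrightarrow> eval3 f p = 0 \<Longrightarrow> f \<in> vanishing_ideal p"
  unfolding vanishing_ideal_def
  using ring.genideal_self[OF ring_poly3, of "{f. (\<exists>i. homogeneous3 i f) \<and> eval3 f p = 0}"] by auto

definition point_power :: "(3 \<Rightarrow> 'k::field) \<Rightarrow> nat \<Rightarrow> 'k poly3 set" where
  "point_power p m = vanishing_ideal p [^]\<^bsub>ideals_set poly3_ring\<^esub> m"

lemma fat_ideal_eq: "fat_ideal s m P = (\<Inter>j\<in>{1..s}. point_power (P j) (m j))"
  by (simp add: fat_ideal_def point_power_def)

lemma point_power_0: "point_power p 0 = UNIV"
  by (simp add: point_power_def ideals_set_def nat_pow_def)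

lemma point_power_Suc: "point_power p (Suc m) = ideal_prod poly3_ring (point_power p m) (vanishing_ideal p)"
  by (simp add: point_power_def ideals_set_def nat_pow_def)

lemma ideal_point_power: "ideal (point_power p m) poly3_ring"
proof (induction m)
  case 0
  show ?case unfolding point_power_0 by (rule ideal_poly3I) auto
next
  case (Suc m)
  show ?case unfolding point_power_Suc
    by (rule ring.ideal_prod_is_ideal[OF ring_poly3 Suc ideal_vanishing_ideal])
qed

lemma point_power_SucI: "f \<in> point_power p m \<Longrightarrow> g \<in> vanishing_ideal p \<Longrightarrow> f * g \<in> point_power p (Suc m)"
  unfolding point_power_Suc using ideal_prod.prod[of f _ g _ poly3_ring] by simp

lemma point_power_Suc_induct [consumes 1, case_names prod sum]:
  assumes "f \<in> point_power p (Suc m)"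
    "\<And>f g. f \<in> point_power p m \<Longrightarrow> g \<in> vanishing_ideal p \<Longrightarrow> Q (f * g)"
    "\<And>f g. Q f \<Longrightarrow> Q g \<Longrightarrow> Q (f + g)"
  shows "Q f"
  using assms(1) unfolding point_power_Suc
  by (induction rule: ideal_prod.induct) (use assms(2,3) in auto)

lemma point_power_antimono_Suc: "point_power p (Suc m) \<subseteq> point_power p m"
proof
  fix f assume "f \<in> point_power p (Suc m)"
  thus "f \<in> point_power p m"
    by (induction rule: point_power_Suc_induct)
      (auto intro: ideal_poly3_mult'[OF ideal_point_power] ideal_poly3_add[OF ideal_point_power])
qed

lemma point_power_antimono: "m \<le> n \<Longrightarrow> point_power p n \<subseteq> point_power p m"
  by (induction rule: dec_induct) (use point_power_antimono_Suc in auto)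

lemma point_power_prod:
  assumes "g \<in> vanishing_ideal p" "h \<in> vanishing_ideal p"
  shows "f * g ^ a * h ^ b \<in> point_power p (a + b)"
proof (induction b)
  case 0
  show ?case
  proof (induction a)
    case 0 thus ?case by (simp add: point_power_0)
  next
    case (Suc a)
    thus ?case using point_power_SucI[OF Suc assms(1)] by (simp add: mult_ac)
  qed
next
  case (Suc b)
  thus ?case using point_power_SucI[OF Suc assms(2)] by (simp add: mult_ac)
qed

text \<open>A form is multiplied by a power of \<open>c\<close> under scaling, so its vanishing does
  not depend on the coordinate vector. This permits normalizing entry 0 of every point to 1.\<close>

lemma vanishing_ideal_scale:
  assumes "c \<noteq> (0 :: 'k::field)"
  shows "vanishing_ideal (\<lambda>j. c * p j) = vanishing_ideal p"
proof -
  have "eval3 f (\<lambda>j. c * p j) = 0 \<longleftrightarrow> eval3 f p = 0" if "homogeneous3 i f" for f :: "'k poly3" and i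
  proof (cases "i < 0")
    case True thus ?thesis using homogeneous3_neg[OF that] by simp
  next
    case False
    then obtain n where "i = int n" using nonneg_int_cases by (metis not_less)
    thus ?thesis using id.ev3_scale[of n f c p] that assms by (simp add: eval3_eq_ev3)
  qed
  hence "{f :: 'k poly3. (\<exists>i. homogeneous3 i f) \<and> eval3 f (\<lambda>j. c * p j) = 0} =
    {f. (\<exists>i. homogeneous3 i f) \<and> eval3 f p = 0}" by blast
  thus ?thesis by (simp add: vanishing_ideal_def)
qed

lemma point_power_scale: "c \<noteq> 0 \<Longrightarrow> point_power (\<lambda>j. c * p j) m = point_power p m"
  by (simp add: point_power_def vanishing_ideal_scale)

section \<open>Homogeneity and derivatives\<close>

definition hom_ideal :: "'k::field poly3 set \<Rightarrow> bool" where
  "hom_ideal I \<longleftrightarrow> ideal I poly3_ring \<and> (\<forall>f\<in>I. \<forall>i. hcomp i f \<in> I)"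

lemma hom_ideal_vanishing_ideal: "hom_ideal (vanishing_ideal p)"
proof -
  let ?I = "vanishing_ideal p"
  let ?J = "{f. \<forall>i. hcomp i f \<in> ?I}"
  note [simp] = ideal_poly3_0[OF ideal_vanishing_ideal] ideal_poly3_add[OF ideal_vanishing_ideal]
  have "?I \<subseteq> ?J"
  proof (rule vanishing_ideal_subset)
    show "ideal ?J poly3_ring"
    proof (rule ideal_poly3I)
      fix f g assume f: "f \<in> ?J"
      have "hcomp i (g * f) \<in> ?I" for i
      proof -
        have "g * f = (\<Sum>k\<in>(\<lambda>t. int (deg3 t)) ` ks g. f * hcomp k g)"
          by (subst sum_hcomp[of g]) (simp add: sum_distrib_right sum_distrib_left mult.commute)
        hence "hcomp i (g * f) = (\<Sum>k\<in>(\<lambda>t. int (deg3 t)) ` ks g. hcomp (i - k) f * hcomp k g)"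
          by (simp only: hcomp_sum hcomp_mult[OF homogeneous3_hcomp])
        thus ?thesis using f
          by (auto intro!: ideal_poly3_sum[OF ideal_vanishing_ideal] ideal_poly3_mult'[OF ideal_vanishing_ideal])
      qed
      thus "g * f \<in> ?J" by simp
    qed (auto simp: hcomp_add)
    show "f \<in> ?J" if "homogeneous3 i f" "eval3 f p = 0" for i f
      using vanishing_idealI[OF that] by (auto simp: hcomp_homogeneous[OF that(1)])
  qed
  thus ?thesis using ideal_vanishing_ideal by (auto simp: hom_ideal_def)
qed

lemma hom_ideal_point_power: "hom_ideal (point_power p m)"
proof (induction m)
  case 0
  thus ?case using ideal_point_power[of p 0] by (simp add: hom_ideal_def point_power_0)
next
  case (Suc m)
  note [simp] = ideal_poly3_add[OF ideal_point_power]
  have "\<forall>i. hcomp i f \<in> point_power p (Suc m)" if "f \<in> point_power p (Suc m)" for f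
    using that
  proof (induction rule: point_power_Suc_induct)
    case (prod f g)
    show ?case
    proof
      fix i
      have "f * g = (\<Sum>k\<in>(\<lambda>t. int (deg3 t)) ` ks g. f * hcomp k g)"
        by (subst sum_hcomp[of g]) (simp add: sum_distrib_left)
      hence "hcomp i (f * g) = (\<Sum>k\<in>(\<lambda>t. int (deg3 t)) ` ks g. hcomp (i - k) f * hcomp k g)"
        by (simp only: hcomp_sum hcomp_mult[OF homogeneous3_hcomp])
      moreover have "hcomp (i - k) f * hcomp k g \<in> point_power p (Suc m)" for k
        using Suc prod hom_ideal_vanishing_ideal by (intro point_power_SucI) (auto simp: hom_ideal_def)
      ultimately show "hcomp i (f * g) \<in> point_power p (Suc m)"
        by (simp add: ideal_poly3_sum[OF ideal_point_power])
    qed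
  qed (simp add: hcomp_add)
  thus ?case using ideal_point_power by (auto simp: hom_ideal_def)
qed

text \<open>Leibniz rule on the generating products: differentiation costs one factor.\<close>

lemma partial3_point_power: "f \<in> point_power p (Suc m) \<Longrightarrow> partial3 j f \<in> point_power p m"
proof (induction m arbitrary: f)
  case 0 thus ?case by (simp add: point_power_0)
next
  case (Suc m)
  from Suc.prems show ?case
  proof (induction rule: point_power_Suc_induct)
    case (prod f g)
    have "g * partial3 j f \<in> point_power p (Suc m)"
      using point_power_SucI[OF Suc.IH[OF prod(1)] prod(2)] by (simp add: mult.commute)
    thus ?case using ideal_poly3_mult'[OF ideal_point_power prod(1)]
      by (simp add: ideal_poly3_add[OF ideal_point_power])
  qed (simp add: ideal_poly3_add[OF ideal_point_power])
qed

lemma ideal_fat_ideal: "ideal (fat_ideal s m P) poly3_ring"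
  unfolding fat_ideal_eq
  by (rule ideal_poly3I)
    (auto intro: ideal_poly3_0[OF ideal_point_power] ideal_poly3_add[OF ideal_point_power] ideal_poly3_mult[OF ideal_point_power])

lemma hom_ideal_fat_ideal: "hom_ideal (fat_ideal s m P)"
  using hom_ideal_point_power ideal_fat_ideal[of s m P] unfolding hom_ideal_def fat_ideal_eq by blast

section \<open>Orders of vanishing\<close>

lemma X_power_dvd_iff: "[:0, 1:] ^ m dvd F \<longleftrightarrow> (\<forall>b<m. coeff F b = 0)"
proof -
  have "[:0, 1:] ^ m = (monom 1 m :: 'a poly)" by (simp add: monom_altdef)
  thus ?thesis by (simp add: monom_1_dvd_iff')
qed

text \<open>Pulling back along \<open>q\<close> sends each form that vanishes at \<open>p\<close> to
  a polynomial with root \<open>\<tau>\<close>, and orders add up in products. The factor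
  \<open>\<kappa>\<close> may be 0, in which case the curve has the zero vector at
  \<open>\<tau>\<close> and the root is still there.\<close>

lemma point_power_order_curve:
  fixes q :: "3 \<Rightarrow> 'k::field poly"
  assumes "f \<in> point_power p m" "\<And>j. poly (q j) \<tau> = \<kappa> * p j"
  shows "[:- \<tau>, 1:] ^ m dvd ev3 (\<lambda>x. [:x:]) q f"
  using assms(1)
proof (induction m arbitrary: f)
  case 0 thus ?case by simp
next
  case (Suc m)
  have v: "vanishing_ideal p \<subseteq> {g. [:- \<tau>, 1:] dvd ev3 (\<lambda>x. [:x:]) q g}"
  proof (rule vanishing_ideal_subset)
    show "ideal {g. [:- \<tau>, 1:] dvd ev3 (\<lambda>x. [:x:]) q g} poly3_ring"
      by (rule ideal_poly3I) auto
    fix i g assume g: "homogeneous3 i g" "eval3 g p = 0"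
    have "poly (ev3 (\<lambda>x. [:x:]) q g) \<tau> = eval3 g (\<lambda>j. \<kappa> * p j)"
      unfolding eval3_eq_ev3 by (rule id.ev3_unique) (simp_all add: assms(2))
    also have "\<dots> = 0"
    proof (cases "i < 0")
      case True thus ?thesis using homogeneous3_neg[OF g(1)] by simp
    next
      case False
      then obtain n where "i = int n" using nonneg_int_cases by (metis not_less)
      thus ?thesis using id.ev3_scale[of n g \<kappa> p] g by (simp add: eval3_eq_ev3)
    qed
    finally show "g \<in> {g. [:- \<tau>, 1:] dvd ev3 (\<lambda>x. [:x:]) q g}" by (simp add: poly_eq_0_iff_dvd)
  qed
  from Suc.prems show ?case
  proof (induction rule: point_power_Suc_induct)
    case (prod f g)
    have "[:- \<tau>, 1:] ^ m * [:- \<tau>, 1:] dvd ev3 (\<lambda>x. [:x:]) q f * ev3 (\<lambda>x. [:x:]) q g"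
      using Suc.IH[OF prod(1)] v prod(2) by (intro mult_dvd_mono) auto
    thus ?case by (simp add: mult.commute)
  qed simp
qed

text \<open>The generic line through \<open>p\<close>: the outer variable \<open>e\<close> is the parameter of the line and the inner
  variable \<open>z\<close> its slope, so that \<open>taylor p f\<close> is \<open>f (p 0, p 1 + e, p 2 + e z)\<close>. For \<open>p 0 = 1\<close> and a form
  \<open>f\<close>, divisibility by a power of \<open>e\<close> detects the order of vanishing at \<open>p\<close>.\<close>

definition generic_line :: "(3 \<Rightarrow> 'k::field) \<Rightarrow> 3 \<Rightarrow> 'k poly poly" where
  "generic_line p j = (if j = 0 then [:[:p 0:]:] else if j = 1 then [:[:p 1:], 1:] else [:[:p 2:], [:0, 1:]:])"

definition taylor :: "(3 \<Rightarrow> 'k::field) \<Rightarrow> 'k poly3 \<Rightarrow> 'k poly poly" where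
  "taylor p = ev3 (\<lambda>x. [:[:x:]:]) (generic_line p)"

lemma generic_line_simps [simp]: "generic_line p 0 = [:[:p 0:]:]" "generic_line p 1 = [:[:p 1:], 1:]"
  "generic_line p 2 = [:[:p 2:], [:0, 1:]:]"
  by (simp_all add: generic_line_def)

lemma taylor_simps [simp]: "taylor p (f + g) = taylor p f + taylor p g" "taylor p (f * g) = taylor p f * taylor p g"
  "taylor p 0 = 0" "taylor p (f - g) = taylor p f - taylor p g" "taylor p (const3 a) = [:[:a:]:]"
  "taylor p (var3 j) = generic_line p j" "taylor p 1 = 1"
  by (simp_all add: taylor_def)

text \<open>At e = 0 the generic line passes through \<open>p\<close> whatever its slope, so the
  value does not involve z.\<close>

lemma poly_taylor_0: "poly (taylor p f) 0 = [:eval3 f p:]"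
proof -
  have "eval3 f p = coeff (poly (taylor p f) 0) 0"
  proof -
    have "(\<lambda>f. coeff (poly (taylor p f) 0) 0) f = ev3 (\<lambda>x. x) p f"
    proof (rule id.ev3_unique)
      have "\<forall>j. coeff (poly (taylor p (var3 j)) 0) 0 = p j" unfolding forall_3 by simp
      thus "coeff (poly (taylor p (var3 j)) 0) 0 = p j" for j by simp
    qed (simp_all add: coeff_mult)
    thus ?thesis by (simp add: eval3_eq_ev3)
  qed
  moreover have "degree (poly (taylor p f) 0) = 0"
  proof (induction f rule: poly3_induct)
    case (var j)
    have "\<forall>j. degree (poly (taylor p (var3 j)) 0) = 0" unfolding forall_3 by simp
    thus ?case by simp
  next
    case (add f g)
    thus ?case using degree_add_le[of "poly (taylor p f) 0" 0 "poly (taylor p g) 0"] by simp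
  next
    case (mult f g)
    thus ?case using degree_mult_le[of "poly (taylor p f) 0" "poly (taylor p g) 0"] by simp
  qed simp
  ultimately show ?thesis by (metis coeff_pCons_0 degree_eq_zeroE)
qed

lemma point_power_order:
  assumes "f \<in> point_power p m"
  shows "[:0, 1:] ^ m dvd taylor p f"
  using assms
proof (induction m arbitrary: f)
  case 0 thus ?case by simp
next
  case (Suc m)
  have v: "vanishing_ideal p \<subseteq> {g. [:0, 1:] dvd taylor p g}"
  proof (rule vanishing_ideal_subset)
    show "ideal {g. [:0, 1:] dvd taylor p g} poly3_ring"
      by (rule ideal_poly3I) auto
    fix i g assume g: "homogeneous3 i g" "eval3 g p = 0"
    show "g \<in> {g. [:0, 1:] dvd taylor p g}"
      using poly_taylor_0[of p g] g by (simp add: poly_eq_0_iff_dvd)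
  qed
  from Suc.prems show ?case
  proof (induction rule: point_power_Suc_induct)
    case (prod f g)
    have "[:0, 1:] ^ m * [:0, 1:] dvd taylor p f * taylor p g"
      using Suc.IH[OF prod(1)] v prod(2) by (intro mult_dvd_mono) auto
    thus ?case by (simp add: mult.commute)
  qed simp
qed

text \<open>The generic line through (1 : 0 : 0), again with parameter e outside and slope z
  inside.\<close>

definition std_generic :: "3 \<Rightarrow> 'k::field poly poly" where
  "std_generic j = (if j = 0 then 1 else if j = 1 then [:0, 1:] else [:0, [:0, 1:]:])"

lemma std_generic_simps: "std_generic 0 = 1" "std_generic 1 = [:0, 1:]" "std_generic 2 = [:0, [:0, 1:]:]"
  by (simp_all add: std_generic_def)

lemma ev3_std_generic:
  "ev3 (\<lambda>x. [:[:x:]:]) std_generic f = (\<Sum>t\<in>ks f. monom (monom (lk f t) (lk t 2)) (lk t 1 + lk t 2))"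
proof -
  have *: "[:[:a:]:] * ([:0, 1:] ^ k * [:0, [:0, 1:]:] ^ l) = monom (monom a l) (k + l)" for a :: 'a and k l
  proof -
    have "[:0, [:0, 1:]:] = [:[:0, 1 :: 'a:]:] * [:0, 1:]" by simp
    hence "[:[:a:]:] * ([:0, 1:] ^ k * [:0, [:0, 1:]:] ^ l) = [:[:a:] * [:0, 1:] ^ l:] * [:0, 1:] ^ (k + l)"
      by (simp only: power_mult_distrib power_add) (simp add: mult_ac poly_const_pow)
    thus ?thesis by (simp add: monom_altdef)
  qed
  show ?thesis
    unfolding poly2.ev3_homogeneous3_eq
    by (intro sum.cong refl) (simp only: std_generic_simps power_one mult_1 *)
qed

text \<open>On this line X_0^a X_1^b X_2^c becomes e^(b + c) z^c. Once the degree is fixed, b + c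
  and c determine the monomial, so nothing cancels and the order in e can be read off from the
  monomials.\<close>

lemma order_std_generic:
  fixes f :: "'a::field poly3"
  assumes "homogeneous3 i f" "[:0, 1:] ^ m dvd ev3 (\<lambda>x. [:[:x:]:]) std_generic f" "t \<in> ks f"
  shows "m \<le> lk t 1 + lk t 2"
proof (rule ccontr)
  assume "\<not> m \<le> lk t 1 + lk t 2"
  moreover have "[:0, 1:] ^ m = (monom 1 m :: 'a poly poly)" by (simp add: monom_altdef)
  with assms(2) obtain h where "ev3 (\<lambda>x. [:[:x:]:]) std_generic f = monom 1 m * h" by (auto elim: dvdE)
  ultimately have "coeff (ev3 (\<lambda>x. [:[:x:]:]) std_generic f) (lk t 1 + lk t 2) = 0"
    by (simp add: coeff_monom_mult)
  moreover have "coeff (coeff (ev3 (\<lambda>x. [:[:x:]:]) std_generic f) (lk t 1 + lk t 2)) (lk t 2) =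
     (\<Sum>u\<in>ks f. if u = t then lk f t else 0)"
    unfolding ev3_std_generic coeff_sum coeff_monom
  proof (intro sum.cong refl)
    fix u assume u: "u \<in> ks f"
    show "coeff (if lk u 1 + lk u 2 = lk t 1 + lk t 2 then monom (lk f u) (lk u 2) else 0) (lk t 2) =
      (if u = t then lk f t else 0)"
    proof (cases "lk u 1 + lk u 2 = lk t 1 + lk t 2 \<and> lk u 2 = lk t 2")
      case True
      have "int (deg3 u) = i" "int (deg3 t) = i" using assms(1,3) u by (auto simp: homogeneous3_def deg3_def)
      hence "u = t" using True by (intro monomial_eqI) (auto simp: deg3_eq)
      thus ?thesis by simp
    qed auto
  qed
  moreover have "\<dots> = lk f t" using assms(3) by simp
  ultimately show False using assms(3) by (simp add: in_keys_iff)
qed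

text \<open>A linear change of coordinates moves \<open>p\<close> to (1 : 0 : 0). There, order m
  means that every monomial has degree at least m in X_1 and X_2; moved back, these variables become
  linear forms vanishing at \<open>p\<close>.\<close>

lemma point_powerI:
  fixes f :: "'a::field poly3"
  assumes "p 0 = 1" "homogeneous3 (int n) f" "[:0, 1:] ^ m dvd taylor p f"
  shows "f \<in> point_power p m"
proof -
  define L :: "3 \<Rightarrow> 'a poly3" where "L j = (if j = 0 then var3 0 else var3 j - const3 (p j) * var3 0)" for j
  define r :: "3 \<Rightarrow> 'a poly3" where "r j = (if j = 0 then var3 0 else const3 (p j) * var3 0 + var3 j)" for j
  have r_hom: "homogeneous3 1 (r j)" for j
    by (simp add: r_def homogeneous3_var3 homogeneous3_add homogeneous3_const3_mult)
  have L_hom: "homogeneous3 1 (L j)" for j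
    by (simp add: L_def homogeneous3_var3 homogeneous3_diff homogeneous3_const3_mult)
  have L_r: "ev3 const3 L (r j) = var3 j" for j
    by (simp add: r_def L_def)
  have g_r: "ev3 (\<lambda>x. [:[:x:]:]) std_generic (r j) = generic_line p j" for j
  proof -
    have "\<forall>j. ev3 (\<lambda>x. [:[:x:]:]) std_generic (r j) = generic_line p j"
      unfolding forall_3 by (simp add: r_def std_generic_def assms(1) flip: one_pCons)
    thus ?thesis ..
  qed
  let ?f = "ev3 const3 r f"
  have hom: "homogeneous3 (int n) ?f" by (rule homogeneous3_ev3[OF assms(2) r_hom])
  have "ev3 (\<lambda>x. [:[:x:]:]) std_generic ?f = taylor p f"
    by (subst ev3_comp[OF poly2.coeff_hom_axioms]) (simp add: g_r taylor_def)
  hence keys: "m \<le> lk t 1 + lk t 2" if "t \<in> ks ?f" for t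
    using order_std_generic[OF hom _ that] assms(3) by simp
  have L: "L 1 \<in> vanishing_ideal p" "L 2 \<in> vanishing_ideal p"
    by (rule vanishing_idealI[OF L_hom], simp add: L_def assms(1))+
  have "f = ev3 const3 L ?f"
    by (subst ev3_comp[OF const3.coeff_hom_axioms]) (simp add: L_r ev3_var3_id)
  also have "\<dots> = (\<Sum>t\<in>ks ?f. const3 (lk ?f t) * (L 0 ^ lk t 0 * L 1 ^ lk t 1 * L 2 ^ lk t 2))"
    by (rule const3.ev3_homogeneous3_eq)
  also have "\<dots> \<in> point_power p m"
  proof (rule ideal_poly3_sum[OF ideal_point_power])
    fix t assume t: "t \<in> ks ?f"
    have "const3 (lk ?f t) * L 0 ^ lk t 0 * L 1 ^ lk t 1 * L 2 ^ lk t 2 \<in> point_power p (lk t 1 + lk t 2)"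
      by (rule point_power_prod[OF L])
    thus "const3 (lk ?f t) * (L 0 ^ lk t 0 * L 1 ^ lk t 1 * L 2 ^ lk t 2) \<in> point_power p m"
      using point_power_antimono[OF keys[OF t], of p] by (auto simp: mult.assoc)
  qed
  finally show ?thesis .
qed

lemma point_power_iff:
  assumes "p 0 = 1" "homogeneous3 (int n) f"
  shows "f \<in> point_power p m \<longleftrightarrow> [:0, 1:] ^ m dvd taylor p f"
  using assms point_powerI point_power_order by blast

text \<open>By the chain rule the derivative of the Taylor expansion in e is a combination of
  expansions of the partial derivatives, so its order is at least m. Its coefficient at e^(m - 1) is
  m times the coefficient of the expansion at e^m; in characteristic 0 the latter vanishes.\<close>

lemma point_power_SucD:
  fixes p :: "3 \<Rightarrow> 'k::field_char_0"
  assumes "p 0 = 1" "homogeneous3 (int n) f" "f \<in> point_power p m" "\<And>j. partial3 j f \<in> point_power p m" "m > 0"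
  shows "f \<in> point_power p (Suc m)"
proof -
  let ?E = "[:0, 1:] :: 'k poly poly"
  have "?E ^ m dvd pderiv (taylor p f)"
    unfolding taylor_def
    by (subst pderiv_ev3[OF poly2.coeff_hom_axioms])
      (use point_power_order[OF assms(4)] in \<open>auto intro!: dvd_sum dvd_mult simp: taylor_def pderiv_pCons\<close>)
  hence "coeff (pderiv (taylor p f)) (m - 1) = 0"
    using assms(5) unfolding X_power_dvd_iff by simp
  hence "of_nat m * coeff (taylor p f) m = 0"
    using assms(5) by (simp add: coeff_pderiv)
  hence "coeff (taylor p f) m = 0" using assms(5) by simp
  hence "?E ^ Suc m dvd taylor p f"
    using point_power_order[OF assms(3)] unfolding X_power_dvd_iff by (auto simp: less_Suc_eq)
  thus ?thesis by (rule point_powerI[where p = p and n = n, OF assms(1,2)])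
qed

section \<open>Geometry of the conic: lines, polar form, parametrization, divisibility\<close>

section \<open>Linear and quadratic forms\<close>

lemma (in coeff_hom) ev3_linear:
  assumes "homogeneous3 1 f"
  shows "ev3 c (\<lambda>j. a * x j + b * y j) f = a * ev3 c x f + b * ev3 c y f"
proof -
  have "homogeneous3 (0 + 1) f" using assms by simp
  then obtain g where g: "\<And>j. homogeneous3 0 (g j)" "f = (\<Sum>j\<in>UNIV. var3 j * g j)"
    by (rule homogeneous3_decompose) auto
  define e where "e j = lk (g j) 0" for j
  have "f = (\<Sum>j\<in>UNIV. var3 j * const3 (e j))"
    unfolding g(2) e_def by (intro sum.cong refl) (metis g(1) homogeneous3_degree_0)
  thus ?thesis by (simp add: sum_distrib_left sum.distrib algebra_simps)
qed

lemma quadratic_form: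
  fixes C :: "'k::field poly3"
  assumes "homogeneous3 2 C"
  obtains e where "C = (\<Sum>j\<in>UNIV. \<Sum>k\<in>UNIV. const3 (e j k) * (var3 j * var3 k))"
proof -
  have "homogeneous3 (1 + 1) C" using assms by simp
  then obtain g where g: "\<And>j. homogeneous3 1 (g j)" "C = (\<Sum>j\<in>UNIV. var3 j * g j)"
    by (rule homogeneous3_decompose) auto
  have "\<exists>h. (\<forall>k. homogeneous3 0 (h k)) \<and> g j = (\<Sum>k\<in>UNIV. var3 k * h k)" for j
  proof -
    have "homogeneous3 (0 + 1) (g j)" using g(1)[of j] by simp
    thus ?thesis by (rule homogeneous3_decompose) auto
  qed
  then obtain h where h: "\<And>j k. homogeneous3 0 (h j k)" "\<And>j. g j = (\<Sum>k\<in>UNIV. var3 k * h j k)" by metis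
  have "C = (\<Sum>j\<in>UNIV. \<Sum>k\<in>UNIV. h j k * (var3 j * var3 k))"
    unfolding g(2) h(2) by (simp add: sum_distrib_left mult_ac)
  also have "\<dots> = (\<Sum>j\<in>UNIV. \<Sum>k\<in>UNIV. const3 (lk (h j k) 0) * (var3 j * var3 k))"
    by (intro sum.cong refl) (metis h(1) homogeneous3_degree_0)
  finally show ?thesis by (rule that)
qed

text \<open>For a quadratic form this is the symmetric bilinear form C(x + y) - C(x) - C(y),
  extended to the target of \<open>c\<close>; it is applied to vectors over K, K[t] and
  K[z][e].\<close>

definition polar :: "('k::field \<Rightarrow> 'b::comm_ring_1) \<Rightarrow> 'k poly3 \<Rightarrow> (3 \<Rightarrow> 'b) \<Rightarrow> (3 \<Rightarrow> 'b) \<Rightarrow> 'b" where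
  "polar c C x y = (\<Sum>j\<in>UNIV. ev3 c x (partial3 j C) * y j)"

context coeff_hom begin

text \<open>Both sides are linear in C. With the coefficients carried along, the identity reduces to
  the monomials X_j X_k, whose polar form is x_j y_k + x_k y_j.\<close>

lemma polar_expand:
  assumes "homogeneous3 2 C"
  shows "ev3 c (\<lambda>j. a * x j + b * y j) C = a\<^sup>2 * ev3 c x C + a * b * polar c C x y + b\<^sup>2 * ev3 c y C"
proof -
  obtain e where C: "C = (\<Sum>j\<in>UNIV. \<Sum>k\<in>UNIV. const3 (e j k) * (var3 j * var3 k))"
    using quadratic_form[OF assms] .
  have "polar c C x y = (\<Sum>i\<in>UNIV. \<Sum>j\<in>UNIV. \<Sum>k\<in>UNIV. c (e j k) *
     (x j * ev3 c x (partial3 i (var3 k)) * y i + x k * ev3 c x (partial3 i (var3 j)) * y i))"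
    unfolding polar_def C by (simp add: sum_distrib_left sum_distrib_right algebra_simps sum.distrib)
  also have "\<dots> = (\<Sum>j\<in>UNIV. \<Sum>i\<in>UNIV. \<Sum>k\<in>UNIV. c (e j k) *
     (x j * ev3 c x (partial3 i (var3 k)) * y i + x k * ev3 c x (partial3 i (var3 j)) * y i))"
    by (rule sum.swap)
  also have "\<dots> = (\<Sum>j\<in>UNIV. \<Sum>k\<in>UNIV. \<Sum>i\<in>UNIV. c (e j k) *
     (x j * ev3 c x (partial3 i (var3 k)) * y i + x k * ev3 c x (partial3 i (var3 j)) * y i))"
    by (rule sum.cong[OF refl], rule sum.swap)
  also have "\<dots> = (\<Sum>j\<in>UNIV. \<Sum>k\<in>UNIV. c (e j k) * (x j * y k + x k * y j))"
  proof (intro sum.cong refl)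
    fix j k
    have "(\<Sum>i\<in>UNIV. c (e j k) * (x j * ev3 c x (partial3 i (var3 k)) * y i + x k * ev3 c x (partial3 i (var3 j)) * y i))
      = (\<Sum>i\<in>UNIV. (if i = k then c (e j k) * (x j * y k) else 0) + (if i = j then c (e j k) * (x k * y j) else 0))"
      by (intro sum.cong refl) (auto simp: partial3_var3 algebra_simps)
    also have "\<dots> = c (e j k) * (x j * y k + x k * y j)"
      by (simp add: sum.distrib distrib_left)
    finally show "(\<Sum>i\<in>UNIV. c (e j k) * (x j * ev3 c x (partial3 i (var3 k)) * y i + x k * ev3 c x (partial3 i (var3 j)) * y i))
      = c (e j k) * (x j * y k + x k * y j)" .
  qed
  finally have *: "polar c C x y = (\<Sum>j\<in>UNIV. \<Sum>k\<in>UNIV. c (e j k) * (x j * y k + x k * y j))" .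
  show ?thesis
    unfolding * by (subst (1 2 3) C) (simp add: sum_distrib_left sum.distrib power2_eq_square algebra_simps)
qed

lemma polar_add: "polar c C x (\<lambda>j. a * y j + b * z j) = a * polar c C x y + b * polar c C x z"
  by (simp add: polar_def sum_distrib_left sum.distrib algebra_simps)

lemma polar_self: "homogeneous3 2 C \<Longrightarrow> polar c C x x = 2 * ev3 c x C"
proof -
  assume "homogeneous3 2 C"
  hence "(\<Sum>j\<in>UNIV. var3 j * partial3 j C) = of_nat 2 * C" by (intro euler3) simp
  also have "\<dots> = C + C" by simp
  finally have "ev3 c x (\<Sum>j\<in>UNIV. var3 j * partial3 j C) = ev3 c x C + ev3 c x C"
    by (simp only: ev3_add)
  thus ?thesis by (simp add: polar_def mult.commute[of "x _"] mult.commute[of 2])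
qed

end

lemma poly_ev3: "poly (ev3 (\<lambda>x. [:x:]) q f) \<tau> = eval3 f (\<lambda>j. poly (q j) \<tau>)"
  unfolding eval3_eq_ev3 by (rule id.ev3_unique) simp_all

lemma ev3_const: "ev3 (\<lambda>x. [:x:]) (\<lambda>j. [:p j:]) f = [:eval3 f p:]"
  by (rule poly1.ev3_unique[symmetric]) simp_all

section \<open>The line through two points\<close>

text \<open>Up to sign, the determinant with rows X, \<open>p\<close>, \<open>q\<close> for vectors
  whose entry 0 is 1.\<close>

definition line_form :: "(3 \<Rightarrow> 'k::field) \<Rightarrow> (3 \<Rightarrow> 'k) \<Rightarrow> 'k poly3" where
  "line_form p q = const3 (q 2 - p 2) * (var3 1 - const3 (p 1) * var3 0) -
     const3 (q 1 - p 1) * (var3 2 - const3 (p 2) * var3 0)"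

lemma homogeneous3_line_form: "homogeneous3 1 (line_form p q)"
  unfolding line_form_def
  by (intro homogeneous3_diff homogeneous3_const3_mult homogeneous3_var3)

lemma eq_3: "p = (q :: 3 \<Rightarrow> 'a) \<longleftrightarrow> p 0 = q 0 \<and> p 1 = q 1 \<and> p 2 = q 2"
  by (simp add: fun_eq_iff forall_3)

text \<open>\<open>U\<close> and \<open>V\<close> are affine coordinates centred at
  \<open>p\<close>. With a dx + b dy = 1, the form a U + b V takes the value 0 at \<open>p\<close>
  and 1 at \<open>q\<close> and serves as the parameter, while \<open>L 2\<close> is the equation of
  the line.\<close>

lemma line_coords_exist:
  fixes p q :: "3 \<Rightarrow> 'k::field"
  assumes "p 0 = 1" "q 0 = 1" "p \<noteq> q"
  obtains L r where "line_coords L r (\<lambda>j. [:p j, q j - p j:])" "L 2 = line_form p q"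
proof -
  define dx dy where "dx = q 1 - p 1" and "dy = q 2 - p 2"
  have "dx \<noteq> 0 \<or> dy \<noteq> 0" using assms by (auto simp: eq_3 dx_def dy_def)
  then obtain a b where ab: "a * dx + b * dy = 1"
    by (metis add.left_neutral add.right_neutral mult_zero_left left_inverse)
  define U V :: "'k poly3" where "U = var3 1 - const3 (p 1) * var3 0" and "V = var3 2 - const3 (p 2) * var3 0"
  define L where "L j = (if j = 0 then var3 0 else if j = 1 then const3 a * U + const3 b * V
     else const3 dy * U - const3 dx * V)" for j :: 3
  define r where "r j = (if j = 0 then var3 0 else if j = 1 then const3 (p 1) * var3 0 + const3 dx * var3 1 + const3 b * var3 2
     else const3 (p 2) * var3 0 + const3 dy * var3 1 - const3 a * var3 2)" for j :: 3
  have c1: "const3 a * const3 dx + const3 b * const3 dy = 1"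
    using ab by (metis const3_1 const3_add const3_mult)
  have UV: "homogeneous3 1 U" "homogeneous3 1 V"
    unfolding U_def V_def by (intro homogeneous3_diff homogeneous3_const3_mult homogeneous3_var3)+
  have "line_coords L r (\<lambda>j. [:p j, q j - p j:])"
  proof
    show "homogeneous3 1 (L j)" for j
      by (simp add: L_def homogeneous3_add homogeneous3_diff homogeneous3_const3_mult homogeneous3_var3 UV)
    show "homogeneous3 1 (r j)" for j
      by (simp add: r_def homogeneous3_add homogeneous3_diff homogeneous3_const3_mult homogeneous3_var3)
    have "ev3 const3 L (r 1) = var3 1"
    proof -
      have "ev3 const3 L (r 1) = const3 (p 1) * var3 0 + (const3 a * const3 dx + const3 b * const3 dy) * U"
        by (simp add: r_def L_def algebra_simps)
      thus ?thesis by (simp add: c1 U_def)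
    qed
    moreover have "ev3 const3 L (r 2) = var3 2"
    proof -
      have "ev3 const3 L (r 2) = const3 (p 2) * var3 0 + (const3 a * const3 dx + const3 b * const3 dy) * V"
        by (simp add: r_def L_def algebra_simps)
      thus ?thesis by (simp add: c1 V_def)
    qed
    moreover have "ev3 const3 L (r 0) = var3 0" by (simp add: r_def L_def)
    ultimately have "\<forall>j. ev3 const3 L (r j) = var3 j" unfolding forall_3 by blast
    thus "ev3 const3 L (r j) = var3 j" for j ..
    have "\<forall>j. ev3 (\<lambda>x. [:x:]) (\<lambda>j. [:p j, q j - p j:]) (L j) = std_line j"
      unfolding forall_3 using ab
      by (simp add: L_def U_def V_def assms dx_def[symmetric] dy_def[symmetric] algebra_simps one_pCons)
    thus "ev3 (\<lambda>x. [:x:]) (\<lambda>j. [:p j, q j - p j:]) (L j) = std_line j" for j ..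
  qed
  moreover have "L 2 = line_form p q"
    by (simp add: L_def line_form_def U_def V_def dx_def dy_def)
  ultimately show ?thesis by (rule that)
qed

lemma eval3_line_form_eq_0:
  fixes p q x :: "3 \<Rightarrow> 'k::field"
  assumes "p 0 = 1" "q 0 = 1" "x 0 = 1" "p \<noteq> q" "eval3 (line_form p q) x = 0"
  obtains \<tau> where "x = (\<lambda>j. (1 - \<tau>) * p j + \<tau> * q j)"
proof -
  define dx dy where "dx = q 1 - p 1" and "dy = q 2 - p 2"
  have "dx \<noteq> 0 \<or> dy \<noteq> 0" using assms by (auto simp: eq_3 dx_def dy_def)
  moreover have e: "dy * (x 1 - p 1) = dx * (x 2 - p 2)"
    using assms by (simp add: line_form_def dx_def dy_def)
  ultimately have "\<exists>\<tau>. x 1 - p 1 = \<tau> * dx \<and> x 2 - p 2 = \<tau> * dy"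
  proof (elim disjE)
    assume "dx \<noteq> 0"
    thus ?thesis using e by (intro exI[of _ "(x 1 - p 1) / dx"]) (auto simp: field_simps)
  next
    assume "dy \<noteq> 0"
    thus ?thesis using e by (intro exI[of _ "(x 2 - p 2) / dy"]) (auto simp: field_simps)
  qed
  then obtain \<tau> where "x 1 = p 1 + \<tau> * dx" "x 2 = p 2 + \<tau> * dy" by (metis add_diff_cancel_left' diff_add_cancel add.commute)
  hence "x = (\<lambda>j. (1 - \<tau>) * p j + \<tau> * q j)"
    using assms by (simp add: eq_3 dx_def dy_def algebra_simps)
  thus ?thesis by (rule that)
qed

section \<open>Non-singular conics\<close>

locale conic =
  fixes C :: "'k::field_char_0 poly3"
  assumes conic: "nonsingular_conic C"
begin

abbreviation B where "B \<equiv> polar (\<lambda>x. x) C"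

lemma C_hom: "homogeneous3 2 C"
  using conic by (simp add: nonsingular_conic_def)

lemma gradient:
  assumes "p \<noteq> (\<lambda>_. 0)" "eval3 C p = 0"
  obtains j where "eval3 (partial3 j C) p \<noteq> 0"
proof -
  have "(\<lambda>j. to_ac (p j)) \<noteq> (\<lambda>_. 0)" using assms(1) by (auto simp: fun_eq_iff)
  moreover have "eval3 (Poly_Mapping.map to_ac C) (\<lambda>j. to_ac (p j)) = 0"
    using assms(2) by (simp add: eval3_map_to_ac)
  ultimately obtain j where "eval3 (Poly_Mapping.map to_ac (partial3 j C)) (\<lambda>j. to_ac (p j)) \<noteq> 0"
    using conic unfolding nonsingular_conic_def by blast
  thus ?thesis using that by (simp add: eval3_map_to_ac)
qed

lemma eval3_C_line: "eval3 C (\<lambda>j. a * x j + b * y j) = a\<^sup>2 * eval3 C x + a * b * B x y + b\<^sup>2 * eval3 C y"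
  unfolding eval3_eq_ev3 by (rule id.polar_expand[OF C_hom])

text \<open>The line is (1 - t) p + t q. As C vanishes at both points, only the mixed term of the
  polar expansion survives.\<close>

lemma line_expand:
  assumes "eval3 C p = 0" "eval3 C q = 0"
  shows "ev3 (\<lambda>x. [:x:]) (\<lambda>j. [:p j, q j - p j:]) C = [:B p q:] * ([:0, 1:] * [:1, - 1:])"
proof -
  have eq: "(\<lambda>j. [:p j, q j - p j:]) = (\<lambda>j. [:1, - 1:] * [:p j:] + [:0, 1:] * [:q j:])" by auto
  have "polar (\<lambda>x. [:x:]) C (\<lambda>j. [:p j:]) (\<lambda>j. [:q j:]) = [:B p q:]"
    unfolding polar_def by (simp add: ev3_const sum_UNIV_3 eval3_eq_ev3)
  thus ?thesis unfolding eq poly1.polar_expand[OF C_hom] ev3_const assms by (simp add: mult_ac)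
qed

text \<open>If the polar form vanished, the line through \<open>p\<close> and \<open>q\<close> would be a component of the conic, and it
  would meet the residual line in a singular point.\<close>

lemma polar_nonzero:
  assumes p: "p 0 = 1" "eval3 C p = 0" and q: "q 0 = 1" "eval3 C q = 0" and pq: "p \<noteq> q"
  shows "B p q \<noteq> 0"
proof
  assume B0: "B p q = 0"
  obtain L r where "line_coords L r (\<lambda>j. [:p j, q j - p j:])" and L2: "L 2 = line_form p q"
    using line_coords_exist[where p = p and q = q, OF p(1) q(1) pq] .
  then interpret line_coords L r "\<lambda>j. [:p j, q j - p j:]" by simp
  have "ev3 (\<lambda>x. [:x:]) (\<lambda>j. [:p j, q j - p j:]) C = 0"
    using line_expand[OF p(2) q(2)] B0 by simp
  then obtain M where M: "homogeneous3 1 M" "C = L 2 * M"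
    using vanish[of 2 C] C_hom by auto
  \<comment> \<open>A point a p + b q of the line at which the residual linear form M vanishes; if M
    is 0 at both points, every point of the line will do.\<close>
  obtain a b where ab: "a \<noteq> 0 \<or> b \<noteq> 0" "a * eval3 M p + b * eval3 M q = 0"
  proof (cases "eval3 M p = 0 \<and> eval3 M q = 0")
    case True thus ?thesis using that[of 1 0] by simp
  next
    case False thus ?thesis using that[of "eval3 M q" "- eval3 M p"] by auto
  qed
  define x where "x = (\<lambda>j. a * p j + b * q j)"
  have "x \<noteq> (\<lambda>_. 0)"
  proof
    assume x: "x = (\<lambda>_. 0)"
    have x0: "a * p j + b * q j = 0" for j using fun_cong[OF x, of j] by (simp add: x_def)
    have b: "b = - a" using x0[of 0] p(1) q(1) by (simp add: eq_neg_iff_add_eq_0 add.commute)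
    have "p j = q j" for j using x0[of j] ab(1) unfolding b by auto
    thus False using pq by auto
  qed
  moreover have "eval3 M x = 0"
    unfolding x_def eval3_eq_ev3 id.ev3_linear[OF M(1)] using ab(2) by (simp only: eval3_eq_ev3)
  moreover have "eval3 (L 2) p = 0" "eval3 (L 2) q = 0"
    unfolding L2 line_form_def using p(1) q(1) by simp_all
  hence "eval3 (L 2) x = 0"
    unfolding x_def eval3_eq_ev3 id.ev3_linear[OF L_hom] by simp
  ultimately have "x \<noteq> (\<lambda>_. 0)" "eval3 C x = 0" "eval3 (partial3 j C) x = 0" for j
    by (simp_all add: M(2))
  thus False using gradient[of x] by blast
qed

lemma polar_self: "eval3 C p = 0 \<Longrightarrow> B p p = 0"
  using id.polar_self[OF C_hom, of p] by (simp add: eval3_eq_ev3)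

text \<open>On the line through \<open>p\<close> and \<open>q\<close> the conic is given by B(p, q)
  \<tau> (1 - \<tau>) with nonzero B(p, q), so the line meets it only in \<open>p\<close> and
  \<open>q\<close>.\<close>

lemma not_collinear:
  assumes p: "p 0 = 1" "eval3 C p = 0" and q: "q 0 = 1" "eval3 C q = 0"
    and x: "x 0 = 1" "eval3 C x = 0" and ne: "p \<noteq> q" "x \<noteq> p" "x \<noteq> q"
  shows "eval3 (line_form p q) x \<noteq> 0"
proof
  assume "eval3 (line_form p q) x = 0"
  then obtain \<tau> where \<tau>: "x = (\<lambda>j. (1 - \<tau>) * p j + \<tau> * q j)"
    using eval3_line_form_eq_0[where p = p and q = q and x = x, OF p(1) q(1) x(1) ne(1)] by blast
  have "(1 - \<tau>) * \<tau> * B p q = 0"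
    using x(2) unfolding \<tau> eval3_C_line p q by simp
  hence "\<tau> = 0 \<or> \<tau> = 1" using polar_nonzero[where p = p and q = q, OF p q ne(1)] by auto
  thus False using ne \<tau> by auto
qed

text \<open>The coefficient at e is g_1 + g_2 z, where g is the gradient at \<open>p\<close>. If it
  vanished, Euler's relation would force g_0 = 0 as well and \<open>p\<close> would be singular.
  Hence dividing a form by C lowers its multiplicity at \<open>p\<close> by no more than
  one.\<close>

lemma taylor_order:
  assumes p: "p 0 = 1" "eval3 C p = 0"
  shows "\<not> [:0, 1:]\<^sup>2 dvd taylor p C"
proof
  assume "[:0, 1:]\<^sup>2 dvd taylor p C"
  hence z: "coeff (taylor p C) 1 = 0" unfolding X_power_dvd_iff by simp
  let ?g = "\<lambda>j. eval3 (partial3 j C) p"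
  define y :: "3 \<Rightarrow> 'k poly poly" where "y j = (if j = 0 then 0 else if j = 1 then 1 else [:[:0, 1:]:])" for j
  have c: "ev3 (\<lambda>x. [:[:x:]:]) (\<lambda>j. [:[:p j:]:]) f = [:[:eval3 f p:]:]" for f :: "'k poly3"
    by (rule poly2.ev3_unique[symmetric]) simp_all
  have "\<forall>j. generic_line p j = 1 * [:[:p j:]:] + [:0, 1:] * y j"
    unfolding forall_3 by (simp add: y_def one_pCons)
  hence eq: "generic_line p = (\<lambda>j. 1 * [:[:p j:]:] + [:0, 1:] * y j)" by auto
  have "taylor p C = [:0, 1:] * polar (\<lambda>x. [:[:x:]:]) C (\<lambda>j. [:[:p j:]:]) y + [:0, 1:]\<^sup>2 * ev3 (\<lambda>x. [:[:x:]:]) y C"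
    unfolding taylor_def eq poly2.polar_expand[OF C_hom] c p(2) by simp
  hence "coeff (taylor p C) 1 = coeff (polar (\<lambda>x. [:[:x:]:]) C (\<lambda>j. [:[:p j:]:]) y) 0"
    by (simp add: power2_eq_square)
  also have "\<dots> = [:?g 1, ?g 2:]"
    by (simp add: polar_def c sum_UNIV_3 y_def)
  finally have "?g 1 = 0" "?g 2 = 0" using z by auto
  moreover have "?g 0 = 0"
    using polar_self[OF p(2)] calculation p(1) by (simp add: polar_def sum_UNIV_3 eval3_eq_ev3)
  ultimately have "\<forall>j. ?g j = 0" unfolding forall_3 by simp
  moreover have "p \<noteq> (\<lambda>_. 0)" using p(1) by auto
  ultimately show False using gradient p(2) by blast
qed

text \<open>Stereographic projection from \<open>P 1\<close>: the line through \<open>P 1\<close> in direction \<open>d\<close> meets the conic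
  again in \<open>C(d) P 1 - B(P 1, d) d\<close>. The directions are \<open>d = (0, t, 1 + l t)\<close>, with \<open>l\<close> generic so that no
  point of the set lies at \<open>t = \<infinity>\<close>.\<close>

lemma parametrization:
  fixes P :: "nat \<Rightarrow> 3 \<Rightarrow> 'k" and s :: nat
  assumes s: "s \<ge> 2"
    and P1: "\<And>j. j \<in> {1..s} \<Longrightarrow> P j 0 = 1" and PC: "\<And>j. j \<in> {1..s} \<Longrightarrow> eval3 C (P j) = 0"
    and inj: "inj_on P {1..s}"
  obtains q :: "3 \<Rightarrow> 'k poly" and \<tau> \<kappa> :: "nat \<Rightarrow> 'k" where
    "\<And>i. degree (q i) \<le> 2" "ev3 (\<lambda>x. [:x:]) q C = 0" "inj_on \<tau> {1..s}"
    "\<And>i j. j \<in> {1..s} \<Longrightarrow> poly (q i) (\<tau> j) = \<kappa> j * P j i"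
    "\<And>j. j \<in> {2..s} \<Longrightarrow> \<kappa> j \<noteq> 0"
proof -
  define p where "p = P 1"
  have p: "p 0 = 1" "eval3 C p = 0" using s P1 PC by (auto simp: p_def)
  have ne: "P j \<noteq> p" if "j \<in> {2..s}" for j
    using inj_onD[OF inj, of j 1] that by (auto simp: p_def)
  have BP: "B p (P j) \<noteq> 0" if "j \<in> {2..s}" for j
    using polar_nonzero[where p = p and q = "P j", OF p] P1[of j] PC[of j] ne[OF that] that by auto
  define g where "g i = eval3 (partial3 i C) p" for i
  have Bg: "B p y = g 0 * y 0 + g 1 * y 1 + g 2 * y 2" for y
    by (simp add: polar_def sum_UNIV_3 g_def eval3_eq_ev3)
  have g12: "[:g 1, g 2:] \<noteq> 0"
  proof
    assume "[:g 1, g 2:] = 0"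
    hence "B p (P 2) = B p p" using p(1) P1[of 2] s unfolding Bg by auto
    thus False using BP[of 2] polar_self[OF p(2)] s by auto
  qed
  define dx dy where "dx j = P j 1 - p 1" and "dy j = P j 2 - p 2" for j
  \<comment> \<open>The roots of F are the forbidden values of l: the first factor keeps the tangent
    direction at \<open>p\<close> at finite t, the others do the same for the directions from
    \<open>p\<close> to the remaining points.\<close>
  define F where "F = [:g 1, g 2:] * (\<Prod>j\<in>{2..s}. [:dy j, - dx j:])"
  have "[:dy j, - dx j:] \<noteq> 0" if "j \<in> {2..s}" for j
  proof
    assume "[:dy j, - dx j:] = 0"
    hence "P j = p" using P1[of j] p(1) that by (simp add: eq_3 dx_def dy_def)
    thus False using ne[OF that] by simp
  qed
  hence "(\<Prod>j\<in>{2..s}. [:dy j, - dx j:]) \<noteq> 0" by (subst prod_zero_iff) auto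
  hence "F \<noteq> 0" unfolding F_def by (rule no_zero_divisors[OF g12])
  hence "finite {x. poly F x = 0}" by (rule poly_roots_finite)
  then obtain l where l: "poly F l \<noteq> 0"
    using infinite_UNIV_char_0[where ?'a = 'k] by (metis (mono_tags, lifting) UNIV_eq_I mem_Collect_eq)
  have l1: "poly [:g 1, g 2:] l \<noteq> 0" and l2: "\<And>j. j \<in> {2..s} \<Longrightarrow> poly [:dy j, - dx j:] l \<noteq> 0"
    using l unfolding F_def poly_mult poly_prod by (auto simp: prod_zero_iff)
  define e where "e = g 1 + l * g 2"
  have e: "e \<noteq> 0" using l1 by (simp add: e_def)
  define y where "y j = dy j - l * dx j" for j
  have y: "y j \<noteq> 0" if "j \<in> {2..s}" for j
    using l2[OF that] by (simp add: y_def)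
  define D :: "3 \<Rightarrow> 'k poly" where "D i = (if i = 0 then 0 else if i = 1 then [:0, 1:] else [:1, l:])" for i
  define d :: "'k \<Rightarrow> 3 \<Rightarrow> 'k" where "d t = (\<lambda>i. poly (D i) t)" for t
  have d: "d t 0 = 0" "d t 1 = t" "d t 2 = 1 + l * t" for t
    by (simp_all add: d_def D_def mult.commute)
  define Cd where "Cd = ev3 (\<lambda>x. [:x:]) D C"
  define Bd where "Bd = polar (\<lambda>x. [:x:]) C (\<lambda>i. [:p i:]) D"
  define q where "q i = Cd * [:p i:] + (- Bd) * D i" for i
  have D1: "degree (D i) \<le> 1" for i by (simp add: D_def)
  have Cd2: "degree Cd \<le> 2" using degree_ev3_le[of 2 C D 1] C_hom D1 by (simp add: Cd_def)
  have Bd_eq: "Bd = [:g 1:] * D 1 + [:g 2:] * D 2"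
    by (simp add: Bd_def polar_def sum_UNIV_3 ev3_const g_def D_def)
  have Bd1: "degree Bd \<le> 1" by (simp add: Bd_eq D_def)
  have poly_Bd: "poly Bd t = B p (d t)" for t
    by (simp add: Bd_eq Bg d) (simp add: D_def mult.commute)
  have poly_Cd: "poly Cd t = eval3 C (d t)" for t
    unfolding Cd_def d_def by (rule poly_ev3)
  have q2: "degree (q i) \<le> 2" for i
  proof -
    have "degree (Cd * [:p i:]) \<le> 2" using degree_mult_le[of Cd "[:p i:]"] Cd2 by simp
    moreover have "degree (- Bd * D i) \<le> 2" using degree_mult_le[of "- Bd" "D i"] Bd1 D1[of i] by simp
    ultimately show ?thesis unfolding q_def by (rule degree_add_le)
  qed
  have qC: "ev3 (\<lambda>x. [:x:]) q C = 0"
  proof -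
    have "ev3 (\<lambda>x. [:x:]) q C = Cd\<^sup>2 * ev3 (\<lambda>x. [:x:]) (\<lambda>i. [:p i:]) C + Cd * (- Bd) * Bd + (- Bd)\<^sup>2 * Cd"
      using poly1.polar_expand[OF C_hom, of Cd "\<lambda>i. [:p i:]" "- Bd" D]
      by (simp only: Bd_def[symmetric] Cd_def[symmetric] q_def[symmetric])
    also have "ev3 (\<lambda>x. [:x:]) (\<lambda>i. [:p i:]) C = 0"
      using p(2) by (simp add: ev3_const)
    finally show ?thesis by (simp add: power2_eq_square algebra_simps)
  qed
  \<comment> \<open>The tangent direction, where B(p, d) = 0, leads back to P 1 itself; the
    direction from \<open>p\<close> to P j is proportional to d at t = dx j / y j.\<close>
  define \<tau> where "\<tau> j = (if j = 1 then - g 2 / e else dx j / y j)" for j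
  define \<kappa> where "\<kappa> j = eval3 C (d (\<tau> j))" for j
  have Pj: "P j = (\<lambda>i. 1 * p i + y j * d (\<tau> j) i)" if j: "j \<in> {2..s}" for j
  proof -
    have t: "y j * \<tau> j = dx j" using y[OF j] j by (simp add: \<tau>_def)
    have P1j: "P j 1 = p 1 + y j * \<tau> j" unfolding t by (simp add: dx_def)
    have "y j * (1 + l * \<tau> j) = y j + l * (y j * \<tau> j)" by (simp add: algebra_simps)
    hence "y j * (1 + l * \<tau> j) = dy j" unfolding t by (simp only: y_def diff_add_cancel)
    moreover have "P j 2 = p 2 + dy j" by (simp add: dy_def)
    ultimately have "P j 2 = p 2 + y j * (1 + l * \<tau> j)" by (simp only:)
    moreover have "P j 0 = p 0 + y j * 0" using P1[of j] p(1) j by simp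
    ultimately show ?thesis unfolding eq_3 d using P1j by simp
  qed
  have Bdj: "B p (P j) = y j * B p (d (\<tau> j))" if j: "j \<in> {2..s}" for j
    by (subst Pj[OF j], subst id.polar_add) (simp add: polar_self[OF p(2)])
  \<comment> \<open>P j = p + y d lies on the conic, so B(p, d) + y C(d) = 0. Therefore the
    parametrization takes the value C(d) P j there, which is the reason for the choice of
    \<open>\<kappa>\<close>.\<close>
  have Cdj: "B p (d (\<tau> j)) = - y j * \<kappa> j" if j: "j \<in> {2..s}" for j
  proof -
    have "0 = eval3 C (P j)" using PC[of j] j by simp
    also have "\<dots> = y j * (B p (d (\<tau> j)) + y j * \<kappa> j)"
      by (subst Pj[OF j], subst eval3_C_line) (simp add: p(2) \<kappa>_def power2_eq_square algebra_simps)
    finally show ?thesis using y[OF j] by (simp add: eq_neg_iff_add_eq_0)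
  qed
  have \<kappa>: "\<kappa> j \<noteq> 0" if j: "j \<in> {2..s}" for j
    using BP[OF j] Bdj[OF j] Cdj[OF j] by auto
  have B1: "B p (d (\<tau> 1)) = 0"
    using e by (simp add: Bg d \<tau>_def field_simps) (simp add: e_def algebra_simps)
  have "poly (q i) (\<tau> j) = \<kappa> j * P j i" if j: "j \<in> {1..s}" for i j
  proof (cases "j = 1")
    case True
    have "poly (q i) (\<tau> 1) = \<kappa> 1 * p i"
      by (simp add: q_def poly_Cd poly_Bd B1[unfolded One_nat_def] \<kappa>_def)
    thus ?thesis using True p_def by metis
  next
    case False
    hence j2: "j \<in> {2..s}" using j by auto
    have "poly (q i) (\<tau> j) = \<kappa> j * p i + y j * \<kappa> j * d (\<tau> j) i"
      using Cdj[OF j2] fun_cong[OF d_def[of "\<tau> j"], of i]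
      by (simp add: q_def poly_Cd poly_Bd \<kappa>_def)
    also have "\<dots> = \<kappa> j * P j i"
      by (subst Pj[OF j2]) (simp add: algebra_simps)
    finally show ?thesis .
  qed
  moreover have "inj_on \<tau> {1..s}"
  proof (rule inj_onI)
    fix j k assume j: "j \<in> {1..s}" and k: "k \<in> {1..s}" and eq: "\<tau> j = \<tau> k"
    show "j = k"
    proof (cases "j = 1 \<or> k = 1")
      case True
      have one: "i = 1" if i: "i \<in> {1..s}" "\<tau> i = \<tau> 1" for i
      proof (rule ccontr)
        assume "i \<noteq> 1"
        hence "i \<in> {2..s}" using i(1) by auto
        hence "B p (d (\<tau> i)) \<noteq> 0" using BP[of i] Bdj[of i] by auto
        thus False using B1 i(2) by simp
      qed
      show ?thesis using True one[OF j] one[OF k] eq by auto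
    next
      case False
      hence j2: "j \<in> {2..s}" and k2: "k \<in> {2..s}" using j k by auto
      have "\<kappa> j = \<kappa> k" using eq by (simp add: \<kappa>_def)
      hence "y j = y k" using Cdj[OF j2] Cdj[OF k2] \<kappa>[OF k2] eq by auto
      hence "P j = P k" using Pj[OF j2] Pj[OF k2] eq by simp
      thus ?thesis using inj_onD[OF inj _ j k] by simp
    qed
  qed
  ultimately show ?thesis using that q2 qC \<kappa> by blast
qed

text \<open>Induction on the degree: subtracting a multiple of \<open>C\<close> makes \<open>f\<close> vanish on the line through the
  points \<open>a\<close> and \<open>b\<close>, and the equation of this line can then be divided out. The third point \<open>x\<close>
  witnesses that the line does not contain the conic.\<close>

lemma conic_dvd:
  fixes q :: "3 \<Rightarrow> 'k poly" and a b x :: "3 \<Rightarrow> 'k"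
  assumes qC: "ev3 (\<lambda>x. [:x:]) q C = 0"
    and a: "a 0 = 1" "eval3 C a = 0" and b: "b 0 = 1" "eval3 C b = 0" and x: "x 0 = 1" "eval3 C x = 0"
    and ne: "a \<noteq> b" "x \<noteq> a" "x \<noteq> b"
    and qa: "\<And>i. poly (q i) \<tau>a = \<kappa>a * a i" "\<kappa>a \<noteq> 0"
    and qb: "\<And>i. poly (q i) \<tau>b = \<kappa>b * b i" "\<kappa>b \<noteq> 0"
    and qx: "\<And>i. poly (q i) \<tau>x = \<kappa>x * x i" "\<kappa>x \<noteq> 0"
    and f: "homogeneous3 (int n) f" "ev3 (\<lambda>x. [:x:]) q f = 0"
  shows "\<exists>g. homogeneous3 (int n - 2) g \<and> f = C * g"
proof -
  let ?l = "\<lambda>j. [:a j, b j - a j:]"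
  obtain L r where "line_coords L r ?l" and L2: "L 2 = line_form a b"
    using line_coords_exist[where p = a and q = b, OF a(1) b(1) ne(1)] .
  then interpret line_coords L r ?l by simp
  have zero: "eval3 f y = 0" if "homogeneous3 (int n) f" "ev3 (\<lambda>x. [:x:]) q f = 0"
    "\<And>i. poly (q i) \<tau> = \<kappa> * y i" "\<kappa> \<noteq> 0" for f y \<tau> \<kappa> n
  proof -
    have "0 = eval3 f (\<lambda>i. \<kappa> * y i)" using poly_ev3[of q f \<tau>] that by simp
    also have "\<dots> = \<kappa> ^ n * eval3 f y" unfolding eval3_eq_ev3 by (rule id.ev3_scale[OF that(1)])
    finally show ?thesis using that(4) by simp
  qed
  have "ev3 (\<lambda>x. [:x:]) q (L 2) \<noteq> 0"
    using zero[of 1 "L 2" \<tau>x \<kappa>x x] L_hom[of 2] qx not_collinear[where p = a and q = b and x = x, OF a b x ne] unfolding L2 by auto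
  note Lq = this
  have "\<exists>g. f = C * g" using f
  proof (induction n arbitrary: f)
    case 0
    then obtain c where "f = const3 c" using homogeneous3_degree_0[of f] by auto
    hence "f = 0" using 0(2) by simp
    thus ?case by (intro exI[of _ 0]) simp
  next
    case (Suc n)
    let ?F = "ev3 (\<lambda>x. [:x:]) ?l f"
    have deg: "degree ?F \<le> Suc n" by (rule q_deg[OF Suc.prems(1)])
    have "poly ?F 0 = 0" "poly ?F 1 = 0"
      using zero[OF Suc.prems qa] zero[OF Suc.prems qb] by (simp_all add: poly_ev3)
    then obtain G where G: "?F = [:0, 1:] * [:1, - 1:] * G"
    proof -
      from \<open>poly ?F 0 = 0\<close> obtain H where H: "?F = [:0, 1:] * H" by (auto simp: poly_eq_0_iff_dvd elim: dvdE)
      hence "poly H 1 = 0" using \<open>poly ?F 1 = 0\<close> by simp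
      then obtain H' where "H = [:- 1, 1:] * H'" by (auto simp: poly_eq_0_iff_dvd elim: dvdE)
      hence "?F = [:0, 1:] * [:1, - 1:] * (- H')" using H by simp
      thus ?thesis using that by blast
    qed
    have "\<exists>h. ev3 (\<lambda>x. [:x:]) ?l (f - C * h) = 0 \<and> homogeneous3 (int (Suc n)) (f - C * h)"
    proof (cases "G = 0")
      case True
      thus ?thesis using G Suc.prems by (intro exI[of _ 0]) simp
    next
      case False
      have "degree ?F = 2 + degree G" unfolding G using False by (subst degree_mult_eq) auto
      hence n: "n \<ge> 1" "degree G \<le> n - 1" using deg by auto
      \<comment> \<open>C restricts to B(a, b) t (1 - t), so C h agrees with f on the line as soon
        as h restricts to G / B(a, b). The degree bound on G provides such a form h of degree n -
        1.\<close>
      have "degree (smult (1 / B a b) G) \<le> n - 1" using n(2) by simp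
      then obtain h where h: "homogeneous3 (int (n - 1)) h" "ev3 (\<lambda>x. [:x:]) ?l h = smult (1 / B a b) G"
        by (rule surj)
      have "ev3 (\<lambda>x. [:x:]) ?l (f - C * h) = 0"
        using polar_nonzero[where p = a and q = b, OF a b ne(1)]
        by (simp add: line_expand[OF a(2) b(2)] h(2) G smult_add_right)
      moreover have "2 + int (n - 1) = int (Suc n)" using n(1) by simp
      hence "homogeneous3 (int (Suc n)) (C * h)"
        using homogeneous3_mult[OF C_hom h(1)] by (simp only:)
      hence "homogeneous3 (int (Suc n)) (f - C * h)" by (rule homogeneous3_diff[OF Suc.prems(1)])
      ultimately show ?thesis by (intro exI[of _ h] conjI)
    qed
    then obtain h where h: "ev3 (\<lambda>x. [:x:]) ?l (f - C * h) = 0" "homogeneous3 (int (Suc n)) (f - C * h)" by blast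
    obtain g where g: "homogeneous3 (int (Suc n) - 1) g" "f - C * h = L 2 * g"
      using vanish[OF h(2,1)] .
    have "ev3 (\<lambda>x. [:x:]) q (L 2) * ev3 (\<lambda>x. [:x:]) q g = ev3 (\<lambda>x. [:x:]) q (f - C * h)"
      by (simp add: g(2))
    also have "\<dots> = 0" using Suc.prems qC by simp
    finally have "ev3 (\<lambda>x. [:x:]) q g = 0" using Lq by simp
    then obtain g' where "g = C * g'" using Suc.IH[of g] g(1) by auto
    hence "f = C * (h + L 2 * g')" using g(2) by (simp add: algebra_simps)
    thus ?case by blast
  qed
  then obtain g where "f = C * g" by blast
  from homogeneous3_cofactor[OF f(1) C_hom this] show ?thesis by blast
qed

end

section \<open>Multiplicities of roots\<close>

text \<open>Orders at \<open>a\<close> add over an integral domain, so a nonzero factor of order at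
  most \<open>k\<close> leaves order at least m - k to the other one. It is used both in K[t] and,
  for Taylor expansions, in K[z][e].\<close>

lemma power_dvd_cancel:
  fixes F G :: "'a::idom poly"
  assumes "[:- a, 1:] ^ m dvd F * G" "\<not> [:- a, 1:] ^ Suc k dvd F"
  shows "[:- a, 1:] ^ (m - k) dvd G"
proof (cases "G = 0")
  case False
  have F: "F \<noteq> 0" using assms(2) by auto
  have "m \<le> order a (F * G)" using assms(1) F False by (auto simp: order_divides)
  also have "\<dots> = order a F + order a G" using F False by (intro order_mult) auto
  finally have "m \<le> order a F + order a G" .
  moreover have "\<not> Suc k \<le> order a F" using assms(2) F unfolding order_divides by simp
  ultimately have "m - k \<le> order a G" by simp
  thus ?thesis by (simp add: order_divides)
qed simp

lemma prod_root_powers_dvd: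
  fixes p :: "'k::field poly"
  assumes "finite J" "inj_on \<tau> J" "\<And>j. j \<in> J \<Longrightarrow> [:- \<tau> j, 1:] ^ m j dvd p"
  shows "(\<Prod>j\<in>J. [:- \<tau> j, 1:] ^ m j) dvd p"
  using assms
proof (induction J arbitrary: p rule: finite_induct)
  case (insert i J)
  from insert.prems(2)[of i] obtain p' where p': "p = [:- \<tau> i, 1:] ^ m i * p'" by (auto elim: dvdE)
  have "(\<Prod>j\<in>J. [:- \<tau> j, 1:] ^ m j) dvd p'"
  proof (rule insert.IH)
    show "inj_on \<tau> J" using insert.prems(1) by auto
    fix j assume j: "j \<in> J"
    have "\<tau> j \<noteq> \<tau> i" using insert.prems(1) insert.hyps(2) j by (auto simp: inj_on_def)
    hence "\<not> [:- \<tau> j, 1:] ^ Suc 0 dvd [:- \<tau> i, 1:] ^ m i"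
      by (simp add: poly_eq_0_iff_dvd[symmetric])
    from power_dvd_cancel[OF _ this, of "m j" p'] show "[:- \<tau> j, 1:] ^ m j dvd p'"
      using insert.prems(2)[of j] j unfolding p' by simp
  qed
  thus ?case unfolding p' using insert.hyps by (simp add: mult_dvd_mono)
qed simp

lemma degree_prod_root_powers:
  "finite J \<Longrightarrow> degree (\<Prod>j\<in>J. [:- \<tau> j, 1:] ^ m j :: 'k::field poly) = (\<Sum>j\<in>J. m j)"
  by (induction J rule: finite_induct) (auto simp: degree_mult_eq degree_power_eq)

section \<open>Forms with prescribed multiplicities at points of the conic: Bezout arguments and
  independence of conditions\<close>

section \<open>Spaces of forms with prescribed multiplicities\<close>

lemma sum_choose_Suc: "(\<Sum>b<m. Suc b) = (m + 1) choose 2"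
  by (induction m) (auto simp: numeral_2_eq_2)

lemma Suc_choose_2: "Suc k choose 2 = k + (k choose 2)"
  by (simp add: numeral_2_eq_2)

text \<open>Lowering a multiplicity k by one removes k conditions. Subtraction is truncated, and k =
  0 is covered as well.\<close>

lemma deg_Suc_choose: "(k + 1) choose 2 = ((k - 1 + 1) choose 2) + k"
proof (cases "k = 0")
  case False
  hence "k - 1 + 1 = k" by simp
  thus ?thesis using Suc_choose_2[of k] by (simp only: add.commute Suc_eq_plus1)
qed (simp add: numeral_2_eq_2)

text \<open>The slope z enters only through the product e z. Consequently vanishing at order b
  amounts to at most b + 1 scalar conditions.\<close>

lemma degree_coeff_taylor: "degree (coeff (taylor p f) b) \<le> b"
proof (induction f arbitrary: b rule: poly3_induct)
  case (const c) thus ?case by (cases b) auto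
next
  case (var j)
  have "\<forall>j. degree (coeff (generic_line p j) b) \<le> b"
    unfolding forall_3 by (cases b; cases "b - 1") (auto simp: coeff_pCons split: nat.splits)
  thus ?case by simp
next
  case (add f g)
  thus ?case by (simp add: degree_add_le)
next
  case (mult f g)
  show ?case
    unfolding taylor_simps coeff_mult
  proof (rule degree_sum_le)
    fix i assume "i \<in> {..b}"
    thus "degree (coeff (taylor p f) i * coeff (taylor p g) (b - i)) \<le> b"
      using degree_mult_le[of "coeff (taylor p f) i" "coeff (taylor p g) (b - i)"] mult[of i] mult[of "b - i"]
      by (smt (verit) add_le_mono atMost_iff le_add_diff_inverse order_trans mult)
  qed simp
qed

text \<open>Each functional lowers the dimension by at most one. Its values are wrapped as constant
  polynomials so that K[t] can serve as the codomain in rank-nullity.\<close>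

lemma dim_functionals:
  fixes l :: "'t \<Rightarrow> 'k::field poly3 \<Rightarrow> 'k"
  assumes "finite T" "fin_subspace scale3 U"
    "\<And>t. t \<in> T \<Longrightarrow> Vector_Spaces.linear scale3 smult (\<lambda>f. [:l t f:])"
  shows "v3.dim U \<le> v3.dim {f\<in>U. \<forall>t\<in>T. l t f = 0} + card T"
  using assms
proof (induction T arbitrary: U rule: finite_induct)
  case (insert t T)
  let ?V = "{f\<in>U. [:l t f:] = 0}"
  interpret Vector_Spaces.linear scale3 smult "\<lambda>f. [:l t f:]" by (rule insert.prems(2)) simp
  have "v3.subspace ?V"
    using v3.subspace_inter[OF v3.fin_subspace_subspace[OF insert.prems(1)] subspace_kernel]
    by (simp add: Int_def)
  hence V: "fin_subspace scale3 ?V" by (rule v3.fin_subspace_subset[OF insert.prems(1)]) auto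
  have "(\<lambda>f. [:l t f:]) ` U \<subseteq> vp.span {1}"
  proof
    fix x assume "x \<in> (\<lambda>f. [:l t f:]) ` U"
    then obtain f where "x = smult (l t f) 1" by (auto simp: one_pCons)
    thus "x \<in> vp.span {1}" using vp.span_scale[OF vp.span_base] by blast
  qed
  hence "vp.dim ((\<lambda>f. [:l t f:]) ` U) \<le> card {1 :: 'k poly}" by (rule vp.dim_le_card) simp
  hence "v3.dim U \<le> 1 + v3.dim ?V"
    using v3p.dim_kernel_image[OF insert.prems(2)[OF insertI1] insert.prems(1)] by simp
  also have "v3.dim ?V \<le> v3.dim {f\<in>?V. \<forall>t\<in>T. l t f = 0} + card T"
    using insert.prems(2) by (intro insert.IH V) auto
  also have "{f\<in>?V. \<forall>t\<in>T. l t f = 0} = {f\<in>U. \<forall>t\<in>insert t T. l t f = 0}" by auto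
  finally show ?case using insert.hyps by simp
qed simp

locale points_on_conic = conic C for C :: "'k::field_char_0 poly3" +
  fixes s :: nat and P :: "nat \<Rightarrow> 3 \<Rightarrow> 'k"
  assumes s4: "s \<ge> 4" and P0: "\<And>j. j \<in> {1..s} \<Longrightarrow> P j 0 = 1"
    and PC: "\<And>j. j \<in> {1..s} \<Longrightarrow> eval3 C (P j) = 0" and P_inj: "inj_on P {1..s}"
begin

definition fat :: "(nat \<Rightarrow> nat) \<Rightarrow> int \<Rightarrow> 'k poly3 set" where
  "fat m i = forms i \<inter> fat_ideal s m P"

definition fdim :: "(nat \<Rightarrow> nat) \<Rightarrow> int \<Rightarrow> nat" where
  "fdim m i = v3.dim (fat m i)"

text \<open>The length of the fat point scheme, which is the eventual value of its Hilbert
  function.\<close>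

definition deg :: "(nat \<Rightarrow> nat) \<Rightarrow> nat" where
  "deg m = (\<Sum>j=1..s. (m j + 1) choose 2)"

lemma subspace_fat: "v3.subspace (fat m i)"
  unfolding fat_def by (intro v3.subspace_inter subspace_forms subspace_ideal ideal_fat_ideal)

lemma fin_fat: "fin_subspace scale3 (fat m i)"
  by (rule fin_subspace_forms_subset[OF subspace_fat]) (auto simp: fat_def)

lemma fatD: "f \<in> fat m i \<Longrightarrow> j \<in> {1..s} \<Longrightarrow> f \<in> point_power (P j) (m j)"
  unfolding fat_def fat_ideal_eq by blast

lemma fatI: "homogeneous3 i f \<Longrightarrow> (\<And>j. j \<in> {1..s} \<Longrightarrow> f \<in> point_power (P j) (m j)) \<Longrightarrow> f \<in> fat m i"
  unfolding fat_def fat_ideal_eq by simp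

lemma fat_iff: "f \<in> fat m (int n) \<longleftrightarrow>
  homogeneous3 (int n) f \<and> (\<forall>j\<in>{1..s}. [:0, 1:] ^ m j dvd taylor (P j) f)"
proof -
  have "f \<in> point_power (P j) (m j) \<longleftrightarrow> [:0, 1:] ^ m j dvd taylor (P j) f"
    if "homogeneous3 (int n) f" "j \<in> {1..s}" for j
    by (rule point_power_iff[where p = "P j" and n = n, OF P0[OF that(2)] that(1)])
  thus ?thesis by (auto simp: fat_def fat_ideal_eq)
qed

lemma P_neq: "a \<in> {1..s} \<Longrightarrow> b \<in> {1..s} \<Longrightarrow> a \<noteq> b \<Longrightarrow> P a \<noteq> P b"
  using inj_onD[OF P_inj] by blast

abbreviation line :: "nat \<Rightarrow> nat \<Rightarrow> 'k poly3" where
  "line a b \<equiv> line_form (P a) (P b)"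

text \<open>No three points of the conic are collinear, so the line has order 0 at the other points.
  At its own two points the coefficient at e is a nonzero polynomial in the slope, which bounds the
  order by 1.\<close>

lemma line_order:
  assumes "a \<in> {1..s}" "b \<in> {1..s}" "a \<noteq> b" "j \<in> {1..s}"
  shows "\<not> [:0, 1:] ^ Suc (if j = a \<or> j = b then 1 else 0) dvd taylor (P j) (line a b)"
proof (cases "j = a \<or> j = b")
  case False
  have "eval3 (line a b) (P j) \<noteq> 0"
    using not_collinear[where p = "P a" and q = "P b" and x = "P j"] P0 PC P_neq assms False by auto
  hence "poly (taylor (P j) (line a b)) 0 \<noteq> 0" by (simp add: poly_taylor_0)
  thus ?thesis using False by (auto simp: poly_eq_0_iff_dvd)
next
  case True
  have "coeff (taylor (P j) (line a b)) 1 = [:P b 2 - P a 2, - (P b 1 - P a 1):]"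
    using P0[OF assms(4)] by (simp add: line_form_def)
  moreover have "[:P b 2 - P a 2, - (P b 1 - P a 1):] \<noteq> 0"
    using P_neq[OF assms(1-3)] P0[OF assms(1)] P0[OF assms(2)] by (auto simp: eq_3)
  ultimately show ?thesis using True unfolding X_power_dvd_iff by auto
qed

text \<open>Multiplicities of the residual scheme with respect to the line through P a and P b;
  multiplicity 0 stays 0.\<close>

definition drop2 :: "nat \<Rightarrow> nat \<Rightarrow> (nat \<Rightarrow> nat) \<Rightarrow> nat \<Rightarrow> nat" where
  "drop2 a b m j = m j - (if j = a \<or> j = b then 1 else 0)"

lemma line_residual:
  assumes ab: "a \<in> {1..s}" "b \<in> {1..s}" "a \<noteq> b"
    and f: "line a b * g \<in> fat m (int n)" and g: "homogeneous3 (int n - 1) g"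
  shows "g \<in> fat (drop2 a b m) (int n - 1)"
proof (cases "n = 0")
  case True
  hence "g = 0" using g homogeneous3_neg[of "int n - 1" g] by simp
  thus ?thesis using v3.subspace_0[OF subspace_fat] by simp
next
  case False
  hence n: "int n - 1 = int (n - 1)" by simp
  have "[:0, 1:] ^ drop2 a b m j dvd taylor (P j) g" if j: "j \<in> {1..s}" for j
    using power_dvd_cancel[of 0 "m j" "taylor (P j) (line a b)" "taylor (P j) g"]
      line_order[OF ab j] f j unfolding fat_iff drop2_def by simp
  thus ?thesis unfolding n fat_iff using g[unfolded n] by blast
qed

lemma line_vanishing: "a \<in> {1..s} \<Longrightarrow> b \<in> {1..s} \<Longrightarrow> line a b \<in> vanishing_ideal (P a) \<and> line a b \<in> vanishing_ideal (P b)"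
  by (intro conjI vanishing_idealI[OF homogeneous3_line_form]; simp add: line_form_def P0)

lemma curve_multiplicities:
  assumes "f \<in> fat m i" "J \<subseteq> {1..s}" "inj_on \<tau> J"
    "\<And>i j. j \<in> J \<Longrightarrow> poly (q i) (\<tau> j) = \<kappa> j * P j i"
  shows "(\<Prod>j\<in>J. [:- \<tau> j, 1:] ^ m j) dvd ev3 (\<lambda>x. [:x:]) q f"
proof (rule prod_root_powers_dvd[OF _ assms(3)])
  show "finite J" using assms(2) finite_subset by blast
  fix j assume j: "j \<in> J"
  hence "f \<in> point_power (P j) (m j)" using fatD[OF assms(1)] assms(2) by blast
  thus "[:- \<tau> j, 1:] ^ m j dvd ev3 (\<lambda>x. [:x:]) q f"
    by (rule point_power_order_curve) (use assms(4) j in auto)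
qed

lemma line_multiplicities:
  assumes ab: "a \<in> {1..s}" "b \<in> {1..s}" "a \<noteq> b" and f: "f \<in> fat m i"
  shows "[:0, 1:] ^ m a * [:- 1, 1:] ^ m b dvd ev3 (\<lambda>x. [:x:]) (\<lambda>j. [:P a j, P b j - P a j:]) f"
proof -
  let ?\<tau> = "\<lambda>j. if j = a then 0 else 1"
  have "(\<Prod>j\<in>{a, b}. [:- ?\<tau> j, 1:] ^ m j) dvd ev3 (\<lambda>x. [:x:]) (\<lambda>j. [:P a j, P b j - P a j:]) f"
    by (rule curve_multiplicities[OF f, where \<kappa> = "\<lambda>_. 1"]) (use ab in auto)
  thus ?thesis using ab(3) by (simp split: if_splits)
qed

text \<open>On the line the form has m a + m b > n zeros, so the line divides it. Multiplication by
  the equation then identifies the two spaces; positivity of m a and m b ensures that the product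
  regains the full multiplicities.\<close>

lemma line_case:
  assumes ab: "a \<in> {1..s}" "b \<in> {1..s}" "a \<noteq> b" and m: "m a \<ge> 1" "m b \<ge> 1" "n < m a + m b"
  shows "fdim m (int n) = fdim (drop2 a b m) (int n - 1)"
proof -
  let ?l = "\<lambda>j. [:P a j, P b j - P a j:]"
  obtain L r where "line_coords L r ?l" and L2: "L 2 = line a b"
    using line_coords_exist[where p = "P a" and q = "P b"] P0 ab P_neq[OF ab] by metis
  then interpret line_coords L r ?l by simp
  have "fat m (int n) = (*) (line a b) ` fat (drop2 a b m) (int n - 1)"
  proof
    show "fat m (int n) \<subseteq> (*) (line a b) ` fat (drop2 a b m) (int n - 1)"
    proof
      fix f assume f: "f \<in> fat m (int n)"
      hence hom: "homogeneous3 (int n) f" by (simp add: fat_def)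
      have "ev3 (\<lambda>x. [:x:]) ?l f = 0"
      proof (rule ccontr)
        assume "ev3 (\<lambda>x. [:x:]) ?l f \<noteq> 0"
        from dvd_imp_degree_le[OF line_multiplicities[OF ab f] this] have "m a + m b \<le> n"
          using q_deg[OF hom] by (simp add: degree_mult_eq degree_power_eq)
        thus False using m by simp
      qed
      from vanish[OF hom this] obtain g where "homogeneous3 (int n - 1) g" "f = line a b * g"
        unfolding L2 .
      thus "f \<in> (*) (line a b) ` fat (drop2 a b m) (int n - 1)"
        using line_residual[OF ab] f by auto
    qed
    show "(*) (line a b) ` fat (drop2 a b m) (int n - 1) \<subseteq> fat m (int n)"
    proof
      fix f assume "f \<in> (*) (line a b) ` fat (drop2 a b m) (int n - 1)"
      then obtain g where g: "g \<in> fat (drop2 a b m) (int n - 1)" "f = line a b * g" by auto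
      have "homogeneous3 (int n) f"
        using homogeneous3_mult[OF homogeneous3_line_form, of "int n - 1" g "P a" "P b"] g by (simp add: fat_def)
      moreover have "f \<in> point_power (P j) (m j)" if j: "j \<in> {1..s}" for j
      proof (cases "j = a \<or> j = b")
        case True
        have "g \<in> point_power (P j) (m j - 1)" using fatD[OF g(1) j] True by (simp add: drop2_def)
        hence "g * line a b \<in> point_power (P j) (Suc (m j - 1))"
          using line_vanishing[OF ab(1,2)] True by (intro point_power_SucI) auto
        moreover have "Suc (m j - 1) = m j" using True m by auto
        ultimately show ?thesis using g(2) by (simp add: mult.commute)
      next
        case False
        hence "g \<in> point_power (P j) (m j)" using fatD[OF g(1) j] False by (simp add: drop2_def)
        thus ?thesis unfolding g(2) by (rule ideal_poly3_mult[OF ideal_point_power])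
      qed
      ultimately show "f \<in> fat m (int n)" by (rule fatI)
    qed
  qed
  moreover have "line a b \<noteq> 0"
    using line_order[OF ab ab(1)] by auto
  ultimately show ?thesis
    unfolding fdim_def by (simp add: dim_mult_image fin_fat)
qed

text \<open>The parametrization has degree 2, so the pullback has degree at most 2 n, fewer than its
  zeros. Hence it is 0 and C divides the form. C vanishes to order exactly one at each point, so the
  quotient loses one from every multiplicity.\<close>

lemma conic_case:
  assumes m: "\<And>j. j \<in> {1..s} \<Longrightarrow> m j \<ge> 1" and n: "2 * n < (\<Sum>j=1..s. m j)"
  shows "fdim m (int n) = fdim (\<lambda>j. m j - 1) (int n - 2)"
proof -
  have s2: "2 \<le> s" using s4 by simp
  obtain q \<tau> \<kappa> where q: "\<And>i. degree (q i) \<le> 2" "ev3 (\<lambda>x. [:x:]) q C = 0" "inj_on \<tau> {1..s}"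
    "\<And>i j. j \<in> {1..s} \<Longrightarrow> poly (q i) (\<tau> j) = \<kappa> j * P j i" "\<And>j. j \<in> {2..s} \<Longrightarrow> \<kappa> j \<noteq> 0"
    using parametrization[OF s2 P0 PC P_inj] by blast
  have "fat m (int n) = (*) C ` fat (\<lambda>j. m j - 1) (int n - 2)"
  proof
    show "fat m (int n) \<subseteq> (*) C ` fat (\<lambda>j. m j - 1) (int n - 2)"
    proof
      fix f assume f: "f \<in> fat m (int n)"
      hence hom: "homogeneous3 (int n) f" by (simp add: fat_def)
      have "ev3 (\<lambda>x. [:x:]) q f = 0"
      proof (rule ccontr)
        assume "ev3 (\<lambda>x. [:x:]) q f \<noteq> 0"
        from dvd_imp_degree_le[OF curve_multiplicities[OF f subset_refl q(3,4)] this]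
        have "(\<Sum>j=1..s. m j) \<le> n * 2"
          using degree_ev3_le[OF hom, of q 2, OF q(1)] by (simp add: degree_prod_root_powers)
        thus False using n by simp
      qed
      note qf = this
      \<comment> \<open>Divisibility by C is tested on three points with nonzero
        \<open>\<kappa>\<close>, and the parametrization guarantees this for indices from 2 on; here
        s \<ge> 4 enters.\<close>
      have j: "2 \<in> {1..s}" "3 \<in> {1..s}" "4 \<in> {1..s}" "2 \<in> {2..s}" "3 \<in> {2..s}" "4 \<in> {2..s}"
        using s4 by auto
      have "\<exists>g. homogeneous3 (int n - 2) g \<and> f = C * g"
        by (rule conic_dvd[OF q(2) P0[OF j(1)] PC[OF j(1)] P0[OF j(2)] PC[OF j(2)] P0[OF j(3)] PC[OF j(3)]
              P_neq[OF j(1,2)] P_neq[OF j(3,1)] P_neq[OF j(3,2)]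
              q(4)[OF j(1)] q(5)[OF j(4)] q(4)[OF j(2)] q(5)[OF j(5)] q(4)[OF j(3)] q(5)[OF j(6)] hom qf]) auto
      then obtain g where g: "homogeneous3 (int n - 2) g" "f = C * g" by blast
      show "f \<in> (*) C ` fat (\<lambda>j. m j - 1) (int n - 2)"
      proof (cases "n < 2")
        case True
        hence "g = 0" using g(1) homogeneous3_neg[of "int n - 2" g] by simp
        thus ?thesis using g v3.subspace_0[OF subspace_fat[of "\<lambda>j. m j - 1" "int n - 2"]] by auto
      next
        case False
        hence n2: "int n - 2 = int (n - 2)" by simp
        have "[:0, 1:] ^ (m j - 1) dvd taylor (P j) g" if j: "j \<in> {1..s}" for j
          using power_dvd_cancel[of 0 "m j" "taylor (P j) C" "taylor (P j) g" 1]
            taylor_order[where p = "P j"] P0[OF j] PC[OF j] f j g(2) unfolding fat_iff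
          by (simp add: numeral_2_eq_2)
        hence "g \<in> fat (\<lambda>j. m j - 1) (int n - 2)" unfolding n2 fat_iff using g(1)[unfolded n2] by blast
        thus ?thesis using g(2) by auto
      qed
    qed
    show "(*) C ` fat (\<lambda>j. m j - 1) (int n - 2) \<subseteq> fat m (int n)"
    proof
      fix f assume "f \<in> (*) C ` fat (\<lambda>j. m j - 1) (int n - 2)"
      then obtain g where g: "g \<in> fat (\<lambda>j. m j - 1) (int n - 2)" "f = C * g" by auto
      have "homogeneous3 (int n) f"
        using homogeneous3_mult[OF C_hom, of "int n - 2" g] g by (simp add: fat_def)
      moreover have "f \<in> point_power (P j) (m j)" if j: "j \<in> {1..s}" for j
      proof -
        have "g \<in> point_power (P j) (m j - 1)" using fatD[OF g(1) j] by simp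
        hence "g * C \<in> point_power (P j) (Suc (m j - 1))"
          using vanishing_idealI[OF C_hom PC[OF j]] by (intro point_power_SucI)
        thus ?thesis using m[OF j] g(2) by (simp add: mult.commute)
      qed
      ultimately show "f \<in> fat m (int n)" by (rule fatI)
    qed
  qed
  moreover have "C \<noteq> 0"
    using taylor_order[where p = "P 1"] P0[of 1] PC[of 1] s4 by auto
  ultimately show ?thesis
    unfolding fdim_def by (simp add: dim_mult_image fin_fat)
qed

text \<open>The number of Taylor coefficients that have to vanish is \<open>deg m\<close>.\<close>

lemma fdim_lower: "v3.dim (forms (int n) :: 'k poly3 set) \<le> fdim m (int n) + deg m"
proof -
  \<comment> \<open>One condition for each point j, order b < m j and power c \<le> b of the slope;
    higher powers do not occur at order b.\<close>
  define T where "T = (SIGMA j:{1..s}. SIGMA b:{..<m j}. {..b})"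
  define l where "l = (\<lambda>(j, b, c) f. coeff (coeff (taylor (P j) f) b) c)"
  have "finite T" by (simp add: T_def)
  have "card T = deg m"
    by (simp add: T_def deg_def sum_choose_Suc)
  have "{f\<in>forms (int n). \<forall>t\<in>T. l t f = 0} \<subseteq> fat m (int n)"
  proof
    fix f assume f: "f \<in> {f\<in>forms (int n). \<forall>t\<in>T. l t f = 0}"
    have "coeff (taylor (P j) f) b = 0" if "j \<in> {1..s}" "b < m j" for j b
    proof (rule poly_eqI)
      fix c
      show "coeff (coeff (taylor (P j) f) b) c = coeff 0 c"
      proof (cases "c \<le> b")
        case True
        hence "(j, b, c) \<in> T" using that by (simp add: T_def)
        thus ?thesis using f by (auto simp: l_def)
      next
        case False
        thus ?thesis using degree_coeff_taylor[of "P j" f b] by (simp add: coeff_eq_0)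
      qed
    qed
    thus "f \<in> fat m (int n)" using f unfolding fat_iff X_power_dvd_iff by auto
  qed
  moreover have lin: "Vector_Spaces.linear scale3 smult (\<lambda>f. [:l t f:])" for t
    by unfold_locales (auto simp: l_def scale3_def split: prod.splits)
  moreover have "v3.subspace {f\<in>forms (int n). \<forall>t\<in>T. l t f = 0}"
    by (rule v3.subspaceI)
      (auto simp: l_def scale3_def homogeneous3_add homogeneous3_const3_mult split: prod.splits)
  ultimately have "v3.dim {f\<in>forms (int n). \<forall>t\<in>T. l t f = 0} \<le> fdim m (int n)"
    unfolding fdim_def by (intro v3.dim_subspace_mono fin_fat)
  moreover have "v3.dim (forms (int n) :: 'k poly3 set) \<le> v3.dim {f\<in>forms (int n). \<forall>t\<in>T. l t f = 0} + card T"
    by (rule dim_functionals[OF \<open>finite T\<close> fin_subspace_forms lin])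
  ultimately show ?thesis using \<open>card T = deg m\<close> by simp
qed

lemma deg_drop2:
  assumes "a \<in> {1..s}" "b \<in> {1..s}" "a \<noteq> b"
  shows "deg m = deg (drop2 a b m) + m a + m b"
proof -
  have "deg m = (\<Sum>j=1..s. ((drop2 a b m j + 1) choose 2) + (if j = a \<or> j = b then m j else 0))"
    unfolding deg_def
  proof (rule sum.cong[OF refl])
    fix j
    show "(m j + 1) choose 2 = ((drop2 a b m j + 1) choose 2) + (if j = a \<or> j = b then m j else 0)"
    proof (cases "j = a \<or> j = b")
      case True
      hence "drop2 a b m j = m j - 1" by (simp add: drop2_def)
      thus ?thesis using True deg_Suc_choose[of "m j"] by (simp only: if_True)
    next
      case False
      thus ?thesis by (simp only: drop2_def if_False diff_zero add_0_right)
    qed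
  qed
  also have "\<dots> = deg (drop2 a b m) + (\<Sum>j=1..s. if j = a \<or> j = b then m j else 0)"
    by (simp add: sum.distrib deg_def)
  also have "(\<Sum>j=1..s. if j = a \<or> j = b then m j else 0) = (\<Sum>j\<in>{a, b}. m j)"
    using assms by (intro sum.mono_neutral_cong_right) auto
  finally show ?thesis using assms(3) by simp
qed

lemma sum_drop2:
  assumes "a \<in> {1..s}" "b \<in> {1..s}" "a \<noteq> b"
  shows "(\<Sum>j=1..s. m j) = (\<Sum>j=1..s. drop2 a b m j) + (if m a = 0 then 0 else 1) + (if m b = 0 then 0 else 1)"
proof -
  let ?d = "\<lambda>j. if m j = 0 then 0 else 1 :: nat"
  have "(\<Sum>j=1..s. m j) = (\<Sum>j=1..s. drop2 a b m j + (if j = a \<or> j = b then ?d j else 0))"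
    unfolding drop2_def by (intro sum.cong refl) auto
  also have "\<dots> = (\<Sum>j=1..s. drop2 a b m j) + (\<Sum>j=1..s. if j = a \<or> j = b then ?d j else 0)"
    by (rule sum.distrib)
  also have "(\<Sum>j=1..s. if j = a \<or> j = b then ?d j else 0) = (\<Sum>j\<in>{a, b}. ?d j)"
    using assms by (intro sum.mono_neutral_cong_right) auto
  finally show ?thesis using assms(3) by simp
qed

lemma fdim_le_forms: "fdim m i \<le> v3.dim (forms i :: 'k poly3 set)"
  unfolding fdim_def by (rule v3.dim_subspace_mono[OF fin_subspace_forms subspace_fat]) (auto simp: fat_def)

text \<open>Rank-nullity for the restriction to the line: the image lies in the multiples of t^(m a)
  (t - 1)^(m b) of degree at most n, a space of dimension n + 1 - (m a + m b), and the kernel embeds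
  into the forms of the residual scheme.\<close>

lemma fdim_upper_step:
  assumes ab: "a \<in> {1..s}" "b \<in> {1..s}" "a \<noteq> b" and n: "m a + m b \<le> n + 1"
  shows "fdim m (int n) \<le> (n + 1 - (m a + m b)) + fdim (drop2 a b m) (int n - 1)"
proof -
  let ?l = "\<lambda>j. [:P a j, P b j - P a j:]"
  let ?f = "ev3 (\<lambda>x. [:x:]) ?l"
  let ?T = "[:0, 1:] ^ m a * [:- 1, 1:] ^ m b :: 'k poly"
  obtain L r where "line_coords L r ?l" and L2: "L 2 = line a b"
    using line_coords_exist[where p = "P a" and q = "P b"] P0 ab P_neq[OF ab] by metis
  then interpret line_coords L r ?l by simp
  have "{f\<in>fat m (int n). ?f f = 0} \<subseteq> (*) (line a b) ` fat (drop2 a b m) (int n - 1)"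
  proof
    fix f assume f: "f \<in> {f\<in>fat m (int n). ?f f = 0}"
    hence "homogeneous3 (int n) f" "?f f = 0" by (simp_all add: fat_def)
    then obtain g where "homogeneous3 (int n - 1) g" "f = line a b * g" unfolding L2[symmetric] by (rule vanish)
    thus "f \<in> (*) (line a b) ` fat (drop2 a b m) (int n - 1)" using line_residual[OF ab] f by auto
  qed
  moreover have lin0: "v3.subspace {f\<in>fat m (int n). ?f f = 0}"
  proof -
    interpret Vector_Spaces.linear scale3 smult ?f by (rule linear_ev3_poly)
    show ?thesis using v3.subspace_inter[OF subspace_fat subspace_kernel] by (simp add: Int_def)
  qed
  moreover have "fin_subspace scale3 ((*) (line a b) ` fat (drop2 a b m) (int n - 1))"
    by (rule v33.fin_subspace_image[OF linear_mult fin_fat])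
  ultimately have "v3.dim {f\<in>fat m (int n). ?f f = 0} \<le> v3.dim ((*) (line a b) ` fat (drop2 a b m) (int n - 1))"
    using v3.dim_subspace_mono by blast
  also have "\<dots> = fdim (drop2 a b m) (int n - 1)"
    using line_order[OF ab ab(1)] unfolding fdim_def by (subst dim_mult_image[OF fin_fat]) auto
  finally have ker: "v3.dim {f\<in>fat m (int n). ?f f = 0} \<le> fdim (drop2 a b m) (int n - 1)" .
  have "?f ` fat m (int n) \<subseteq> vp.span ((\<lambda>k. ?T * monom 1 k) ` {..<n + 1 - (m a + m b)})"
  proof
    fix p assume "p \<in> ?f ` fat m (int n)"
    then obtain f where f: "f \<in> fat m (int n)" "p = ?f f" by auto
    obtain u where u: "p = ?T * u" using line_multiplicities[OF ab f(1)] f(2) by (auto elim: dvdE)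
    show "p \<in> vp.span ((\<lambda>k. ?T * monom 1 k) ` {..<n + 1 - (m a + m b)})"
    proof (cases "u = 0")
      case True thus ?thesis using u vp.span_zero by simp
    next
      case False
      have "degree p = (m a + m b) + degree u"
        unfolding u using False by (simp add: degree_mult_eq degree_power_eq)
      moreover have "degree p \<le> n" using f by (auto simp: fat_def intro: q_deg)
      ultimately have d: "m a + m b + degree u \<le> n" by simp
      have "u = (\<Sum>k\<le>degree u. smult (coeff u k) (monom 1 k))"
        using poly_as_sum_of_monoms[of u] by (simp add: smult_monom)
      from arg_cong[OF this, of "(*) ?T"]
      have "p = (\<Sum>k\<le>degree u. smult (coeff u k) (?T * monom 1 k))"
        unfolding u[symmetric] by (simp only: sum_distrib_left mult_smult_right)
      moreover have "\<dots> \<in> vp.span ((\<lambda>k. ?T * monom 1 k) ` {..<n + 1 - (m a + m b)})"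
        by (intro vp.span_sum vp.span_scale vp.span_base imageI) (use d in auto)
      ultimately show ?thesis by simp
    qed
  qed
  hence "vp.dim (?f ` fat m (int n)) \<le> card ((\<lambda>k. ?T * monom 1 k) ` {..<n + 1 - (m a + m b)})"
    by (rule vp.dim_le_card) simp
  also have "\<dots> \<le> n + 1 - (m a + m b)"
    using card_image_le[of "{..<n + 1 - (m a + m b)}"] by simp
  finally have "vp.dim (?f ` fat m (int n)) \<le> n + 1 - (m a + m b)" .
  moreover have "v3.dim (fat m (int n)) = vp.dim (?f ` fat m (int n)) + v3.dim {f\<in>fat m (int n). ?f f = 0}"
    by (rule v3p.dim_kernel_image[OF linear_ev3_poly fin_fat])
  ultimately show ?thesis using ker unfolding fdim_def by linarith
qed

lemma finite_max:
  fixes m :: "nat \<Rightarrow> nat"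
  assumes "finite A" "A \<noteq> {}"
  obtains a where "a \<in> A" "\<And>j. j \<in> A \<Longrightarrow> m j \<le> m a"
proof -
  have "Max (m ` A) \<in> m ` A" using assms by (intro Max_in) auto
  then obtain a where a: "a \<in> A" "Max (m ` A) = m a" by auto
  have "m j \<le> m a" if "j \<in> A" for j
    unfolding a(2)[symmetric] using assms(1) that by (intro Max_ge) auto
  with a(1) show ?thesis by (rule that)
qed

lemma top_two:
  fixes m :: "nat \<Rightarrow> nat"
  obtains a b where "a \<in> {1..s}" "b \<in> {1..s}" "a \<noteq> b"
    "\<forall>j\<in>{1..s}. m j \<le> m a" "\<forall>j\<in>{1..s} - {a}. m j \<le> m b"
proof -
  have "{1..s} \<noteq> {}" using s4 by simp
  from finite_max[OF _ this, of m] obtain a where a: "a \<in> {1..s}" "\<And>j. j \<in> {1..s} \<Longrightarrow> m j \<le> m a"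
    by blast
  have "card ({1..s} - {a}) > 0" using s4 a by simp
  hence ne: "{1..s} - {a} \<noteq> {}" by (metis card.empty less_irrefl)
  from finite_max[OF _ this, of m] obtain b where
    "b \<in> {1..s} - {a}" "\<And>j. j \<in> {1..s} - {a} \<Longrightarrow> m j \<le> m b" by blast
  thus ?thesis using a by (intro that[of a b]) auto
qed

text \<open>Induction on the degree, splitting off the line through the two points of highest multiplicity.
  No third point lies on this line, so the hypotheses pass to the residual scheme.\<close>

lemma fdim_upper:
  assumes "\<And>a b. a \<in> {1..s} \<Longrightarrow> b \<in> {1..s} \<Longrightarrow> a \<noteq> b \<Longrightarrow> m a + m b \<le> n + 1"
    "(\<Sum>j=1..s. m j) \<le> 2 * n + 1"
  shows "fdim m (int n) + deg m \<le> v3.dim (forms (int n) :: 'k poly3 set)"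
  using assms
proof (induction n arbitrary: m)
  case 0
  \<comment> \<open>In degree 0 the multiplicities add up to at most 1. There is at most one reduced
    point, and no nonzero constant vanishes at it.\<close>
  show ?case
  proof (cases "\<forall>j\<in>{1..s}. m j = 0")
    case True
    hence "deg m = 0" by (simp add: deg_def)
    thus ?thesis using fdim_le_forms[of m 0] by simp
  next
    case False
    then obtain a where a: "a \<in> {1..s}" "m a \<noteq> 0" by auto
    have sum: "(\<Sum>j=1..s. m j) = m a + (\<Sum>j\<in>{1..s} - {a}. m j)"
      using a by (intro sum.remove) auto
    have ma: "m a = 1" and m0: "(\<Sum>j\<in>{1..s} - {a}. m j) = 0" using 0(2) a(2) unfolding sum by linarith+
    have "(\<Sum>j\<in>{1..s} - {a}. (m j + 1) choose 2) = 0"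
    proof (rule sum.neutral, rule ballI)
      fix j assume "j \<in> {1..s} - {a}"
      hence "m j = 0" using m0 by (simp only: sum_eq_0_iff finite_Diff finite_atLeastAtMost)
      thus "(m j + 1) choose 2 = 0" by simp
    qed
    note z = this
    have "deg m = ((m a + 1) choose 2) + (\<Sum>j\<in>{1..s} - {a}. (m j + 1) choose 2)"
      unfolding deg_def using a by (intro sum.remove) auto
    hence deg: "deg m = 1" unfolding z ma by (simp add: numeral_2_eq_2)
    have "fat m 0 \<subseteq> {0}"
    proof
      fix f assume f: "f \<in> fat m 0"
      hence c: "f = const3 (lk f 0)" by (intro homogeneous3_degree_0) (simp add: fat_def)
      have "[:0, 1:] ^ 1 dvd taylor (P a) f" using point_power_order[OF fatD[OF f a(1)]] ma by simp
      hence "poly (taylor (P a) f) 0 = 0" by (auto simp: poly_eq_0_iff_dvd)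
      hence "lk f 0 = 0" by (subst (asm) c) simp
      thus "f \<in> {0}" using c by simp
    qed
    hence "fdim m 0 \<le> card ({} :: 'k poly3 set)" unfolding fdim_def by (intro v3.dim_le_card) auto
    thus ?thesis using deg dim_forms[where ?'k = 'k, of 0] by simp
  qed
next
  case (Suc n)
  obtain a b where ab: "a \<in> {1..s}" "b \<in> {1..s}" "a \<noteq> b"
    and max: "\<forall>j\<in>{1..s}. m j \<le> m a" "\<forall>j\<in>{1..s} - {a}. m j \<le> m b"
    by (rule top_two[of m])
  have a: "m j \<le> m a" if "j \<in> {1..s}" for j using max(1) that by blast
  have b: "m j \<le> m b" if "j \<in> {1..s}" "j \<noteq> a" for j using max(2) that by blast
  show ?case
  proof (cases "m a = 0")
    case True
    hence "m j = 0" if "j \<in> {1..s}" for j using a[OF that] by simp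
    hence "deg m = 0" by (simp add: deg_def)
    thus ?thesis using fdim_le_forms[of m "int (Suc n)"] by simp
  next
    case False
    let ?m = "drop2 a b m"
    have sums: "(\<Sum>j=1..s. m j) = (\<Sum>j=1..s. ?m j) + 1 + (if m b = 0 then 0 else 1)"
      using sum_drop2[OF ab, of m] False by simp
    have mab: "m a + m b \<le> Suc n + 1" using Suc.prems(1)[OF ab] .
    have pair: "?m c + ?m d \<le> n + 1" if cd: "c \<in> {1..s}" "d \<in> {1..s}" "c \<noteq> d" for c d
    proof -
      have le: "m c + m d \<le> n + 2" using Suc.prems(1)[OF cd] by simp
      show ?thesis
      proof (cases "{c, d} \<inter> {a, b} = {}")
        \<comment> \<open>Four different points have total multiplicity at most 2 n + 3, and m a + m
          b dominates m c + m d, so the latter is at most n + 1.\<close>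
        case True
        have "(\<Sum>j\<in>{a, b, c, d}. m j) \<le> (\<Sum>j=1..s. m j)"
          using ab cd by (intro sum_mono2) auto
        hence "m a + m b + m c + m d \<le> 2 * Suc n + 1"
          using Suc.prems(2) ab cd True by (auto simp: add.assoc)
        moreover have "m c \<le> m a" "m d \<le> m b" using a[OF cd(1)] b[OF cd(2)] True by auto
        ultimately show ?thesis using True by (auto simp: drop2_def)
      next
        case c: False
        show ?thesis
        \<comment> \<open>A pair meeting a or b may have multiplicities adding up to n + 2 and must
          lose one. If m b is positive, both a and b are properly lowered. If m b = 0, all
          multiplicity sits at a, which is lowered.\<close>
        proof (cases "m b = 0")
          case True
          have z: "m j = 0" if "j \<in> {1..s}" "j \<noteq> a" for j using b[OF that] True by simp
          have zc: "m c = 0" if "c \<noteq> a" using z[OF cd(1) that] .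
          have zd: "m d = 0" if "d \<noteq> a" using z[OF cd(2) that] .
          have "?m a = m a - 1" by (simp add: drop2_def)
          moreover have "?m j \<le> m j" for j by (simp add: drop2_def)
          moreover have "m a \<le> n + 2" using mab by simp
          moreover note mono = calculation
          show ?thesis
          proof (cases "c = a")
            case True
            have "?m d = 0" using zd True cd(3) mono(2)[of d] by simp
            thus ?thesis using True mono(1,3) by simp
          next
            case False
            hence "?m c = 0" using zc mono(2)[of c] by simp
            moreover have "?m d \<le> n + 1" using zd mono(1,3) mono(2)[of d] by (cases "d = a") auto
            ultimately show ?thesis by simp
          qed
        next
          case nb: False
          show ?thesis
          proof (cases "m c + m d \<le> n + 1")
            case True thus ?thesis by (auto simp: drop2_def)
          next
            case eq: False
            thus ?thesis using le c False nb by (auto simp: drop2_def)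
          qed
        qed
      qed
    qed
    have sum': "(\<Sum>j=1..s. ?m j) \<le> 2 * n + 1"
    \<comment> \<open>The sum drops by 2 unless m b = 0; in that case it equals m a before the step
      and at most n + 1 after it.\<close>
    proof (cases "m b = 0")
      case True
      have "(\<Sum>j=1..s. m j) = m a + (\<Sum>j\<in>{1..s} - {a}. m j)"
        using ab by (intro sum.remove) auto
      also have "(\<Sum>j\<in>{1..s} - {a}. m j) = 0" using b True by (intro sum.neutral) fastforce
      finally show ?thesis using mab sums True by simp
    next
      case False
      thus ?thesis using sums Suc.prems(2) by simp
    qed
    have "fdim ?m (int n) + deg ?m \<le> v3.dim (forms (int n) :: 'k poly3 set)"
      by (rule Suc.IH[OF pair sum'])
    moreover have "fdim m (int (Suc n)) \<le> (Suc n + 1 - (m a + m b)) + fdim ?m (int n)"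
      using fdim_upper_step[OF ab mab] by simp
    moreover have "deg m = deg ?m + m a + m b" by (rule deg_drop2[OF ab])
    moreover have "v3.dim (forms (int (Suc n)) :: 'k poly3 set) = Suc n + 1 + v3.dim (forms (int n) :: 'k poly3 set)"
      using dim_forms_Suc[where ?'k = 'k, of "Suc n"] by simp
    ultimately show ?thesis using mab by linarith
  qed
qed

text \<open>The lower bound by counting conditions and the upper bound by splitting off lines
  coincide.\<close>

theorem fdim_regular:
  assumes "\<And>a b. a \<in> {1..s} \<Longrightarrow> b \<in> {1..s} \<Longrightarrow> a \<noteq> b \<Longrightarrow> m a + m b \<le> n + 1"
    "(\<Sum>j=1..s. m j) \<le> 2 * n + 1"
  shows "v3.dim (forms (int n) :: 'k poly3 set) = fdim m (int n) + deg m"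
  using fdim_upper[OF assms] fdim_lower[of n m] by simp

end

section \<open>Hilbert functions and regularity indices of the coordinate rings\<close>

section \<open>The coordinate ring and its Hilbert function\<close>

abbreviation cls :: "'k::field poly3 set \<Rightarrow> 'k poly3 \<Rightarrow> 'k poly3 set" where
  "cls I f \<equiv> I +>\<^bsub>poly3_ring\<^esub> f"

lemma cls_def': "cls I f = {h + f | h. h \<in> I}"
  unfolding a_r_coset_def' by auto

lemma cls_eq_iff:
  assumes "ideal I poly3_ring"
  shows "cls I f = cls I g \<longleftrightarrow> f - g \<in> I"
proof
  assume eq: "cls I f = cls I g"
  have "f = 0 + f" by simp
  hence "f \<in> cls I f" unfolding cls_def' using ideal_poly3_0[OF assms] by blast
  hence "f \<in> cls I g" by (simp only: eq)
  then obtain h where "h \<in> I" "f = h + g" unfolding cls_def' by auto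
  thus "f - g \<in> I" by simp
next
  assume fg: "f - g \<in> I"
  show "cls I f = cls I g"
  proof
    show "cls I f \<subseteq> cls I g"
    proof
      fix x assume "x \<in> cls I f"
      then obtain h where "h \<in> I" "x = h + f" unfolding cls_def' by auto
      hence "h + (f - g) \<in> I" "x = (h + (f - g)) + g" using ideal_poly3_add[OF assms] fg by auto
      thus "x \<in> cls I g" unfolding cls_def' by blast
    qed
    show "cls I g \<subseteq> cls I f"
    proof
      fix x assume "x \<in> cls I g"
      then obtain h where "h \<in> I" "x = h + g" unfolding cls_def' by auto
      hence "h - (f - g) \<in> I" "x = (h - (f - g)) + f" using ideal_poly3_diff[OF assms] fg by auto
      thus "x \<in> cls I f" unfolding cls_def' by blast
    qed
  qed
qed

lemma cls_0: "ideal I poly3_ring \<Longrightarrow> cls I 0 = I"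
  unfolding cls_def' by simp

lemma cls_add: "ideal I poly3_ring \<Longrightarrow> set_add poly3_ring (cls I f) (cls I g) = cls I (f + g)"
  using abelian_subgroup.a_rcos_sum[OF abelian_subgroupI3[OF ideal.axioms(1) ring.is_abelian_group[OF ring_poly3]], of I f g]
  by simp

lemma coord_ring_simps:
  assumes "ideal I (poly3_ring :: 'k::field poly3 ring)"
  shows carrier_coord_ring: "carrier (coord_ring I) = range (cls I)"
    and add_coord_ring: "cls I f \<oplus>\<^bsub>coord_ring I\<^esub> cls I g = cls I (f + g)"
    and mult_coord_ring: "cls I f \<otimes>\<^bsub>coord_ring I\<^esub> cls I g = cls I (f * g)"
    and zero_coord_ring: "\<zero>\<^bsub>coord_ring I\<^esub> = cls I 0"
    and one_coord_ring: "\<one>\<^bsub>coord_ring I\<^esub> = cls I 1"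
    and smult_coord_ring: "c \<odot>\<^bsub>coord_ring I\<^esub> cls I f = cls I (const3 c * f)"
proof -
  have mult: "rcoset_mult poly3_ring I (cls I f) (cls I g) = cls I (f * g)" for f g
    using ideal.rcoset_mult_add[OF assms, of f g] by simp
  show "carrier (coord_ring I) = range (cls I)"
    by (auto simp: coord_ring_def ring.defs FactRing_def A_RCOSETS_def')
  show "cls I f \<oplus>\<^bsub>coord_ring I\<^esub> cls I g = cls I (f + g)"
    using cls_add[OF assms] by (simp add: coord_ring_def ring.defs FactRing_def)
  show "cls I f \<otimes>\<^bsub>coord_ring I\<^esub> cls I g = cls I (f * g)"
    using mult by (simp add: coord_ring_def ring.defs FactRing_def)
  show "\<zero>\<^bsub>coord_ring I\<^esub> = cls I 0"
    using cls_0[OF assms] by (simp add: coord_ring_def ring.defs FactRing_def)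
  show "\<one>\<^bsub>coord_ring I\<^esub> = cls I 1"
    by (simp add: coord_ring_def ring.defs FactRing_def)
  show "c \<odot>\<^bsub>coord_ring I\<^esub> cls I f = cls I (const3 c * f)"
    using mult by (simp add: coord_ring_def ring.defs module.defs FactRing_def)
qed

lemma HF_eq:
  assumes "ideal I (poly3_ring :: 'k::field poly3 ring)"
  shows "int (HF I i) = int (v3.dim (forms i :: 'k poly3 set)) - int (v3.dim (forms i \<inter> I))"
  unfolding HF_def
proof (rule v3.vectorspace_dim_quotient[where T = "cls I" and U = "forms i"])
  show "fin_subspace scale3 (forms i :: 'k poly3 set)" by (rule fin_subspace_forms)
  show "v3.subspace (forms i \<inter> I)" by (intro v3.subspace_inter subspace_forms subspace_ideal assms)
  show "cls I x = cls I y \<longleftrightarrow> x - y \<in> forms i \<inter> I" if "x \<in> forms i" "y \<in> forms i" for x y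
    using v3.subspace_diff[OF subspace_forms that] by (simp only: cls_eq_iff[OF assms] Int_iff simp_thms)
qed (auto simp: coord_ring_deg_def add_coord_ring[OF assms] smult_coord_ring[OF assms] zero_coord_ring[OF assms] scale3_def)

section \<open>The regularity index\<close>

text \<open>A polynomial that equals a constant at all large integers is that constant, since the
  difference has infinitely many roots. This gives the uniqueness demanded by the definite
  description.\<close>

lemma hilbert_polynomial_const:
  assumes "\<forall>j\<ge>N. H j = D"
  shows "hilbert_polynomial H = [:of_nat D:]"
  unfolding hilbert_polynomial_def
proof (rule the_equality)
  show "\<forall>\<^sub>F i in at_top. of_nat (H i) = poly [:of_nat D:] (of_int i :: rat)"
    using assms by (auto simp: eventually_at_top_linorder intro!: exI[of _ N])
  fix q :: "rat poly"
  assume "\<forall>\<^sub>F i in at_top. of_nat (H i) = poly q (of_int i)"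
  then obtain M where M: "\<And>i. i \<ge> M \<Longrightarrow> of_nat (H i) = poly q (of_int i)"
    by (auto simp: eventually_at_top_linorder)
  have "poly (q - [:of_nat D:]) (of_int i) = 0" if "i \<ge> max M N" for i
    using M[of i] assms that by simp
  hence "of_int ` {max M N..} \<subseteq> {x. poly (q - [:of_nat D:]) x = 0}" by auto
  moreover have "infinite (of_int ` {max M N..} :: rat set)"
  proof
    assume "finite (of_int ` {max M N..} :: rat set)"
    hence "finite {max M N..}" by (rule finite_imageD) (auto intro: inj_onI)
    thus False using infinite_Ici[of "max M N"] by simp
  qed
  ultimately have "infinite {x. poly (q - [:of_nat D:]) x = 0}" using finite_subset by blast
  hence "q - [:of_nat D:] = 0" using poly_roots_finite by blast
  thus "q = [:of_nat D:]" by simp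
qed

text \<open>The integers are not well-ordered, so the existence of a least index has to be secured:
  a value other than D in degree -1 makes every admissible index nonnegative.\<close>

lemma regularity_index_const:
  assumes N: "\<forall>j\<ge>N. H j = D" and z: "H (- 1) \<noteq> D"
  shows "regularity_index H \<ge> 0" "\<forall>j\<ge>regularity_index H. H j = D"
    "\<And>M. \<forall>j\<ge>M. H j = D \<Longrightarrow> regularity_index H \<le> M"
proof -
  define Q where "Q i \<longleftrightarrow> (\<forall>j\<ge>i. H j = D)" for i
  have eq: "regularity_index H = (LEAST i. Q i)"
    unfolding regularity_index_def hilbert_polynomial_const[OF N] Q_def by simp
  have nonneg: "i \<ge> 0" if "Q i" for i
  proof (rule ccontr)
    assume "\<not> i \<ge> 0"
    hence "H (- 1) = D" using that by (simp add: Q_def)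
    thus False using z by simp
  qed
  have QN: "Q N" using N by (simp add: Q_def)
  hence ex: "Q (int (nat N))" using nonneg[OF QN] by simp
  define r where "r = int (LEAST n. Q (int n))"
  have Qr: "Q r" unfolding r_def by (rule LeastI[where P = "\<lambda>n. Q (int n)", OF ex])
  have least: "r \<le> i" if "Q i" for i
  proof -
    have "Q (int (nat i))" using nonneg[OF that] that by simp
    hence "(LEAST n. Q (int n)) \<le> nat i" by (rule Least_le)
    thus ?thesis using nonneg[OF that] by (simp add: r_def)
  qed
  have "(LEAST i. Q i) = r" using Qr least by (rule Least_equality)
  hence r: "regularity_index H = r" using eq by simp
  show "regularity_index H \<ge> 0" using nonneg[OF Qr] r by simp
  show "\<forall>j\<ge>regularity_index H. H j = D" using Qr r by (simp add: Q_def)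
  show "regularity_index H \<le> M" if "\<forall>j\<ge>M. H j = D" for M
    using least[of M] that r by (simp add: Q_def)
qed

context points_on_conic begin

lemma HF_fat: "int (HF (fat_ideal s m P) i) = int (v3.dim (forms i :: 'k poly3 set)) - int (fdim m i)"
  unfolding HF_eq[OF ideal_fat_ideal] fdim_def fat_def ..

lemma HF_regular:
  assumes "\<And>a b. a \<in> {1..s} \<Longrightarrow> b \<in> {1..s} \<Longrightarrow> a \<noteq> b \<Longrightarrow> int (m a) + int (m b) \<le> i + 1"
    "(\<Sum>j=1..s. int (m j)) \<le> 2 * i + 1" "i \<ge> 0"
  shows "HF (fat_ideal s m P) i = deg m"
proof -
  obtain n where n: "i = int n" using assms(3) nonneg_int_cases by blast
  have "v3.dim (forms (int n) :: 'k poly3 set) = fdim m (int n) + deg m"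
  proof (rule fdim_regular)
    show "m a + m b \<le> n + 1" if "a \<in> {1..s}" "b \<in> {1..s}" "a \<noteq> b" for a b
      using assms(1)[OF that] n by simp
    have "int (\<Sum>j=1..s. m j) \<le> 2 * int n + 1" using assms(2) n by simp
    thus "(\<Sum>j=1..s. m j) \<le> 2 * n + 1" by linarith
  qed
  thus ?thesis using HF_fat[of m i] n by simp
qed

lemma HF_neg: "i < 0 \<Longrightarrow> HF (fat_ideal s m P) i = 0"
  using HF_fat[of m i] dim_forms_neg[where ?'k = 'k, of i] by simp

end

section \<open>Presentation of the module of differentials of S/I and its Hilbert function\<close>

section \<open>Free modules and quotient modules\<close>

lemma free_module_simps:
  fixes A :: "('a, 'm) ring_scheme" (structure)
  assumes "cring A"
  shows carrier_free_module: "carrier (free_module A B) = {f \<in> B \<rightarrow>\<^sub>E carrier A. finite {x \<in> B. f x \<noteq> \<zero>}}"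
    and add_free_module: "f \<oplus>\<^bsub>free_module A B\<^esub> g = (\<lambda>x\<in>B. f x \<oplus> g x)"
    and zero_free_module: "\<zero>\<^bsub>free_module A B\<^esub> = (\<lambda>x\<in>B. \<zero>)"
    and smult_free_module: "a \<odot>\<^bsub>free_module A B\<^esub> f = (\<lambda>x\<in>B. a \<otimes> f x)"
proof -
  interpret cring A by fact
  show "carrier (free_module A B) = {f \<in> B \<rightarrow>\<^sub>E carrier A. finite {x \<in> B. f x \<noteq> \<zero>}}"
    "f \<oplus>\<^bsub>free_module A B\<^esub> g = (\<lambda>x\<in>B. f x \<oplus> g x)" "\<zero>\<^bsub>free_module A B\<^esub> = (\<lambda>x\<in>B. \<zero>)"
    "a \<odot>\<^bsub>free_module A B\<^esub> f = (\<lambda>x\<in>B. a \<otimes> f x)"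
    by (simp_all add: free_module_def func_space_def)
qed

lemma module_free_module:
  fixes A :: "('a, 'm) ring_scheme" (structure)
  assumes "cring A"
  shows "Module.module A (free_module A B)"
proof -
  interpret cring A by fact
  interpret F: Module.module A "func_space B" by (rule func_space_is_module)
  let ?N = "{f \<in> B \<rightarrow>\<^sub>E carrier A. finite {x \<in> B. f x \<noteq> \<zero>}}"
  have "LinearCombinations.submodule A ?N (func_space B)"
  proof (unfold_locales)
    show "?N \<subseteq> carrier (func_space B)" by (auto simp: func_space_def)
    show "\<zero>\<^bsub>func_space B\<^esub> \<in> ?N" by (auto simp: func_space_def)
    fix v w assume v: "v \<in> ?N"
    show "v \<oplus>\<^bsub>func_space B\<^esub> w \<in> ?N" if w: "w \<in> ?N"
    proof -
      have "{x \<in> B. (v \<oplus>\<^bsub>func_space B\<^esub> w) x \<noteq> \<zero>} \<subseteq> {x \<in> B. v x \<noteq> \<zero>} \<union> {x \<in> B. w x \<noteq> \<zero>}"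
        by (auto simp: func_space_def)
      moreover have "finite ({x \<in> B. v x \<noteq> \<zero>} \<union> {x \<in> B. w x \<noteq> \<zero>})" using v w by simp
      ultimately have "finite {x \<in> B. (v \<oplus>\<^bsub>func_space B\<^esub> w) x \<noteq> \<zero>}" by (rule finite_subset)
      thus ?thesis using v w by (auto simp: func_space_def)
    qed
    show "c \<odot>\<^bsub>func_space B\<^esub> v \<in> ?N" if c: "c \<in> carrier A" for c
    proof -
      have "{x \<in> B. (c \<odot>\<^bsub>func_space B\<^esub> v) x \<noteq> \<zero>} \<subseteq> {x \<in> B. v x \<noteq> \<zero>}"
        using c by (auto simp: func_space_def)
      moreover have "finite {x \<in> B. v x \<noteq> \<zero>}" using v by simp
      ultimately have "finite {x \<in> B. (c \<odot>\<^bsub>func_space B\<^esub> v) x \<noteq> \<zero>}" by (rule finite_subset)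
      thus ?thesis using v c by (auto simp: func_space_def)
    qed
  qed
  from F.submodule_is_module[OF this] show ?thesis by (simp add: free_module_def)
qed

lemma free_gen_closed:
  fixes A :: "('a, 'm) ring_scheme" (structure)
  assumes "cring A"
  shows "free_gen A B a \<in> carrier (free_module A B)"
proof -
  interpret cring A by fact
  have "{x \<in> B. free_gen A B a x \<noteq> \<zero>} \<subseteq> {a}" by (auto simp: free_gen_def)
  hence "finite {x \<in> B. free_gen A B a x \<noteq> \<zero>}" by (rule finite_subset) simp
  thus ?thesis by (auto simp: carrier_free_module[OF assms] free_gen_def)
qed

locale module_quotient = Module.module R M for R (structure) and M (structure) +
  fixes N
  assumes sub: "LinearCombinations.submodule R N M"
begin

lemma N_closed: "x \<in> N \<Longrightarrow> x \<in> carrier M"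
  using LinearCombinations.submodule.subset[OF sub] by blast

lemma N_minus: "x \<in> N \<Longrightarrow> \<ominus>\<^bsub>M\<^esub> x \<in> N"
proof -
  assume x: "x \<in> N"
  have "(\<ominus> \<one>) \<odot>\<^bsub>M\<^esub> x \<in> N" using LinearCombinations.submodule.smult_closed[OF sub _ x, of "\<ominus> \<one>"] by simp
  thus ?thesis using smult_l_minus[of \<one> x] N_closed[OF x] by simp
qed

lemma additive_subgroup_N: "additive_subgroup N M"
proof (rule additive_subgroupI, rule M.add.subgroupI)
  show "N \<subseteq> carrier M" using N_closed by blast
  show "N \<noteq> {}" using LinearCombinations.submodule.zero_closed[OF sub] by auto
  show "\<ominus>\<^bsub>M\<^esub> a \<in> N" if "a \<in> N" for a using N_minus[OF that] .
  show "a \<oplus>\<^bsub>M\<^esub> b \<in> N" if "a \<in> N" "b \<in> N" for a b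
    using LinearCombinations.submodule.m_closed[OF sub that] .
qed

lemma abelian_subgroup_N: "abelian_subgroup N M"
  by (rule abelian_subgroupI3[OF additive_subgroup_N M.abelian_group_axioms])

abbreviation "Q \<equiv> quotient_module M N"
abbreviation co where "co x \<equiv> N +>\<^bsub>M\<^esub> x"

lemma carrier_Q: "carrier Q = (\<lambda>x. co x) ` carrier M"
  by (auto simp: quotient_module_def A_RCOSETS_def')

lemma co_closed: "x \<in> carrier M \<Longrightarrow> co x \<in> carrier Q"
  unfolding carrier_Q by blast

lemma zero_Q: "\<zero>\<^bsub>Q\<^esub> = co \<zero>\<^bsub>M\<^esub>"
proof -
  have "co \<zero>\<^bsub>M\<^esub> = N" using M.a_coset_add_zero N_closed by blast
  thus ?thesis by (simp add: quotient_module_def)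
qed

lemma add_Q: "x \<in> carrier M \<Longrightarrow> y \<in> carrier M \<Longrightarrow> co x \<oplus>\<^bsub>Q\<^esub> co y = co (x \<oplus>\<^bsub>M\<^esub> y)"
  using abelian_subgroup.a_rcos_sum[OF abelian_subgroup_N] by (simp add: quotient_module_def)

lemma co_eqI:
  assumes "x \<in> carrier M" "y \<in> carrier M" "x \<ominus>\<^bsub>M\<^esub> y \<in> N"
  shows "co x = co y"
proof -
  have "x = (x \<ominus>\<^bsub>M\<^esub> y) \<oplus>\<^bsub>M\<^esub> y" using assms(1,2) by (simp add: a_minus_def M.a_assoc M.l_neg)
  hence "x \<in> co y" unfolding a_r_coset_def' using assms(3) by blast
  thus ?thesis using abelian_group.a_repr_independence[OF M.abelian_group_axioms _ assms(2), of x N]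
      additive_subgroup.a_subgroup[OF additive_subgroup_N] by simp
qed

lemma co_eq_zeroD:
  assumes "x \<in> carrier M" "co x = \<zero>\<^bsub>Q\<^esub>"
  shows "x \<in> N"
proof -
  have "x \<in> co x" using abelian_subgroup.a_rcos_self[OF abelian_subgroup_N assms(1)] .
  thus ?thesis using assms(2) by (simp add: quotient_module_def)
qed

lemma co_zero: "x \<in> N \<Longrightarrow> co x = \<zero>\<^bsub>Q\<^esub>"
  using abelian_group.a_coset_join2[OF M.abelian_group_axioms, of x N] N_closed
    additive_subgroup.a_subgroup[OF additive_subgroup_N]
  by (simp add: quotient_module_def)

text \<open>Scalar multiplication in the quotient is defined as a union over all representatives;
  the cosets in this union coincide because N is closed under scalars.\<close>

lemma smult_Q:
  assumes a: "a \<in> carrier R" and x: "x \<in> carrier M"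
  shows "a \<odot>\<^bsub>Q\<^esub> co x = co (a \<odot>\<^bsub>M\<^esub> x)"
proof -
  have "co (a \<odot>\<^bsub>M\<^esub> y) = co (a \<odot>\<^bsub>M\<^esub> x)" if y: "y \<in> co x" for y
  proof -
    from y obtain n where n: "n \<in> N" "y = n \<oplus>\<^bsub>M\<^esub> x" unfolding a_r_coset_def' by auto
    have "a \<odot>\<^bsub>M\<^esub> y \<ominus>\<^bsub>M\<^esub> a \<odot>\<^bsub>M\<^esub> x = a \<odot>\<^bsub>M\<^esub> n"
      using n x a N_closed[OF n(1)] by (simp add: smult_r_distr a_minus_def M.a_assoc M.r_neg)
    moreover have "a \<odot>\<^bsub>M\<^esub> n \<in> N" using LinearCombinations.submodule.smult_closed[OF sub a n(1)] .
    moreover have "y \<in> carrier M" using n x N_closed by simp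
    ultimately show ?thesis using a x by (intro co_eqI) simp_all
  qed
  moreover have "x \<in> co x" using abelian_subgroup.a_rcos_self[OF abelian_subgroup_N x] .
  ultimately have "(\<Union>y\<in>co x. co (a \<odot>\<^bsub>M\<^esub> y)) = co (a \<odot>\<^bsub>M\<^esub> x)" by blast
  thus ?thesis by (simp add: quotient_module_def)
qed

lemma module_Q: "Module.module R Q"
proof (rule moduleI)
  show "cring R" by (rule R.cring_axioms)
  show "abelian_group Q"
  proof (rule abelian_groupI)
    fix x assume "x \<in> carrier Q"
    then obtain u where u: "u \<in> carrier M" "x = co u" unfolding carrier_Q by blast
    have "co (\<ominus>\<^bsub>M\<^esub> u) \<in> carrier Q" "co (\<ominus>\<^bsub>M\<^esub> u) \<oplus>\<^bsub>Q\<^esub> x = \<zero>\<^bsub>Q\<^esub>"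
      using u by (simp_all add: co_closed add_Q zero_Q M.l_neg)
    thus "\<exists>y\<in>carrier Q. y \<oplus>\<^bsub>Q\<^esub> x = \<zero>\<^bsub>Q\<^esub>" by blast
  qed (auto simp: carrier_Q add_Q zero_Q M.a_ac)
qed (auto simp: carrier_Q add_Q smult_Q smult_l_distr smult_r_distr smult_assoc1)

end

section \<open>Differentials of a homogeneous coordinate ring\<close>

locale coord_quotient =
  fixes I :: "'k::field_char_0 poly3 set"
  assumes I_hom: "hom_ideal I"
begin

lemma I: "ideal I poly3_ring"
  using I_hom by (simp add: hom_ideal_def)

abbreviation R where "R \<equiv> coord_ring I"

lemmas R_simps = carrier_coord_ring[OF I] add_coord_ring[OF I] mult_coord_ring[OF I]
  zero_coord_ring[OF I] one_coord_ring[OF I] smult_coord_ring[OF I]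

lemma cls_closed [simp]: "cls I f \<in> carrier R"
  by (simp add: R_simps)

lemma cring_R: "cring R"
proof (rule cringI)
  show "abelian_group R"
  proof (rule abelian_groupI)
    fix x assume "x \<in> carrier R"
    then obtain f where "x = cls I f" by (auto simp: R_simps)
    hence "cls I (- f) \<in> carrier R" "cls I (- f) \<oplus>\<^bsub>R\<^esub> x = \<zero>\<^bsub>R\<^esub>" by (simp_all add: R_simps)
    thus "\<exists>y\<in>carrier R. y \<oplus>\<^bsub>R\<^esub> x = \<zero>\<^bsub>R\<^esub>" by blast
  qed (auto simp: R_simps algebra_simps)
  show "Group.comm_monoid R"
    by (rule comm_monoidI) (auto simp: R_simps algebra_simps)
qed (auto simp: R_simps algebra_simps)

abbreviation F where "F \<equiv> free_module R (carrier R)"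
abbreviation Rel where "Rel \<equiv> kaehler_relations base_field R"
abbreviation N where "N \<equiv> kaehler_submodule base_field R"
abbreviation \<delta> where "\<delta> f \<equiv> free_gen R (carrier R) (cls I f)"

sublocale F: Module.module R F
  by (rule module_free_module[OF cring_R])

lemma \<delta>_closed [simp]: "\<delta> f \<in> carrier F"
  by (rule free_gen_closed[OF cring_R])

text \<open>Relations indexed by elements of R are indexed by polynomials instead, since the
  computations below take place in S.\<close>

lemma Rel_eq: "Rel =
    {\<delta> (f + g) \<ominus>\<^bsub>F\<^esub> (\<delta> f \<oplus>\<^bsub>F\<^esub> \<delta> g) | f g. True} \<union>
    {\<delta> (f * g) \<ominus>\<^bsub>F\<^esub> (cls I f \<odot>\<^bsub>F\<^esub> \<delta> g \<oplus>\<^bsub>F\<^esub> cls I g \<odot>\<^bsub>F\<^esub> \<delta> f) | f g. True} \<union>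
    {\<delta> (const3 c) | c. True}"
proof -
  have g: "{H a b | a b. a \<in> carrier R \<and> b \<in> carrier R} = {H (cls I f) (cls I g) | f g. True}"
    for H :: "'k poly3 set \<Rightarrow> 'k poly3 set \<Rightarrow> 'k poly3 set \<Rightarrow> 'k poly3 set"
    unfolding carrier_coord_ring[OF I] by blast
  have 1: "{\<delta>' (a \<oplus>\<^bsub>R\<^esub> b) \<ominus>\<^bsub>F\<^esub> (\<delta>' a \<oplus>\<^bsub>F\<^esub> \<delta>' b) | a b. a \<in> carrier R \<and> b \<in> carrier R} =
    {\<delta>' (cls I (f + g)) \<ominus>\<^bsub>F\<^esub> (\<delta>' (cls I f) \<oplus>\<^bsub>F\<^esub> \<delta>' (cls I g)) | f g. True}" for \<delta>'
    using g[of "\<lambda>a b. \<delta>' (a \<oplus>\<^bsub>R\<^esub> b) \<ominus>\<^bsub>F\<^esub> (\<delta>' a \<oplus>\<^bsub>F\<^esub> \<delta>' b)"] by (simp only: add_coord_ring[OF I])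
  have 2: "{\<delta>' (a \<otimes>\<^bsub>R\<^esub> b) \<ominus>\<^bsub>F\<^esub> (a \<odot>\<^bsub>F\<^esub> \<delta>' b \<oplus>\<^bsub>F\<^esub> b \<odot>\<^bsub>F\<^esub> \<delta>' a) | a b. a \<in> carrier R \<and> b \<in> carrier R} =
    {\<delta>' (cls I (f * g)) \<ominus>\<^bsub>F\<^esub> (cls I f \<odot>\<^bsub>F\<^esub> \<delta>' (cls I g) \<oplus>\<^bsub>F\<^esub> cls I g \<odot>\<^bsub>F\<^esub> \<delta>' (cls I f)) | f g. True}" for \<delta>'
    using g[of "\<lambda>a b. \<delta>' (a \<otimes>\<^bsub>R\<^esub> b) \<ominus>\<^bsub>F\<^esub> (a \<odot>\<^bsub>F\<^esub> \<delta>' b \<oplus>\<^bsub>F\<^esub> b \<odot>\<^bsub>F\<^esub> \<delta>' a)"]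
    by (simp only: mult_coord_ring[OF I])
  have 3: "{\<delta>' (c \<odot>\<^bsub>R\<^esub> \<one>\<^bsub>R\<^esub>) | c. c \<in> carrier base_field} = {\<delta>' (cls I (const3 c)) | c. True}" for \<delta>'
    by (simp add: one_coord_ring[OF I] smult_coord_ring[OF I]) (simp add: ring_of_type_algebra_def)
  show ?thesis unfolding kaehler_relations_def Let_def 1 2 3 ..
qed

lemma Rel_closed: "Rel \<subseteq> carrier F"
proof
  fix x assume "x \<in> Rel"
  then consider f g where "x = \<delta> (f + g) \<ominus>\<^bsub>F\<^esub> (\<delta> f \<oplus>\<^bsub>F\<^esub> \<delta> g)"
    | f g where "x = \<delta> (f * g) \<ominus>\<^bsub>F\<^esub> (cls I f \<odot>\<^bsub>F\<^esub> \<delta> g \<oplus>\<^bsub>F\<^esub> cls I g \<odot>\<^bsub>F\<^esub> \<delta> f)"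
    | c where "x = \<delta> (const3 c)"
    unfolding Rel_eq by blast
  thus "x \<in> carrier F"
    by cases (simp_all add: F.M.minus_closed F.smult_closed)
qed

lemma N_eq: "N = F.span Rel"
  by (simp add: kaehler_submodule_def)

lemma Rel_N: "Rel \<subseteq> N"
  unfolding N_eq by (rule F.in_own_span[OF Rel_closed])

sublocale module_quotient R F N
proof (rule module_quotient.intro[OF module_free_module[OF cring_R]], rule module_quotient_axioms.intro)
  show "LinearCombinations.submodule R N F"
    unfolding N_eq by (rule F.span_is_submodule[OF Rel_closed])
qed

lemma kaehler_eq: "kaehler base_field R = Q"
  by (simp add: kaehler_def)

sublocale Q: Module.module R Q
  by (rule module_Q)

definition D :: "'k poly3 \<Rightarrow> ('k poly3 set \<Rightarrow> 'k poly3 set) set" where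
  "D f = co (\<delta> f)"

lemma kaehler_d_eq: "kaehler_d base_field R (cls I f) = D f"
  by (simp add: kaehler_d_def D_def)

lemma D_closed [simp]: "D f \<in> carrier Q"
  unfolding D_def by (rule co_closed) simp

lemma D_add: "D (f + g) = D f \<oplus>\<^bsub>Q\<^esub> D g"
proof -
  have "\<delta> (f + g) \<ominus>\<^bsub>F\<^esub> (\<delta> f \<oplus>\<^bsub>F\<^esub> \<delta> g) \<in> N" using Rel_N unfolding Rel_eq by blast
  hence "co (\<delta> (f + g)) = co (\<delta> f \<oplus>\<^bsub>F\<^esub> \<delta> g)" by (intro co_eqI) auto
  thus ?thesis by (simp add: D_def add_Q)
qed

lemma D_mult: "D (f * g) = cls I f \<odot>\<^bsub>Q\<^esub> D g \<oplus>\<^bsub>Q\<^esub> cls I g \<odot>\<^bsub>Q\<^esub> D f"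
proof -
  have "\<delta> (f * g) \<ominus>\<^bsub>F\<^esub> (cls I f \<odot>\<^bsub>F\<^esub> \<delta> g \<oplus>\<^bsub>F\<^esub> cls I g \<odot>\<^bsub>F\<^esub> \<delta> f) \<in> N" using Rel_N unfolding Rel_eq by blast
  hence "co (\<delta> (f * g)) = co (cls I f \<odot>\<^bsub>F\<^esub> \<delta> g \<oplus>\<^bsub>F\<^esub> cls I g \<odot>\<^bsub>F\<^esub> \<delta> f)" by (intro co_eqI) auto
  thus ?thesis by (simp add: D_def add_Q smult_Q)
qed

lemma D_const3: "D (const3 c) = \<zero>\<^bsub>Q\<^esub>"
proof -
  have "\<delta> (const3 c) \<in> N" using Rel_N unfolding Rel_eq by blast
  thus ?thesis unfolding D_def by (rule co_zero)
qed

text \<open>The arguments are triples of polynomials instead of elements of R, so that kernels and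
  dimensions are those of subspaces of S^3.\<close>

definition T :: "(3 \<Rightarrow> 'k poly3) \<Rightarrow> ('k poly3 set \<Rightarrow> 'k poly3 set) set" where
  "T b = (\<Oplus>\<^bsub>Q\<^esub>j\<in>UNIV. cls I (b j) \<odot>\<^bsub>Q\<^esub> D (var3 j))"

lemma T_closed [simp]: "T b \<in> carrier Q"
  unfolding T_def by (rule Q.M.finsum_closed) auto

lemma T_add: "T b \<oplus>\<^bsub>Q\<^esub> T b' = T (b + b')"
proof -
  have "T (b + b') = (\<Oplus>\<^bsub>Q\<^esub>j\<in>UNIV. cls I (b j) \<odot>\<^bsub>Q\<^esub> D (var3 j) \<oplus>\<^bsub>Q\<^esub> cls I (b' j) \<odot>\<^bsub>Q\<^esub> D (var3 j))"
    unfolding T_def by (intro Q.M.finsum_cong') (auto simp: add_coord_ring[OF I, symmetric] Q.smult_l_distr)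
  also have "\<dots> = T b \<oplus>\<^bsub>Q\<^esub> T b'" unfolding T_def by (rule Q.M.finsum_addf) auto
  finally show ?thesis ..
qed

lemma T_mult: "cls I f \<odot>\<^bsub>Q\<^esub> T b = T (\<lambda>j. f * b j)"
proof -
  have "cls I f \<odot>\<^bsub>Q\<^esub> T b = (\<Oplus>\<^bsub>Q\<^esub>j\<in>UNIV. cls I f \<odot>\<^bsub>Q\<^esub> (cls I (b j) \<odot>\<^bsub>Q\<^esub> D (var3 j)))"
    unfolding T_def by (rule Q.finsum_smult_ldistr) auto
  also have "\<dots> = T (\<lambda>j. f * b j)"
    unfolding T_def by (intro Q.M.finsum_cong') (auto simp: mult_coord_ring[OF I, symmetric] Q.smult_assoc1)
  finally show ?thesis .
qed

lemma T_cong: "(\<And>j. b j - b' j \<in> I) \<Longrightarrow> T b = T b'"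
proof -
  assume "\<And>j. b j - b' j \<in> I"
  hence "cls I (b j) = cls I (b' j)" for j by (simp add: cls_eq_iff[OF I])
  thus ?thesis unfolding T_def by (simp only:)
qed

lemma T_0: "T (\<lambda>_. 0) = \<zero>\<^bsub>Q\<^esub>"
  unfolding T_def using zero_coord_ring[OF I, symmetric]
  by (simp add: Q.M.finsum_zero)

definition grad :: "'k poly3 \<Rightarrow> 3 \<Rightarrow> 'k poly3" where
  "grad f = (\<lambda>j. partial3 j f)"

lemma grad_add: "grad (f + g) = grad f + grad g"
  by (auto simp: grad_def fun_eq_iff)

lemma grad_mult: "grad (f * g) = (\<lambda>j. f * grad g j) + (\<lambda>j. g * grad f j)"
  by (auto simp: grad_def fun_eq_iff)

text \<open>Both sides obey the sum and product rules, vanish on constants and agree on the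
  variables.\<close>

lemma D_eq_T: "D f = T (grad f)"
proof (induction f rule: poly3_induct)
  case (const c)
  show ?case by (simp add: D_const3 grad_def T_0)
next
  case (var i)
  have "T (grad (var3 i)) = (\<Oplus>\<^bsub>Q\<^esub>j\<in>UNIV. if i = j then D (var3 j) else \<zero>\<^bsub>Q\<^esub>)"
    unfolding T_def grad_def
    by (intro Q.M.finsum_cong')
      (auto simp: partial3_var3 one_coord_ring[OF I, symmetric] zero_coord_ring[OF I, symmetric])
  also have "\<dots> = D (var3 i)" by (rule Q.M.finsum_singleton) auto
  finally show ?case ..
next
  case (add f g)
  show ?case by (simp only: D_add add T_add grad_add)
next
  case (mult f g)
  show ?case by (simp only: D_mult mult T_mult T_add grad_mult)
qed

text \<open>Triples congruent modulo I to the gradient of an element of I. This turns out to be the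
  kernel of \<open>T\<close>.\<close>

definition E :: "(3 \<Rightarrow> 'k poly3) set" where
  "E = {b. \<exists>f\<in>I. \<forall>j. b j - partial3 j f \<in> I}"

lemma T_E:
  assumes "b \<in> E"
  shows "T b = \<zero>\<^bsub>Q\<^esub>"
proof -
  obtain f where f: "f \<in> I" "\<And>j. b j - partial3 j f \<in> I" using assms by (auto simp: E_def)
  have "T b = T (grad f)" by (rule T_cong) (use f(2) in \<open>simp add: grad_def\<close>)
  also have "\<dots> = D f" by (simp add: D_eq_T)
  also have "cls I f = cls I 0" using f(1) by (simp add: cls_eq_iff[OF I])
  hence "D f = D (const3 0)" by (simp add: D_def)
  finally show ?thesis by (simp only: D_const3)
qed

lemma E_0: "(\<lambda>_. 0) \<in> E"
  using ideal_poly3_0[OF I] by (auto simp: E_def intro!: bexI[of _ 0])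

lemma E_add: "b \<in> E \<Longrightarrow> b' \<in> E \<Longrightarrow> b + b' \<in> E"
proof -
  assume "b \<in> E" "b' \<in> E"
  then obtain f f' where "f \<in> I" "f' \<in> I" "\<And>j. b j - partial3 j f \<in> I" "\<And>j. b' j - partial3 j f' \<in> I"
    by (auto simp: E_def)
  hence "f + f' \<in> I" "\<And>j. (b j - partial3 j f) + (b' j - partial3 j f') \<in> I"
    using ideal_poly3_add[OF I] by blast+
  hence "f + f' \<in> I" "\<forall>j. (b + b') j - partial3 j (f + f') \<in> I"
    by (simp_all add: algebra_simps)
  thus ?thesis unfolding E_def by blast
qed

text \<open>The gradient is not linear over S, but g grad f = grad (g f) - f grad g, and the last
  term has entries in I.\<close>

lemma E_mult: "b \<in> E \<Longrightarrow> (\<lambda>j. g * b j) \<in> E"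
proof -
  assume "b \<in> E"
  then obtain f where f: "f \<in> I" "\<And>j. b j - partial3 j f \<in> I" by (auto simp: E_def)
  have "g * f \<in> I" using ideal_poly3_mult[OF I f(1)] .
  moreover have "g * b j - partial3 j (g * f) \<in> I" for j
  proof -
    have "g * (b j - partial3 j f) - partial3 j g * f \<in> I"
      by (intro ideal_poly3_diff[OF I] ideal_poly3_mult[OF I] f)
    thus ?thesis by (simp add: algebra_simps)
  qed
  ultimately show ?thesis unfolding E_def by blast
qed

lemma E_I: "(\<And>j. b j \<in> I) \<Longrightarrow> b \<in> E"
  using ideal_poly3_0[OF I] by (auto simp: E_def intro!: bexI[of _ 0])

lemma E_grad: "f \<in> I \<Longrightarrow> grad f \<in> E"
  using ideal_poly3_0[OF I] by (auto simp: E_def grad_def intro!: bexI[of _ f])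

definition rep :: "'k poly3 set \<Rightarrow> 'k poly3" where
  "rep a = (SOME f. cls I f = a)"

lemma rep: "a \<in> carrier R \<Longrightarrow> cls I (rep a) = a"
  unfolding rep_def carrier_coord_ring[OF I] by (rule someI_ex) auto

lemma rep_cls: "rep (cls I f) - f \<in> I"
  using rep[of "cls I f"] by (simp add: cls_eq_iff[OF I])

definition supp :: "('k poly3 set \<Rightarrow> 'k poly3 set) \<Rightarrow> 'k poly3 set set" where
  "supp \<phi> = {a \<in> carrier R. \<phi> a \<noteq> \<zero>\<^bsub>R\<^esub>}"

text \<open>The inverse of the presentation \<open>T\<close>, on the free module: \<open>da\<close> is sent to the gradient of a representative
  of \<open>a\<close>. The map is linear only modulo \<open>E\<close>.\<close>

definition lift :: "('k poly3 set \<Rightarrow> 'k poly3 set) \<Rightarrow> 3 \<Rightarrow> 'k poly3" where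
  "lift \<phi> = (\<lambda>j. \<Sum>a\<in>supp \<phi>. rep (\<phi> a) * partial3 j (rep a))"

lemma E_minus: "b \<in> E \<Longrightarrow> - b \<in> E"
  using E_mult[of b "- 1"] by (simp add: fun_Compl_def)

lemma E_diff: "b \<in> E \<Longrightarrow> b' \<in> E \<Longrightarrow> b - b' \<in> E"
  using E_add[OF _ E_minus, of b b'] by simp

lemma carrier_F: "\<phi> \<in> carrier F \<longleftrightarrow> \<phi> \<in> carrier R \<rightarrow>\<^sub>E carrier R \<and> finite (supp \<phi>)"
  unfolding carrier_free_module[OF cring_R] supp_def by simp

text \<open>The chosen representative of the zero class is some element of I and may be nonzero, so
  enlarging the index set changes the sum by an element of I.\<close>

lemma lift_superset:
  assumes "\<phi> \<in> carrier F" "finite A" "supp \<phi> \<subseteq> A" "A \<subseteq> carrier R"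
  shows "(\<Sum>a\<in>A. rep (\<phi> a) * partial3 j (rep a)) - lift \<phi> j \<in> I"
proof -
  have "(\<Sum>a\<in>A. rep (\<phi> a) * partial3 j (rep a)) = (\<Sum>a\<in>A - supp \<phi>. rep (\<phi> a) * partial3 j (rep a)) + lift \<phi> j"
    unfolding lift_def using assms by (intro sum.subset_diff) auto
  moreover have "(\<Sum>a\<in>A - supp \<phi>. rep (\<phi> a) * partial3 j (rep a)) \<in> I"
  proof (rule ideal_poly3_sum[OF I])
    fix a assume "a \<in> A - supp \<phi>"
    hence "\<phi> a = cls I 0" using assms(4) by (auto simp: supp_def zero_coord_ring[OF I])
    hence "rep (\<phi> a) \<in> I" using rep_cls[of 0] by simp
    thus "rep (\<phi> a) * partial3 j (rep a) \<in> I" by (rule ideal_poly3_mult'[OF I])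
  qed
  ultimately show ?thesis by simp
qed

lemma lift_add:
  assumes x: "x \<in> carrier F" and y: "y \<in> carrier F"
  shows "lift (x \<oplus>\<^bsub>F\<^esub> y) - (lift x + lift y) \<in> E"
proof (rule E_I)
  fix j
  let ?A = "supp x \<union> supp y"
  let ?z = "x \<oplus>\<^bsub>F\<^esub> y"
  let ?s = "\<lambda>\<phi>. \<Sum>a\<in>?A. rep (\<phi> a) * partial3 j (rep a)"
  have z: "?z \<in> carrier F" using x y by simp
  have za: "?z a = x a \<oplus>\<^bsub>R\<^esub> y a" if "a \<in> carrier R" for a
    using that by (simp add: add_free_module[OF cring_R])
  have xa: "x a \<in> carrier R" "y a \<in> carrier R" if "a \<in> carrier R" for a
    using x y that by (auto simp: carrier_F)
  have A: "finite ?A" "?A \<subseteq> carrier R" using x y by (auto simp: carrier_F supp_def)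
  interpret RR: cring R by (rule cring_R)
  have "supp ?z \<subseteq> ?A" using za by (auto simp: supp_def)
  hence 1: "?s ?z - lift ?z j \<in> I" "?s x - lift x j \<in> I" "?s y - lift y j \<in> I"
    using lift_superset[OF z A(1) _ A(2)] lift_superset[OF x A(1) _ A(2)] lift_superset[OF y A(1) _ A(2)] by blast+
  have 2: "?s ?z - (?s x + ?s y) \<in> I"
  proof -
    have "?s ?z - (?s x + ?s y) = (\<Sum>a\<in>?A. (rep (?z a) - (rep (x a) + rep (y a))) * partial3 j (rep a))"
      by (simp add: sum.distrib sum_subtractf algebra_simps)
    also have "\<dots> \<in> I"
    proof (intro ideal_poly3_sum[OF I] ideal_poly3_mult'[OF I])
      fix a assume "a \<in> ?A"
      hence a: "a \<in> carrier R" using A by blast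
      have "cls I (rep (x a) + rep (y a)) = ?z a"
        using rep[OF xa(1)[OF a]] rep[OF xa(2)[OF a]] za[OF a] add_coord_ring[OF I, of "rep (x a)" "rep (y a)"] by simp
      thus "rep (?z a) - (rep (x a) + rep (y a)) \<in> I" using rep_cls by metis
    qed
    finally show ?thesis .
  qed
  have "(?s x - lift x j) + (?s y - lift y j) - (?s ?z - lift ?z j) + (?s ?z - (?s x + ?s y)) \<in> I"
    by (intro ideal_poly3_add[OF I] ideal_poly3_diff[OF I] 1 2)
  thus "(lift ?z - (lift x + lift y)) j \<in> I" by (simp add: algebra_simps)
qed

lemma lift_smult:
  assumes x: "x \<in> carrier F"
  shows "lift (cls I f \<odot>\<^bsub>F\<^esub> x) - (\<lambda>j. f * lift x j) \<in> E"
proof (rule E_I)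
  fix j
  let ?z = "cls I f \<odot>\<^bsub>F\<^esub> x"
  let ?s = "\<lambda>\<phi>. \<Sum>a\<in>supp x. rep (\<phi> a) * partial3 j (rep a)"
  have z: "?z \<in> carrier F" using x by simp
  have za: "?z a = cls I f \<otimes>\<^bsub>R\<^esub> x a" if "a \<in> carrier R" for a
    using that by (simp add: smult_free_module[OF cring_R])
  have xa: "x a \<in> carrier R" if "a \<in> carrier R" for a
    using x that by (auto simp: carrier_F)
  have A: "finite (supp x)" "supp x \<subseteq> carrier R" using x by (auto simp: carrier_F supp_def)
  interpret RR: cring R by (rule cring_R)
  have "supp ?z \<subseteq> supp x" using za by (auto simp: supp_def)
  hence 1: "?s ?z - lift ?z j \<in> I" using lift_superset[OF z A(1) _ A(2)] by blast
  have 2: "?s ?z - f * ?s x \<in> I"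
  proof -
    have "?s ?z - f * ?s x = (\<Sum>a\<in>supp x. (rep (?z a) - f * rep (x a)) * partial3 j (rep a))"
      by (simp add: sum_distrib_left sum_subtractf algebra_simps)
    also have "\<dots> \<in> I"
    proof (intro ideal_poly3_sum[OF I] ideal_poly3_mult'[OF I])
      fix a assume "a \<in> supp x"
      hence a: "a \<in> carrier R" using A by blast
      have "cls I (f * rep (x a)) = ?z a"
        using rep[OF xa[OF a]] za[OF a] mult_coord_ring[OF I, of f "rep (x a)"] by simp
      thus "rep (?z a) - f * rep (x a) \<in> I" using rep_cls by metis
    qed
    finally show ?thesis .
  qed
  have "(?s ?z - f * ?s x) - (?s ?z - lift ?z j) \<in> I"
    by (intro ideal_poly3_diff[OF I] 1 2)
  thus "(lift ?z - (\<lambda>j. f * lift x j)) j \<in> I" by (simp add: lift_def)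
qed

text \<open>The chosen representative of the class of f differs from f by an element of I, whose
  gradient lies in E. It is for this reason that the gradients of I are part of E.\<close>

lemma lift_gen: "lift (\<delta> f) - grad f \<in> E"
proof -
  let ?a = "cls I f"
  have "lift (\<delta> f) - grad (rep ?a) \<in> E"
  proof (rule E_I)
    fix j
    have sub: "supp (\<delta> f) \<subseteq> {?a}" by (auto simp: supp_def free_gen_def split: if_splits)
    have 1: "(\<Sum>a\<in>{?a}. rep (\<delta> f a) * partial3 j (rep a)) - lift (\<delta> f) j \<in> I"
      by (rule lift_superset) (use sub in auto)
    have "\<delta> f ?a = cls I 1" by (simp add: free_gen_def one_coord_ring[OF I])
    hence "rep (\<delta> f ?a) - 1 \<in> I" using rep_cls[of 1] by simp
    hence 2: "(rep (\<delta> f ?a) - 1) * partial3 j (rep ?a) \<in> I" by (rule ideal_poly3_mult'[OF I])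
    have "(rep (\<delta> f ?a) - 1) * partial3 j (rep ?a) - ((\<Sum>a\<in>{?a}. rep (\<delta> f a) * partial3 j (rep a)) - lift (\<delta> f) j) \<in> I"
      by (rule ideal_poly3_diff[OF I 2 1])
    thus "(lift (\<delta> f) - grad (rep ?a)) j \<in> I" by (simp add: grad_def algebra_simps)
  qed
  moreover have "grad (rep ?a - f) \<in> E" by (rule E_grad[OF rep_cls])
  ultimately have "(lift (\<delta> f) - grad (rep ?a)) + grad (rep ?a - f) \<in> E" by (rule E_add)
  moreover have "(lift (\<delta> f) - grad (rep ?a)) + grad (rep ?a - f) = lift (\<delta> f) - grad f"
    by (auto simp: grad_def fun_eq_iff)
  ultimately show ?thesis by simp
qed

definition cong_E :: "(3 \<Rightarrow> 'k poly3) \<Rightarrow> (3 \<Rightarrow> 'k poly3) \<Rightarrow> bool" (infix "\<approx>" 50) where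
  "b \<approx> b' \<longleftrightarrow> b - b' \<in> E"

lemma cong_E_refl: "b \<approx> b"
  using E_0 by (simp add: cong_E_def zero_fun_def)

lemma cong_E_trans: "a \<approx> b \<Longrightarrow> b \<approx> c \<Longrightarrow> a \<approx> c"
  unfolding cong_E_def using E_add[of "a - b" "b - c"] by simp

lemma cong_E_sym: "a \<approx> b \<Longrightarrow> b \<approx> a"
  unfolding cong_E_def using E_minus[of "a - b"] by simp

lemma cong_E_add: "a \<approx> b \<Longrightarrow> c \<approx> d \<Longrightarrow> a + c \<approx> b + d"
  unfolding cong_E_def using E_add[of "a - b" "c - d"] by (simp add: algebra_simps)

lemma cong_E_mult: "a \<approx> b \<Longrightarrow> (\<lambda>j. f * a j) \<approx> (\<lambda>j. f * b j)"
  unfolding cong_E_def using E_mult[of "a - b" f]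
  by (simp add: fun_diff_def right_diff_distrib)

lemma cong_E_E: "a \<approx> b \<Longrightarrow> a \<in> E \<longleftrightarrow> b \<in> E"
  using E_add[of "a - b" b] E_diff[of a "a - b"] unfolding cong_E_def by auto

lemma lift_add': "x \<in> carrier F \<Longrightarrow> y \<in> carrier F \<Longrightarrow> lift (x \<oplus>\<^bsub>F\<^esub> y) \<approx> lift x + lift y"
  unfolding cong_E_def by (rule lift_add)

lemma lift_smult': "x \<in> carrier F \<Longrightarrow> lift (cls I f \<odot>\<^bsub>F\<^esub> x) \<approx> (\<lambda>j. f * lift x j)"
  unfolding cong_E_def by (rule lift_smult)

lemma lift_gen': "lift (\<delta> f) \<approx> grad f"
  unfolding cong_E_def by (rule lift_gen)

lemma lift_diff:
  assumes "x \<in> carrier F" "y \<in> carrier F" "lift x \<approx> lift y"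
  shows "lift (x \<ominus>\<^bsub>F\<^esub> y) \<in> E"
proof -
  let ?z = "x \<ominus>\<^bsub>F\<^esub> y"
  have z: "?z \<in> carrier F" using assms by simp
  have "?z \<oplus>\<^bsub>F\<^esub> y = x" using assms by (simp add: a_minus_def F.M.a_assoc F.M.l_neg)
  hence "lift x \<approx> lift ?z + lift y" using lift_add'[OF z assms(2)] by simp
  hence "lift y \<approx> lift ?z + lift y" using cong_E_trans[OF cong_E_sym[OF assms(3)]] by blast
  from cong_E_sym[OF this] show ?thesis by (simp add: cong_E_def)
qed

text \<open>The elements whose lift lies in E form a submodule. The defining relations belong to it
  by the sum and product rules for the gradient, hence so does their span.\<close>

lemma lift_N: "x \<in> N \<Longrightarrow> lift x \<in> E"
proof -
  let ?M = "{x \<in> carrier F. lift x \<in> E}"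
  have "LinearCombinations.submodule R ?M F"
  proof (rule LinearCombinations.submodule.intro)
    show "Module.module R F" by (rule module_free_module[OF cring_R])
    show "v \<oplus>\<^bsub>F\<^esub> w \<in> ?M" if "v \<in> ?M" "w \<in> ?M" for v w
    proof -
      have vw: "v \<in> carrier F" "w \<in> carrier F" "lift v \<in> E" "lift w \<in> E" using that by simp_all
      have "lift (v \<oplus>\<^bsub>F\<^esub> w) \<in> E"
        by (subst cong_E_E[OF lift_add'[OF vw(1,2)]]) (rule E_add[OF vw(3,4)])
      thus ?thesis using vw by simp
    qed
    show "\<zero>\<^bsub>F\<^esub> \<in> ?M"
    proof -
      have "lift (\<zero>\<^bsub>F\<^esub> \<ominus>\<^bsub>F\<^esub> \<zero>\<^bsub>F\<^esub>) \<in> E" by (rule lift_diff) (auto intro: cong_E_refl)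
      thus ?thesis by (simp add: a_minus_def F.M.r_neg)
    qed
    show "c \<odot>\<^bsub>F\<^esub> v \<in> ?M" if c: "c \<in> carrier R" and v: "v \<in> ?M" for c v
    proof -
      obtain f where f: "c = cls I f" using c by (auto simp: carrier_coord_ring[OF I])
      have v': "v \<in> carrier F" "lift v \<in> E" using v by simp_all
      have "lift (c \<odot>\<^bsub>F\<^esub> v) \<in> E"
        unfolding f by (subst cong_E_E[OF lift_smult'[OF v'(1)]]) (rule E_mult[OF v'(2)])
      thus ?thesis using v' c by simp
    qed
  qed auto
  moreover have "Rel \<subseteq> ?M"
  proof
    fix x assume "x \<in> Rel"
    then consider f g where "x = \<delta> (f + g) \<ominus>\<^bsub>F\<^esub> (\<delta> f \<oplus>\<^bsub>F\<^esub> \<delta> g)"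
      | f g where "x = \<delta> (f * g) \<ominus>\<^bsub>F\<^esub> (cls I f \<odot>\<^bsub>F\<^esub> \<delta> g \<oplus>\<^bsub>F\<^esub> cls I g \<odot>\<^bsub>F\<^esub> \<delta> f)"
      | c where "x = \<delta> (const3 c)"
      unfolding Rel_eq by blast
    hence "lift x \<in> E"
    proof cases
      case (1 f g)
      have "lift (\<delta> f \<oplus>\<^bsub>F\<^esub> \<delta> g) \<approx> lift (\<delta> f) + lift (\<delta> g)" by (rule lift_add') simp_all
      from cong_E_trans[OF this cong_E_add[OF lift_gen' lift_gen']]
      have "lift (\<delta> f \<oplus>\<^bsub>F\<^esub> \<delta> g) \<approx> grad f + grad g" .
      from cong_E_sym[OF this] have "grad (f + g) \<approx> lift (\<delta> f \<oplus>\<^bsub>F\<^esub> \<delta> g)"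
        by (simp only: grad_add)
      hence "lift (\<delta> (f + g)) \<approx> lift (\<delta> f \<oplus>\<^bsub>F\<^esub> \<delta> g)"
        by (rule cong_E_trans[OF lift_gen'])
      thus ?thesis unfolding 1 by (intro lift_diff) simp_all
    next
      case (2 f g)
      let ?y = "cls I f \<odot>\<^bsub>F\<^esub> \<delta> g \<oplus>\<^bsub>F\<^esub> cls I g \<odot>\<^bsub>F\<^esub> \<delta> f"
      have sm: "lift (cls I f \<odot>\<^bsub>F\<^esub> \<delta> g) \<approx> (\<lambda>j. f * grad g j)" for f g
        by (rule cong_E_trans[OF lift_smult' cong_E_mult[OF lift_gen']]) simp
      have "lift ?y \<approx> lift (cls I f \<odot>\<^bsub>F\<^esub> \<delta> g) + lift (cls I g \<odot>\<^bsub>F\<^esub> \<delta> f)"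
        by (rule lift_add') simp_all
      from cong_E_trans[OF this cong_E_add[OF sm sm]]
      have "lift ?y \<approx> (\<lambda>j. f * grad g j) + (\<lambda>j. g * grad f j)" .
      from cong_E_sym[OF this] have "grad (f * g) \<approx> lift ?y"
        by (simp only: grad_mult)
      hence "lift (\<delta> (f * g)) \<approx> lift ?y"
        by (rule cong_E_trans[OF lift_gen'])
      thus ?thesis unfolding 2 by (intro lift_diff) simp_all
    next
      case (3 c)
      have "grad (const3 c) = 0" by (auto simp: grad_def fun_eq_iff)
      from lift_gen[of "const3 c", unfolded this diff_0_right] show ?thesis unfolding 3 .
    qed
    moreover have "x \<in> carrier F" using \<open>x \<in> Rel\<close> Rel_closed by (rule rev_subsetD)
    ultimately show "x \<in> ?M" by (intro CollectI conjI)
  qed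
  ultimately have s: "F.span Rel \<subseteq> ?M" by (rule F.span_is_subset[rotated])
  assume "x \<in> N"
  hence "x \<in> ?M" unfolding N_eq by (rule subsetD[OF s])
  thus "lift x \<in> E" by simp
qed

text \<open>If T b = 0, the combination of the symbols \<open>\<delta> (var3 j)\<close> with
  coefficients b_j lies in the span of the relations, so its lift lies in E. But this lift is
  congruent to b modulo E.\<close>

lemma T_eq_0_iff: "T b = \<zero>\<^bsub>Q\<^esub> \<longleftrightarrow> b \<in> E"
proof
  assume T: "T b = \<zero>\<^bsub>Q\<^esub>"
  define G where "G j = cls I (b j) \<odot>\<^bsub>F\<^esub> \<delta> (var3 j)" for j
  have Gc: "G j \<in> carrier F" for j unfolding G_def by simp
  have coG: "cls I (b j) \<odot>\<^bsub>Q\<^esub> D (var3 j) = co (G j)" for j unfolding G_def D_def by (rule smult_Q) simp_all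
  have cQ: "co (G j) \<in> carrier Q" for j by (rule co_closed[OF Gc])
  let ?G = "G 0 \<oplus>\<^bsub>F\<^esub> (G 1 \<oplus>\<^bsub>F\<^esub> G 2)"
  have "T b = co (G 0) \<oplus>\<^bsub>Q\<^esub> (co (G 1) \<oplus>\<^bsub>Q\<^esub> co (G 2))"
    unfolding T_def coG UNIV_3
    by (simp add: Q.M.finsum_insert cQ)
  also have "\<dots> = co ?G" using Gc by (simp add: add_Q)
  finally have "co ?G = \<zero>\<^bsub>Q\<^esub>" unfolding T by (rule sym)
  hence "?G \<in> N" by (intro co_eq_zeroD) (simp_all add: Gc)
  hence 1: "lift ?G \<in> E" by (rule lift_N)
  have G: "lift (G j) \<approx> (\<lambda>k. b j * grad (var3 j) k)" for j
    unfolding G_def by (rule cong_E_trans[OF lift_smult' cong_E_mult[OF lift_gen']]) simp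
  have 2: "lift (G 1 \<oplus>\<^bsub>F\<^esub> G 2) \<approx> (\<lambda>k. b 1 * grad (var3 1) k) + (\<lambda>k. b 2 * grad (var3 2) k)"
    by (rule cong_E_trans[OF lift_add'[OF Gc Gc] cong_E_add[OF G G]])
  have 3: "lift ?G \<approx> (\<lambda>k. b 0 * grad (var3 0) k) + ((\<lambda>k. b 1 * grad (var3 1) k) + (\<lambda>k. b 2 * grad (var3 2) k))"
    by (rule cong_E_trans[OF lift_add'[OF Gc] cong_E_add[OF G 2]]) (simp add: Gc)
  have 4: "(\<lambda>k. b 0 * grad (var3 0) k) + ((\<lambda>k. b 1 * grad (var3 1) k) + (\<lambda>k. b 2 * grad (var3 2) k)) = b"
  proof
    fix k :: 3
    have "k \<in> {0, 1, 2}" unfolding UNIV_3[symmetric] by simp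
    hence "k = 0 \<or> k = 1 \<or> k = 2" by simp
    thus "((\<lambda>k. b 0 * grad (var3 0) k) + ((\<lambda>k. b 1 * grad (var3 1) k) + (\<lambda>k. b 2 * grad (var3 2) k))) k = b k"
      by (elim disjE) (simp_all add: grad_def partial3_var3)
  qed
  from 1 show "b \<in> E" by (simp only: cong_E_E[OF 3[unfolded 4]])
qed (rule T_E)

lemma T_eq_iff: "T b = T b' \<longleftrightarrow> b - b' \<in> E"
proof -
  have "T (b - b') \<oplus>\<^bsub>Q\<^esub> T b' = T b" unfolding T_add by simp
  moreover have "x = \<zero>\<^bsub>Q\<^esub>" if "x \<in> carrier Q" "x \<oplus>\<^bsub>Q\<^esub> y = y" "y \<in> carrier Q" for x y
    using that Q.M.add.right_cancel[of y x "\<zero>\<^bsub>Q\<^esub>"] by simp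
  ultimately have "T b = T b' \<longleftrightarrow> T (b - b') = \<zero>\<^bsub>Q\<^esub>"
    using Q.M.l_zero[OF T_closed, of b'] T_closed by metis
  thus ?thesis by (simp only: T_eq_0_iff)
qed

end

text \<open>Rank-nullity splits off one coordinate at a time.\<close>

lemma
  fixes S :: "'k::field poly3 set"
  assumes S: "fin_subspace scale3 S"
  shows fin_subspace_triples: "fin_subspace scaleF {b. \<forall>j. b j \<in> S}"
    and dim_triples: "vF.dim {b. \<forall>j. b j \<in> S} = 3 * v3.dim S"
proof -
  note sX = v3.fin_subspace_subspace[OF S]
  let ?U = "{b. \<forall>j. b j \<in> S} :: (3 \<Rightarrow> 'k poly3) set"
  define emb where "emb k f = (\<lambda>j. if j = k then f else 0)" for k :: 3 and f :: "'k poly3"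
  have emb: "Vector_Spaces.linear scale3 scaleF (emb k)" for k
    by unfold_locales (auto simp: emb_def scaleF_def fun_eq_iff)
  have proj: "Vector_Spaces.linear scaleF scale3 (\<lambda>b. b k)" for k :: 3
    by unfold_locales (auto simp: scaleF_def)
  have sU: "vF.subspace ?U"
    by (rule vF.subspaceI) (auto simp: scaleF_def v3.subspace_0[OF sX] v3.subspace_add[OF sX] v3.subspace_scale[OF sX])
  from S obtain W where W: "finite W" "S \<subseteq> v3.span W" by (auto simp: fin_subspace_def)
  show fU: "fin_subspace scaleF ?U"
  proof (rule vF.fin_subspaceI[OF sU])
    show "finite (\<Union>k\<in>UNIV. emb k ` W)" using W by simp
    show "?U \<subseteq> vF.span (\<Union>k\<in>UNIV. emb k ` W)"
    proof
      fix b assume b: "b \<in> ?U"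
      have "emb k (b k) \<in> vF.span (\<Union>k\<in>UNIV. emb k ` W)" for k
      proof -
        interpret Vector_Spaces.linear scale3 scaleF "emb k" by (rule emb)
        have "b k \<in> v3.span W" using b W(2) by auto
        hence "emb k (b k) \<in> vF.span (emb k ` W)" using span_image[of W] by blast
        moreover have "vF.span (emb k ` W) \<subseteq> vF.span (\<Union>k\<in>UNIV. emb k ` W)"
          by (rule vF.span_mono) blast
        ultimately show ?thesis by blast
      qed
      hence "emb 0 (b 0) + emb 1 (b 1) + emb 2 (b 2) \<in> vF.span (\<Union>k\<in>UNIV. emb k ` W)"
        by (intro vF.span_add)
      moreover have "emb 0 (b 0) + emb 1 (b 1) + emb 2 (b 2) = b"
        unfolding fun_eq_iff forall_3 by (simp add: emb_def)
      ultimately show "b \<in> vF.span (\<Union>k\<in>UNIV. emb k ` W)" by simp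
    qed
  qed
  let ?U1 = "{b\<in>?U. b 0 = 0}" and ?U2 = "{b\<in>{b\<in>?U. b 0 = 0}. b 1 = 0}"
  have s1: "vF.subspace ?U1"
    using sU by (intro vF.subspaceI) (auto simp: vF.subspace_def scaleF_def)
  have f1: "fin_subspace scaleF ?U1" by (rule vF.fin_subspace_subset[OF fU s1]) auto
  have s2: "vF.subspace ?U2"
    using s1 by (intro vF.subspaceI) (auto simp: vF.subspace_def scaleF_def)
  have f2: "fin_subspace scaleF ?U2" by (rule vF.fin_subspace_subset[OF fU s2]) auto
  have i0: "(\<lambda>b. b 0) ` ?U = S"
  proof -
    have "f \<in> (\<lambda>b. b 0) ` ?U" if "f \<in> S" for f
      by (rule image_eqI[of _ _ "emb 0 f"]) (use that v3.subspace_0[OF sX] in \<open>auto simp: emb_def\<close>)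
    thus ?thesis by auto
  qed
  have i1: "(\<lambda>b. b 1) ` ?U1 = S"
  proof -
    have "f \<in> (\<lambda>b. b 1) ` ?U1" if "f \<in> S" for f
      by (rule image_eqI[of _ _ "emb 1 f"]) (use that v3.subspace_0[OF sX] in \<open>auto simp: emb_def\<close>)
    thus ?thesis by auto
  qed
  have i2: "(\<lambda>b. b 2) ` ?U2 = S"
  proof -
    have "f \<in> (\<lambda>b. b 2) ` ?U2" if "f \<in> S" for f
      by (rule image_eqI[of _ _ "emb 2 f"]) (use that v3.subspace_0[OF sX] in \<open>auto simp: emb_def\<close>)
    thus ?thesis by auto
  qed
  have "vF.dim ?U = v3.dim S + vF.dim ?U1"
    using vF3.dim_kernel_image[OF proj fU, of 0] by (simp only: i0)
  moreover have "vF.dim ?U1 = v3.dim S + vF.dim ?U2"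
    using vF3.dim_kernel_image[OF proj f1, of 1] by (simp only: i1)
  moreover have "v3.dim ((\<lambda>b. b 2) ` ?U2) = vF.dim ?U2"
  proof (rule vF3.dim_image_inj[OF proj f2])
    fix b :: "3 \<Rightarrow> 'k poly3" assume "b \<in> ?U2" "b 2 = 0"
    thus "b = 0" unfolding fun_eq_iff forall_3 by simp
  qed
  ultimately show "vF.dim ?U = 3 * v3.dim S" by (simp only: i2)
qed

context coord_quotient begin

lemma linear_grad: "Vector_Spaces.linear scale3 scaleF grad"
  by unfold_locales (auto simp: grad_def scale3_def scaleF_def fun_eq_iff)

lemma subspace_E: "vF.subspace E"
proof (rule vF.subspaceI)
  show "0 \<in> E" using E_0 by (simp add: zero_fun_def)
  show "scaleF c b \<in> E" if "b \<in> E" for c b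
    using E_mult[OF that, of "const3 c"] by (simp add: scaleF_def scale3_def)
qed (rule E_add)

text \<open>The gradient lowers degrees by one and I is homogeneous, so for a triple of forms of
  degree i - 1 the witness f in the definition of E can be replaced by its component of degree
  i.\<close>

lemma E_forms:
  "{b. \<forall>j. b j \<in> forms (i - 1)} \<inter> E =
    {a + b | a b. a \<in> {b. \<forall>j. b j \<in> forms (i - 1) \<inter> I} \<and> b \<in> grad ` (forms i \<inter> I)}"
proof (intro equalityI subsetI)
  fix b assume b: "b \<in> {b. \<forall>j. b j \<in> forms (i - 1)} \<inter> E"
  then obtain f where f: "f \<in> I" "\<And>j. b j - partial3 j f \<in> I" by (auto simp: E_def)
  let ?g = "hcomp i f"
  have g: "?g \<in> forms i \<inter> I" using f(1) I_hom by (simp add: hom_ideal_def homogeneous3_hcomp)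
  have "b j - partial3 j ?g = hcomp (i - 1) (b j - partial3 j f)" for j
    using b by (simp add: hcomp_diff hcomp_partial3 hcomp_homogeneous[of "i - 1"])
  hence "b j - partial3 j ?g \<in> forms (i - 1) \<inter> I" for j
    using f(2)[of j] I_hom by (simp add: hom_ideal_def homogeneous3_hcomp)
  hence "b - grad ?g \<in> {b. \<forall>j. b j \<in> forms (i - 1) \<inter> I}" by (simp add: grad_def)
  moreover have "b = (b - grad ?g) + grad ?g" by simp
  ultimately show "b \<in> {a + b | a b. a \<in> {b. \<forall>j. b j \<in> forms (i - 1) \<inter> I} \<and> b \<in> grad ` (forms i \<inter> I)}"
    using g by blast
next
  fix x assume "x \<in> {a + b | a b. a \<in> {b. \<forall>j. b j \<in> forms (i - 1) \<inter> I} \<and> b \<in> grad ` (forms i \<inter> I)}"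
  then obtain a f where x: "x = a + grad f" "\<And>j. a j \<in> forms (i - 1) \<inter> I" "f \<in> forms i \<inter> I" by blast
  have "a \<in> E" by (rule E_I) (use x(2) in blast)
  hence "x \<in> E" unfolding x(1) using x(3) by (intro E_add E_grad) simp_all
  moreover have "x j \<in> forms (i - 1)" for j
    using x by (simp add: grad_def homogeneous3_add homogeneous3_partial3)
  ultimately show "x \<in> {b. \<forall>j. b j \<in> forms (i - 1)} \<inter> E" by blast
qed

lemma HF_kaehler_quotient:
  "int (HF_kaehler I i) = int (vF.dim ({b. \<forall>j. b j \<in> forms (i - 1)} :: (3 \<Rightarrow> 'k poly3) set))
    - int (vF.dim ({b. \<forall>j. b j \<in> forms (i - 1)} \<inter> E))"
  unfolding HF_kaehler_def kaehler_eq
proof (rule vF.vectorspace_dim_quotient[where T = T and U = "{b. \<forall>j. b j \<in> forms (i - 1)}"])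
  let ?U = "{b. \<forall>j. b j \<in> forms (i - 1)} :: (3 \<Rightarrow> 'k poly3) set"
  show fU: "fin_subspace scaleF ?U" by (rule fin_subspace_triples[OF fin_subspace_forms])
  note sU = vF.fin_subspace_subspace[OF fU]
  show "vF.subspace (?U \<inter> E)" by (intro vF.subspace_inter sU subspace_E)
  show "T x = T y \<longleftrightarrow> x - y \<in> ?U \<inter> E" if "x \<in> ?U" "y \<in> ?U" for x y
    using vF.subspace_diff[OF sU that] by (simp only: T_eq_iff Int_iff simp_thms)
  have deg: "kaehler_deg I i = {\<Oplus>\<^bsub>Q\<^esub>j\<in>UNIV. a j \<odot>\<^bsub>Q\<^esub> D (var3 j) | a. \<forall>j. a j \<in> coord_ring_deg I (i - 1)}"
    unfolding kaehler_deg_def Let_def kaehler_eq kaehler_d_eq ..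
  have "kaehler_deg I i = T ` ?U"
  proof (intro equalityI subsetI)
    fix x assume "x \<in> kaehler_deg I i"
    then obtain a where a: "x = (\<Oplus>\<^bsub>Q\<^esub>j\<in>UNIV. a j \<odot>\<^bsub>Q\<^esub> D (var3 j))" "\<forall>j. a j \<in> coord_ring_deg I (i - 1)"
      unfolding deg by (elim CollectE exE conjE)
    from a(2) have "\<forall>j. \<exists>f. a j = cls I f \<and> homogeneous3 (i - 1) f" by (auto simp: coord_ring_deg_def)
    then obtain b where b: "\<And>j. a j = cls I (b j)" "\<And>j. homogeneous3 (i - 1) (b j)" by metis
    have "x = T b" unfolding T_def a(1) b(1) ..
    thus "x \<in> T ` ?U" using b(2) by simp
  next
    fix x assume "x \<in> T ` ?U"
    then obtain b where b: "x = T b" "\<forall>j. homogeneous3 (i - 1) (b j)" by auto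
    have "\<forall>j. cls I (b j) \<in> coord_ring_deg I (i - 1)" using b(2) by (auto simp: coord_ring_deg_def)
    thus "x \<in> kaehler_deg I i"
      unfolding deg b(1) T_def by (intro CollectI exI[of _ "\<lambda>j. cls I (b j)"] conjI refl)
  qed
  thus "carrier (restrict_scalars R Q\<lparr>carrier := kaehler_deg I i\<rparr>) = T ` ?U" by simp
  show "T x \<oplus>\<^bsub>restrict_scalars R Q\<lparr>carrier := kaehler_deg I i\<rparr>\<^esub> T y = T (x + y)" for x y
    by (simp add: restrict_scalars_def T_add)
  show "c \<odot>\<^bsub>restrict_scalars R Q\<lparr>carrier := kaehler_deg I i\<rparr>\<^esub> T x = T (scaleF c x)" for c x
    by (simp add: restrict_scalars_def one_coord_ring[OF I] smult_coord_ring[OF I] T_mult scaleF_def scale3_def)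
  show "\<zero>\<^bsub>restrict_scalars R Q\<lparr>carrier := kaehler_deg I i\<rparr>\<^esub> = T 0"
    by (simp add: restrict_scalars_def T_0[symmetric] zero_fun_def)
qed auto

text \<open>The relations in degree i are the sum of the triples in I and the gradients of I. The
  two summands meet in the gradients of those f for which all partial derivatives lie in I. The
  kernel of the gradient enters the dimension formula twice, with opposite signs, and
  cancels.\<close>

theorem HF_kaehler_eq:
  "int (HF_kaehler I i) = 3 * int (HF I (i - 1)) - int (v3.dim (forms i \<inter> I))
    + int (v3.dim {f \<in> forms i \<inter> I. \<forall>j. partial3 j f \<in> I})"
proof -
  let ?U = "{b. \<forall>j. b j \<in> forms (i - 1)} :: (3 \<Rightarrow> 'k poly3) set"
  let ?A = "{b. \<forall>j. b j \<in> forms (i - 1) \<inter> I}" and ?B = "grad ` (forms i \<inter> I)"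
  let ?V = "{f \<in> forms i \<inter> I. \<forall>j. partial3 j f \<in> I}"
  interpret grad: Vector_Spaces.linear scale3 scaleF grad by (rule linear_grad)
  have sI: "v3.subspace (forms k \<inter> I)" for k by (intro v3.subspace_inter subspace_forms subspace_ideal I)
  have fI: "fin_subspace scale3 (forms k \<inter> I)" for k by (rule fin_subspace_forms_subset[OF sI, of k]) (rule Int_lower1)
  have fA: "fin_subspace scaleF ?A" by (rule fin_subspace_triples[OF fI])
  have fU: "fin_subspace scaleF ?U" by (rule fin_subspace_triples[OF fin_subspace_forms])
  have sV: "v3.subspace ?V"
    using sI[of i] subspace_ideal[OF I] by (intro v3.subspaceI) (auto simp: v3.subspace_def scale3_def)
  have fV: "fin_subspace scale3 ?V" by (rule v3.fin_subspace_subset[OF fI[of i] sV]) auto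
  have AB: "?A \<inter> ?B = grad ` ?V"
  proof (intro equalityI subsetI)
    fix x assume "x \<in> ?A \<inter> ?B"
    then obtain f where "f \<in> forms i \<inter> I" "x = grad f" "\<forall>j. x j \<in> I" by blast
    thus "x \<in> grad ` ?V" by (auto simp: grad_def)
  next
    fix x assume "x \<in> grad ` ?V"
    thus "x \<in> ?A \<inter> ?B" by (auto simp: grad_def homogeneous3_partial3)
  qed
  have "vF.dim (?U \<inter> E) + vF.dim (?A \<inter> ?B) = vF.dim ?A + vF.dim ?B"
    unfolding E_forms
  proof (rule vF.dim_sum_Int[OF fU])
    show "vF.subspace ?A" by (rule vF.fin_subspace_subspace[OF fA])
    show "vF.subspace ?B" by (rule grad.subspace_image[OF sI])
    show "?B \<subseteq> ?U" by (auto simp: grad_def homogeneous3_partial3)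
  qed auto
  moreover have "v3.dim (forms i \<inter> I) = vF.dim ?B + v3.dim {f \<in> forms i \<inter> I. grad f = 0}"
    by (rule v3F.dim_kernel_image[OF linear_grad fI])
  moreover have "v3.dim ?V = vF.dim (grad ` ?V) + v3.dim {f \<in> ?V. grad f = 0}"
    by (rule v3F.dim_kernel_image[OF linear_grad fV])
  moreover have "v3.dim {f \<in> ?V. grad f = 0} = v3.dim {f \<in> forms i \<inter> I. grad f = 0}"
  proof -
    have "partial3 j f \<in> I" if "grad f = 0" for f j
      using fun_cong[OF that, of j] ideal_poly3_0[OF I] by (simp add: grad_def)
    hence "{f \<in> ?V. grad f = 0} = {f \<in> forms i \<inter> I. grad f = 0}" by blast
    thus ?thesis by (simp only:)
  qed
  moreover have "vF.dim ?A = 3 * v3.dim (forms (i - 1) \<inter> I)" by (rule dim_triples[OF fI])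
  moreover have "vF.dim ?U = 3 * v3.dim (forms (i - 1) :: 'k poly3 set)" by (rule dim_triples[OF fin_subspace_forms])
  ultimately show ?thesis
    using HF_kaehler_quotient[of i] HF_eq[OF I, of "i - 1"] unfolding AB by linarith
qed

end

section \<open>Differentials of fat points on a conic: recursions, stationary values and the final
  case analysis\<close>

context points_on_conic begin

text \<open>The forms counted by the last term of \<open>HF_kaehler_eq\<close> are those with
  multiplicities m j + 1. Adding and subtracting dim S_i turns dimensions of ideals into Hilbert
  functions.\<close>

lemma HF_kaehler_fat:
  assumes m: "\<And>j. j \<in> {1..s} \<Longrightarrow> m j \<ge> 1"
  shows "int (HF_kaehler (fat_ideal s m P) i) =
    3 * int (HF (fat_ideal s m P) (i - 1)) + int (HF (fat_ideal s m P) i)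
      - int (HF (fat_ideal s (\<lambda>j. m j + 1) P) i)"
proof -
  let ?I = "fat_ideal s m P"
  interpret coord_quotient ?I by unfold_locales (rule hom_ideal_fat_ideal)
  have V: "{f \<in> forms i \<inter> ?I. \<forall>j. partial3 j f \<in> ?I} = fat (\<lambda>j. m j + 1) i"
  proof (intro equalityI subsetI)
    fix f assume "f \<in> {f \<in> forms i \<inter> ?I. \<forall>j. partial3 j f \<in> ?I}"
    hence f: "homogeneous3 i f" "f \<in> ?I" "\<And>j. partial3 j f \<in> ?I" by auto
    show "f \<in> fat (\<lambda>j. m j + 1) i"
    proof (cases "i < 0")
      case True
      hence "f = 0" using f(1) homogeneous3_neg by blast
      thus ?thesis using v3.subspace_0[OF subspace_fat] by simp
    next
      case False
      then obtain n where n: "i = int n" using nonneg_int_cases by (metis not_less)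
      show ?thesis
      proof (rule fatI[OF f(1)])
        fix k assume k: "k \<in> {1..s}"
        have I: "g \<in> point_power (P k) (m k)" if "g \<in> ?I" for g
          using that k unfolding fat_ideal_eq by blast
        have "f \<in> point_power (P k) (Suc (m k))"
        proof (rule point_power_SucD[where p = "P k"])
          show "P k 0 = 1" by (rule P0[OF k])
          show "homogeneous3 (int n) f" using f(1) n by simp
          show "f \<in> point_power (P k) (m k)" by (rule I[OF f(2)])
          show "partial3 j f \<in> point_power (P k) (m k)" for j by (rule I[OF f(3)])
          show "m k > 0" using m[OF k] by simp
        qed
        thus "f \<in> point_power (P k) (m k + 1)" by simp
      qed
    qed
  next
    fix f assume f: "f \<in> fat (\<lambda>j. m j + 1) i"
    have S: "f \<in> point_power (P k) (Suc (m k))" if "k \<in> {1..s}" for k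
      using fatD[OF f that] by simp
    have "homogeneous3 i f" using f by (simp add: fat_def)
    moreover have "f \<in> ?I" unfolding fat_ideal_eq
      using S point_power_antimono_Suc by blast
    moreover have "partial3 j f \<in> ?I" for j unfolding fat_ideal_eq
      using partial3_point_power[OF S] by blast
    ultimately show "f \<in> {f \<in> forms i \<inter> ?I. \<forall>j. partial3 j f \<in> ?I}" by simp
  qed
  show ?thesis
    using HF_kaehler_eq[of i] HF_fat[of m i] HF_fat[of "\<lambda>j. m j + 1" i]
    unfolding V fdim_def by (simp only: fat_def)
qed

end

lemma of_nat_choose_2: "(of_nat ((k + 1) choose 2) :: rat) = (of_nat k + 1) * of_nat k / 2"
  by (induction k) (simp_all add: numeral_2_eq_2 field_simps)

context points_on_conic begin

text \<open>The term 2 i + 1 = dim S_i - dim S_(i - 2) is the Hilbert function of the conic. Spaces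
  of forms of negative degree are 0, which covers i = 0 and i = 1.\<close>

lemma HF_conic:
  assumes m: "\<And>j. j \<in> {1..s} \<Longrightarrow> m j \<ge> 1" and i: "0 \<le> i" "2 * i < int ((\<Sum>j=1..s. m j) + s)"
  shows "int (HF (fat_ideal s (\<lambda>j. m j + 1) P) i) = 2 * i + 1 + int (HF (fat_ideal s m P) (i - 2))"
proof -
  obtain n where n: "i = int n" using i(1) nonneg_int_cases by blast
  have "(\<Sum>j=1..s. m j + 1) = (\<Sum>j=1..s. m j) + s" unfolding sum.distrib by simp
  hence "2 * n < (\<Sum>j=1..s. m j + 1)" using i(2) n by linarith
  hence "fdim (\<lambda>j. m j + 1) (int n) = fdim (\<lambda>j. m j + 1 - 1) (int n - 2)" by (intro conic_case) auto
  hence f: "fdim (\<lambda>j. m j + 1) i = fdim m (i - 2)" by (simp add: n)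
  have "int (v3.dim (forms (int n) :: 'k poly3 set)) =
      2 * int n + 1 + int (v3.dim (forms (int n - 2) :: 'k poly3 set))"
  proof (cases n)
    case 0
    thus ?thesis using dim_forms_Suc[where ?'k = 'k, of 0] dim_forms_neg[where ?'k = 'k, of "-1"]
        dim_forms_neg[where ?'k = 'k, of "-2"] by simp
  next
    case (Suc k)
    thus ?thesis using dim_forms_Suc[where ?'k = 'k, of "Suc k"] dim_forms_Suc[where ?'k = 'k, of k] by simp
  qed
  thus ?thesis using f HF_fat[of "\<lambda>j. m j + 1" i] HF_fat[of m "i - 2"] n by simp
qed

text \<open>The term i + 1 is the Hilbert function of a line. The raised multiplicities of the last
  two points add up to m s + m (s - 1) + 2 > i, as the Bezout argument requires, and lowering these
  two yields Y.\<close>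

lemma HF_line:
  assumes i: "0 \<le> i" "i \<le> int (m s + m (s - 1)) + 1"
  shows "int (HF (fat_ideal s (\<lambda>j. m j + 1) P) i) =
    i + 1 + int (HF (fat_ideal s (\<lambda>j. if j \<le> s - 2 then m j + 1 else m j) P) (i - 1))"
proof -
  obtain n where n: "i = int n" using i(1) nonneg_int_cases by blast
  let ?m' = "\<lambda>j. if j \<le> s - 2 then m j + 1 else m j"
  have "fdim (\<lambda>j. m j + 1) (int n) = fdim (drop2 (s - 1) s (\<lambda>j. m j + 1)) (int n - 1)"
    by (rule line_case) (use s4 i n in auto)
  moreover have "fat_ideal s (drop2 (s - 1) s (\<lambda>j. m j + 1)) P = fat_ideal s ?m' P"
    unfolding fat_ideal_eq by (intro INF_cong refl) (use s4 in \<open>auto simp: drop2_def\<close>)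
  ultimately have f: "fdim (\<lambda>j. m j + 1) i = fdim ?m' (i - 1)" by (simp add: fdim_def fat_def n)
  have "int (v3.dim (forms i :: 'k poly3 set)) = i + 1 + int (v3.dim (forms (i - 1) :: 'k poly3 set))"
    using dim_forms_Suc[where ?'k = 'k, of n] n by simp
  thus ?thesis using f HF_fat[of "\<lambda>j. m j + 1" i] HF_fat[of ?m' "i - 1"] by linarith
qed

text \<open>The eventual value of the Hilbert function of the differentials, compared point by
  point. Over the rationals no subtraction is truncated and halving is exact.\<close>

lemma deg_rat:
  "4 * (of_nat (deg m) :: rat) - of_nat (deg (\<lambda>j. m j + 1)) =
    (\<Sum>j=1..s. (of_nat (m j) + 1) * (3 * of_nat (m j) - 2) / 2)"
proof -
  have "4 * (of_nat ((k + 1) choose 2) :: rat) - of_nat ((k + 1 + 1) choose 2) =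
      (of_nat k + 1) * (3 * of_nat k - 2) / 2" for k
    unfolding of_nat_choose_2 by (simp add: field_simps)
  thus ?thesis unfolding deg_def by (simp only: of_nat_sum sum_distrib_left sum_subtractf[symmetric])
qed

context
  fixes m :: "nat \<Rightarrow> nat"
  assumes m1: "1 \<le> m 1" and mono: "\<And>i j. 1 \<le> i \<Longrightarrow> i \<le> j \<Longrightarrow> j \<le> s \<Longrightarrow> m i \<le> m j"
begin

lemma m_pos: "j \<in> {1..s} \<Longrightarrow> m j \<ge> 1"
  using m1 mono[of 1 j] by simp

lemma pair_le: "a \<in> {1..s} \<Longrightarrow> b \<in> {1..s} \<Longrightarrow> a \<noteq> b \<Longrightarrow> m a + m b \<le> m s + m (s - 1)"
proof (induction a b rule: linorder_wlog)
  case (le a b)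
  hence "1 \<le> a" "a \<le> s - 1" "1 \<le> b" "b \<le> s" by auto
  thus ?case using mono[of a "s - 1"] mono[of b s] by simp
next
  case (sym a b)
  thus ?case by (simp add: add.commute)
qed

lemma HF_top:
  assumes "int (m s + m (s - 1)) \<le> i + 1" "int (\<Sum>j=1..s. m j) \<le> 2 * i + 1" "i \<ge> 0"
  shows "HF (fat_ideal s m P) i = deg m"
proof (rule HF_regular)
  show "int (m a) + int (m b) \<le> i + 1" if "a \<in> {1..s}" "b \<in> {1..s}" "a \<noteq> b" for a b
    using pair_le[OF that] assms(1) by linarith
qed (use assms in simp_all)

text \<open>Raising all multiplicities by one adds 2 to each pair and s to the sum, which shifts the
  two bounds of \<open>HF_top\<close>.\<close>

lemma HF_top_Suc:
  assumes "int (m s + m (s - 1)) \<le> i - 1" "int ((\<Sum>j=1..s. m j) + s) \<le> 2 * i + 1"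
  shows "HF (fat_ideal s (\<lambda>j. m j + 1) P) i = deg (\<lambda>j. m j + 1)"
proof (rule HF_regular)
  show "int (m a + 1) + int (m b + 1) \<le> i + 1" if "a \<in> {1..s}" "b \<in> {1..s}" "a \<noteq> b" for a b
    using pair_le[OF that] assms(1) by linarith
qed (use assms in \<open>simp_all add: sum.distrib\<close>)

text \<open>The index r is not determined. What matters is that the Hilbert function is stationary
  from r on and that r is at most any degree meeting the criterion for independent
  conditions.\<close>

lemma regularity:
  defines "r \<equiv> regularity_index (HF (fat_ideal s m P))"
  shows "r \<ge> 0" "\<And>i. i \<ge> r \<Longrightarrow> HF (fat_ideal s m P) i = deg m"
    "\<And>i. int (m s + m (s - 1)) \<le> i + 1 \<Longrightarrow> int (\<Sum>j=1..s. m j) \<le> 2 * i + 1 \<Longrightarrow> i \<ge> 0 \<Longrightarrow> r \<le> i"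
proof -
  obtain S where S: "(\<Sum>j=1..s. m j) = S" by blast
  let ?N = "int (m s + m (s - 1)) + int S"
  have top: "\<forall>j\<ge>i. HF (fat_ideal s m P) j = deg m"
    if "int (m s + m (s - 1)) \<le> i + 1" "int S \<le> 2 * i + 1" "i \<ge> 0" for i
    using that by (intro allI impI HF_top, unfold S) linarith+
  have N: "\<forall>j\<ge>?N. HF (fat_ideal s m P) j = deg m" by (rule top) simp_all
  have "1 \<in> {1..s}" using s4 by simp
  hence "(m 1 + 1) choose 2 \<le> deg m" unfolding deg_def by (intro member_le_sum) simp_all
  moreover have "(m 1 + 1) choose 2 > 0" using m1 by (simp add: zero_less_binomial)
  moreover have "HF (fat_ideal s m P) (- 1) = 0" by (rule HF_neg) simp
  ultimately have z: "HF (fat_ideal s m P) (- 1) \<noteq> deg m" by linarith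
  note reg = regularity_index_const[where H = "HF (fat_ideal s m P)", OF N z]
  show "r \<ge> 0" unfolding r_def by (rule reg(1))
  show "HF (fat_ideal s m P) i = deg m" if "i \<ge> r" for i using reg(2) that unfolding r_def by blast
  show "r \<le> i" if "int (m s + m (s - 1)) \<le> i + 1" "int (\<Sum>j=1..s. m j) \<le> 2 * i + 1" "i \<ge> 0" for i
    unfolding r_def by (rule reg(3)[OF top[OF that[unfolded S]]])
qed

lemma HF_kaehler_top:
  assumes "int (m s + m (s - 1)) \<le> i - 1" "int ((\<Sum>j=1..s. m j) + s) \<le> 2 * i + 1"
  shows "(of_nat (HF_kaehler (fat_ideal s m P) i) :: rat) =
    (\<Sum>j=1..s. (of_nat (m j) + 1) * (3 * of_nat (m j) - 2) / 2)"
proof -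
  have s: "int s \<ge> 4" using s4 by simp
  \<comment> \<open>Degree i - 1 is covered too: s \<ge> 4 makes the sum of the m j at most 2 (i -
    1) + 1.\<close>
  have "HF (fat_ideal s m P) i = deg m" "HF (fat_ideal s m P) (i - 1) = deg m"
    using assms s by (auto intro!: HF_top simp del: of_nat_sum)
  hence "int (HF_kaehler (fat_ideal s m P) i) + int (deg (\<lambda>j. m j + 1)) = 4 * int (deg m)"
    using HF_kaehler_fat[where m = m and i = i, OF m_pos] HF_top_Suc[OF assms] by simp
  hence "HF_kaehler (fat_ideal s m P) i + deg (\<lambda>j. m j + 1) = 4 * deg m" by linarith
  hence "(of_nat (HF_kaehler (fat_ideal s m P) i + deg (\<lambda>j. m j + 1)) :: rat) = of_nat (4 * deg m)"
    by (simp only:)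
  thus ?thesis unfolding deg_rat[symmetric] by simp
qed

end

end

text \<open>Division by entry 0 stays within a projective point and on the conic; equal normalized
  vectors would mean proportional original ones.\<close>

lemma points_on_conic_normalize:
  fixes P :: "nat \<Rightarrow> 3 \<Rightarrow> 'k::field_char_0"
  assumes "s \<ge> 4" "\<And>j. j \<in> {1..s} \<Longrightarrow> P j 0 \<noteq> 0"
    and distinct: "\<And>i j. i \<in> {1..s} \<Longrightarrow> j \<in> {1..s} \<Longrightarrow> i \<noteq> j \<Longrightarrow> \<not> same_point (P i) (P j)"
    and conic: "nonsingular_conic C" and on_conic: "\<And>j. j \<in> {1..s} \<Longrightarrow> eval3 C (P j) = 0"
  shows "points_on_conic C s (\<lambda>j k. P j k / P j 0)"
proof
  show "nonsingular_conic C" by (rule conic)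
  show "s \<ge> 4" by (rule assms(1))
  fix j assume j: "j \<in> {1..s}"
  show "P j 0 / P j 0 = 1" using assms(2)[OF j] by simp
  have "homogeneous3 (int 2) C" using conic by (simp add: nonsingular_conic_def)
  hence "eval3 C (\<lambda>k. inverse (P j 0) * P j k) = inverse (P j 0) ^ 2 * eval3 C (P j)"
    unfolding eval3_eq_ev3 by (rule id.ev3_scale)
  also have "(\<lambda>k. inverse (P j 0) * P j k) = (\<lambda>k. P j k / P j 0)" by (simp only: divide_inverse mult.commute)
  finally show "eval3 C (\<lambda>k. P j k / P j 0) = 0" using on_conic[OF j] by simp
next
  show "inj_on (\<lambda>j k. P j k / P j 0) {1..s}"
  proof (rule inj_onI, rule ccontr)
    fix i j assume ij: "i \<in> {1..s}" "j \<in> {1..s}" "(\<lambda>k. P i k / P i 0) = (\<lambda>k. P j k / P j 0)" "i \<noteq> j"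
    have "P i k = P i 0 * inverse (P j 0) * P j k" for k
    proof -
      have "P i k / P i 0 = P j k / P j 0" by (rule fun_cong[OF ij(3)])
      hence "P i k = P j k / P j 0 * P i 0" by (simp only: nonzero_divide_eq_eq[OF assms(2)[OF ij(1)]])
      also have "\<dots> = P i 0 * inverse (P j 0) * P j k" by (simp only: divide_inverse mult_ac)
      finally show ?thesis .
    qed
    moreover have "P i 0 * inverse (P j 0) \<noteq> 0" using assms(2)[OF ij(1)] assms(2)[OF ij(2)] by simp
    ultimately have "same_point (P i) (P j)" unfolding same_point_def by blast
    thus False using distinct[OF ij(1,2,4)] by simp
  qed
qed

lemma fat_ideal_normalize:
  assumes "\<And>j. j \<in> {1..s} \<Longrightarrow> P j 0 \<noteq> 0"
  shows "fat_ideal s m (\<lambda>j k. P j k / P j 0) = fat_ideal s m P"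
  unfolding fat_ideal_eq
proof (intro INF_cong refl)
  fix j assume "j \<in> {1..s}"
  hence "inverse (P j 0) \<noteq> 0" using assms by simp
  from point_power_scale[OF this, of "P j" "m j"]
  show "point_power (\<lambda>k. P j k / P j 0) (m j) = point_power (P j) (m j)"
    by (simp only: divide_inverse mult.commute)
qed

theorem theorem9p2:
  fixes s :: nat and m m' :: "nat \<Rightarrow> nat"
    and P :: "nat \<Rightarrow> 3 \<Rightarrow> 'k::field_char_0" and C :: "'k poly3"
    and \<mu> \<rho> :: nat and r :: int
    and IW IY :: "'k poly3 set"
  assumes "s \<ge> 4"
    and points: "\<And>j. j \<in> {1..s} \<Longrightarrow> P j \<noteq> (\<lambda>_. 0)"
    and off_line: "\<And>j. j \<in> {1..s} \<Longrightarrow> P j 0 \<noteq> 0"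
    and distinct: "\<And>i j. i \<in> {1..s} \<Longrightarrow> j \<in> {1..s} \<Longrightarrow> i \<noteq> j \<Longrightarrow> \<not> same_point (P i) (P j)"
    and conic: "nonsingular_conic C"
    and on_conic: "\<And>j. j \<in> {1..s} \<Longrightarrow> eval3 C (P j) = 0"
    and mult_pos: "1 \<le> m 1"
    and mult_mono: "\<And>i j. 1 \<le> i \<Longrightarrow> i \<le> j \<Longrightarrow> j \<le> s \<Longrightarrow> m i \<le> m j"
  defines "IW \<equiv> fat_ideal s m P"
    and "m' \<equiv> (\<lambda>j. if j \<le> s - 2 then m j + 1 else m j)"
  defines "IY \<equiv> fat_ideal s m' P"
    and "r \<equiv> regularity_index (HF IW)"
    and "\<mu> \<equiv> (\<Sum>j=1..s. m j) + s"
    and "\<rho> \<equiv> m s + m (s - 1)"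
  shows "(\<mu> \<ge> 2 * \<rho> + 4 \<longrightarrow> (\<forall>i :: int.
      (i \<ge> \<lfloor>of_nat \<mu> / 2 :: rat\<rfloor> \<longrightarrow>
        (of_nat (HF_kaehler IW i) :: rat) =
          (\<Sum>j=1..s. (of_nat (m j) + 1) * (3 * of_nat (m j) - 2) / 2)) \<and>
      (r + 2 \<le> i \<and> i < \<lfloor>of_nat \<mu> / 2 :: rat\<rfloor> \<longrightarrow>
        int (HF_kaehler IW i) = 3 * (\<Sum>j=1..s. int ((m j + 1) choose 2)) - 2 * i - 1) \<and>
      (i = r + 1 \<longrightarrow>
        int (HF_kaehler IW i) =
          4 * (\<Sum>j=1..s. int ((m j + 1) choose 2)) - 2 * i - 1 - int (HF IW (i - 2))) \<and>
      (0 \<le> i \<and> i \<le> r \<longrightarrow>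
        int (HF_kaehler IW i) =
          int (HF IW i) + 3 * int (HF IW (i - 1)) - int (HF IW (i - 2)) - 2 * i - 1)))
    \<and> (\<mu> \<le> 2 * \<rho> + 3 \<longrightarrow> (\<forall>i :: int.
      (i \<ge> int \<rho> + 1 \<longrightarrow>
        (of_nat (HF_kaehler IW i) :: rat) =
          (\<Sum>j=1..s. (of_nat (m j) + 1) * (3 * of_nat (m j) - 2) / 2)) \<and>
      (r + 1 \<le> i \<and> i \<le> int \<rho> \<longrightarrow>
        int (HF_kaehler IW i) =
          4 * (\<Sum>j=1..s. int ((m j + 1) choose 2)) - i - 1 - int (HF IY (i - 1))) \<and>
      (0 \<le> i \<and> i \<le> r \<longrightarrow>
        int (HF_kaehler IW i) =
          int (HF IW i) + 3 * int (HF IW (i - 1)) - int (HF IY (i - 1)) - i - 1)))"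
proof -
  define P' where "P' = (\<lambda>j k. P j k / P j 0)"
  interpret points_on_conic C s P'
    unfolding P'_def using assms by (intro points_on_conic_normalize)
  have P': "fat_ideal s n P = fat_ideal s n P'" for n
    unfolding P'_def by (rule fat_ideal_normalize[symmetric]) (rule off_line)
  have IW: "IW = fat_ideal s m P'" unfolding IW_def by (rule P')
  have IY: "IY = fat_ideal s m' P'" unfolding IY_def by (rule P')
  have m_pos: "m j \<ge> 1" if "j \<in> {1..s}" for j
    using that mult_pos mult_mono[of 1 j] by simp
  have s: "int s \<ge> 4" using assms(1) by simp
  have sum: "int (\<Sum>j=1..s. m j) = int \<mu> - int s" unfolding \<mu>_def by simp
  have "s \<in> {1..s}" "s - 1 \<in> {1..s}" using assms(1) by auto
  hence \<rho>: "\<rho> \<ge> 2" unfolding \<rho>_def using m_pos[of s] m_pos[of "s - 1"] by linarith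
  have r0: "r \<ge> 0" unfolding r_def IW by (rule regularity(1)[where m = m, OF mult_pos mult_mono])
  have r_deg: "int (HF IW i) = int (deg m)" if "i \<ge> r" for i
    using regularity(2)[where m = m, OF mult_pos mult_mono] that unfolding r_def IW by simp
  have r_le: "r \<le> i" if "int \<rho> \<le> i + 1" "int \<mu> - int s \<le> 2 * i + 1" "i \<ge> 0" for i
    unfolding r_def IW
    by (rule regularity(3)[where m = m, OF mult_pos mult_mono that(1)[unfolded \<rho>_def] that(2)[folded sum] that(3)])
  have top: "(of_nat (HF_kaehler IW i) :: rat) =
      (\<Sum>j=1..s. (of_nat (m j) + 1) * (3 * of_nat (m j) - 2) / 2)"
    if "int \<rho> \<le> i - 1" "int \<mu> \<le> 2 * i + 1" for i
    unfolding IW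
    by (rule HF_kaehler_top[where m = m, OF mult_pos mult_mono that[unfolded \<rho>_def \<mu>_def]])
  note kaehler = HF_kaehler_fat[where m = m, OF m_pos, folded IW]
  have by_conic: "int (HF_kaehler IW i) =
      3 * int (HF IW (i - 1)) + int (HF IW i) - 2 * i - 1 - int (HF IW (i - 2))"
    if "0 \<le> i" "2 * i < int \<mu>" for i
    using kaehler[of i] HF_conic[where m = m, OF m_pos that[unfolded \<mu>_def]] unfolding IW by linarith
  have by_line: "int (HF_kaehler IW i) =
      3 * int (HF IW (i - 1)) + int (HF IW i) - i - 1 - int (HF IY (i - 1))"
    if "0 \<le> i" "i \<le> int \<rho> + 1" for i
    using kaehler[of i] HF_line[where m = m, OF that[unfolded \<rho>_def]] unfolding IW IY m'_def by linarith
  have floor: "\<lfloor>of_nat \<mu> / 2 :: rat\<rfloor> = int \<mu> div 2"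
    using floor_divide_of_nat_eq[of \<mu> 2, where ?'a = rat] by (simp add: zdiv_int)
  have deg: "(\<Sum>j=1..s. int ((m j + 1) choose 2)) = int (deg m)" by (simp add: deg_def)
  show ?thesis
    unfolding floor deg
  proof (intro conjI impI allI)
    fix i :: int
    assume \<mu>: "\<mu> \<ge> 2 * \<rho> + 4"
    \<comment> \<open>At q = (\<mu> - 3) div 2 the criterion bounding r holds, because \<mu> \<ge> 2
      \<rho> + 4 and s \<ge> 4. It follows that 2 (r + 1) < \<mu>, so degree r + 1 still lies in the
      conic range.\<close>
    obtain q where q: "2 * q \<le> int \<mu> - 3" "int \<mu> - 3 \<le> 2 * q + 1"
      by (rule that[of "(int \<mu> - 3) div 2"]) linarith+
    have "r \<le> q" by (rule r_le) (use q \<mu> s in linarith)+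
    hence r: "2 * r + 2 < int \<mu>" using q(1) by linarith
    show "(of_nat (HF_kaehler IW i) :: rat) =
        (\<Sum>j=1..s. (of_nat (m j) + 1) * (3 * of_nat (m j) - 2) / 2)" if "i \<ge> int \<mu> div 2"
      using that \<mu> by (intro top) linarith+
    \<comment> \<open>From r + 2 on, the Hilbert function of W is stationary in degrees i, i - 1 and
      i - 2 alike; in degree r + 1 the term for i - 2 = r - 1 has to remain.\<close>
    show "int (HF_kaehler IW i) = 3 * int (deg m) - 2 * i - 1" if "r + 2 \<le> i \<and> i < int \<mu> div 2"
      using that by_conic[of i] r0 r_deg[of i] r_deg[of "i - 1"] r_deg[of "i - 2"] by linarith
    show "int (HF_kaehler IW i) = 4 * int (deg m) - 2 * i - 1 - int (HF IW (i - 2))" if "i = r + 1"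
      using that by_conic[of i] r r0 r_deg[of i] r_deg[of "i - 1"] by linarith
    show "int (HF_kaehler IW i) =
        int (HF IW i) + 3 * int (HF IW (i - 1)) - int (HF IW (i - 2)) - 2 * i - 1" if "0 \<le> i \<and> i \<le> r"
      using that by_conic[of i] r by linarith
  next
    fix i :: int
    assume \<mu>: "\<mu> \<le> 2 * \<rho> + 3"
    \<comment> \<open>Since \<mu> \<le> 2 \<rho> + 3 and s \<ge> 4, the criterion bounding r already
      holds in degree \<rho>, so all degrees up to r lie in the line range.\<close>
    have r: "r \<le> int \<rho>" by (rule r_le) (use \<mu> s in linarith)+
    show "(of_nat (HF_kaehler IW i) :: rat) =
        (\<Sum>j=1..s. (of_nat (m j) + 1) * (3 * of_nat (m j) - 2) / 2)" if "i \<ge> int \<rho> + 1"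
      using that \<mu> by (intro top) linarith+
    show "int (HF_kaehler IW i) = 4 * int (deg m) - i - 1 - int (HF IY (i - 1))" if "r + 1 \<le> i \<and> i \<le> int \<rho>"
      using that by_line[of i] r0 r_deg[of i] r_deg[of "i - 1"] by linarith
    show "int (HF_kaehler IW i) =
        int (HF IW i) + 3 * int (HF IW (i - 1)) - int (HF IY (i - 1)) - i - 1" if "0 \<le> i \<and> i \<le> r"
      using that by_line[of i] r by linarith
  qed
qed

end
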